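(* Let $d\ge3$. For $c\in(0,\infty)$ let $$m_c:=\inf\{\mathcal{H}(u): u\in H^1(\mathbb{R}^d),\ \mathcal{M}(u)=c,\ \mathcal{K}(u)=0\},$$ where $\mathcal{M}(u)=\|u\|_2^2$, $\mathcal{H}(u)=\frac12\|\nabla u\|_2^2+\frac1{2_*}\|u\|_{2_*}^{2_*}-\frac1{2^*}\|u\|_{2^*}^{2^*}$ and $\mathcal{K}(u)=\|\nabla u\|_2^2+\frac{d}{d+2}\|u\|_{2_*}^{2_*}-\|u\|_{2^*}^{2^*}$. Then for every $c\in(0,\infty)$ one has $m_c=\mathcal{H}^*(W)$, and the infimum defining $m_c$ is not attained.
   Context: Notation: $2_*=2+\frac4d$, $2^*=2+\frac4{d-2}$, $\|\cdot\|_p$ is the $L^p(\mathbb{R}^d)$-norm. $W(x)=\big(1+\frac{|x|^2}{d(d-2)}\big)^{-\frac{d-2}2}$ and $\mathcal{H}^*(u)=\frac12\|\nabla u\|_2^2-\frac1{2^*}\|u\|_{2^*}^{2^*}$. The functionals are those of the defocusing-focusing regime ($\mu_1=-1$, $\mu_2=1$) of $i\partial_tu+\Delta u+\mu_1|u|^{4/d}u+\mu_2|u|^{4/(d-2)}u=0$. *)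

theory Defs
  imports "HOL-Analysis.Analysis"
begin

text \<open>
  The space dimension is \<open>d = CARD('n)\<close>, and functions are complex-valued functions on \<open>real ^ 'n\<close>.
  Elements of Lebesgue and Sobolev spaces are represented by Lebesgue measurable functions;
  everything below is invariant under changing such a function on a null set.
\<close>

definition two_lower :: "nat \<Rightarrow> real" where
  "two_lower d = 2 + 4 / real d"

definition two_upper :: "nat \<Rightarrow> real" where
  "two_upper d = 2 + 4 / (real d - 2)"


section \<open>Lebesgue spaces\<close>

definition in_Lp :: "real \<Rightarrow> (real ^ 'n::finite \<Rightarrow> 'b::euclidean_space) \<Rightarrow> bool" where
  "in_Lp p f \<longleftrightarrow>
     f \<in> borel_measurable lebesgue \<and> integrable lebesgue (\<lambda>x. norm (f x) powr p)"

text \<open>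
  The Bochner integral of a non-integrable function is \<open>0\<close>, so \<open>Lp_norm p f\<close> is meaningful only
  if \<open>in_Lp p f\<close>.  For \<open>d \<ge> 3\<close> the functionals below evaluate it only where this holds, by the
  Sobolev embedding for functions in the Sobolev space and by direct computation for
  \<open>ground_state\<close>.
\<close>

definition Lp_norm :: "real \<Rightarrow> (real ^ 'n::finite \<Rightarrow> 'b::euclidean_space) \<Rightarrow> real" where
  "Lp_norm p f = (LINT x|lebesgue. norm (f x) powr p) powr (1 / p)"

definition locally_integrable :: "(real ^ 'n::finite \<Rightarrow> 'b::euclidean_space) \<Rightarrow> bool" where
  "locally_integrable f \<longleftrightarrow> (\<forall>K. compact K \<longrightarrow> set_integrable lebesgue K f)"


section \<open>Weak gradients and the Sobolev space\<close>

definition partial_deriv :: "'n::finite \<Rightarrow> (real ^ 'n \<Rightarrow> real) \<Rightarrow> real ^ 'n \<Rightarrow> real" where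
  "partial_deriv i f x = frechet_derivative f (at x) (axis i 1)"

primrec Ck :: "nat \<Rightarrow> (real ^ 'n::finite \<Rightarrow> real) \<Rightarrow> bool" where
  "Ck 0 f \<longleftrightarrow> continuous_on UNIV f"
| "Ck (Suc k) f \<longleftrightarrow> (\<forall>x. f differentiable (at x)) \<and> (\<forall>i. Ck k (partial_deriv i f))"

definition test_function :: "(real ^ 'n::finite \<Rightarrow> real) \<Rightarrow> bool" where
  "test_function \<phi> \<longleftrightarrow> (\<forall>k. Ck k \<phi>) \<and> compact (closure {x. \<phi> x \<noteq> 0})"

text \<open>
  Real-valued test functions suffice for complex-valued \<open>u\<close>, since the identity is linear in the
  test function.  The norm of \<open>g x :: complex ^ 'n\<close> is \<open>sqrt (\<Sum>i\<in>UNIV. (cmod (g x $ i))\<^sup>2)\<close>.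
\<close>

definition has_weak_gradient ::
  "(real ^ 'n::finite \<Rightarrow> complex) \<Rightarrow> (real ^ 'n \<Rightarrow> complex ^ 'n) \<Rightarrow> bool" where
  "has_weak_gradient u g \<longleftrightarrow>
     locally_integrable u \<and> locally_integrable g \<and>
     (\<forall>\<phi> i. test_function \<phi> \<longrightarrow>
        (LINT x|lebesgue. partial_deriv i \<phi> x *\<^sub>R u x) = - (LINT x|lebesgue. \<phi> x *\<^sub>R (g x $ i)))"

text \<open>A weak gradient is unique up to null sets, so its \<open>Lp_norm\<close> does not depend on the choice.\<close>

definition weak_gradient :: "(real ^ 'n::finite \<Rightarrow> complex) \<Rightarrow> real ^ 'n \<Rightarrow> complex ^ 'n" where
  "weak_gradient u = (SOME g. has_weak_gradient u g)"

definition sobolev_H1 :: "(real ^ 'n::finite \<Rightarrow> complex) set" where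
  "sobolev_H1 = {u. in_Lp 2 u \<and> (\<exists>g. has_weak_gradient u g \<and> in_Lp 2 g)}"


section \<open>The functionals and the variational problem\<close>

definition mass :: "(real ^ 'n::finite \<Rightarrow> complex) \<Rightarrow> real" where
  "mass u = (Lp_norm 2 u)\<^sup>2"

definition energy :: "(real ^ 'n::finite \<Rightarrow> complex) \<Rightarrow> real" where
  "energy u =
     1 / 2 * (Lp_norm 2 (weak_gradient u))\<^sup>2
     + 1 / two_lower CARD('n) * Lp_norm (two_lower CARD('n)) u powr two_lower CARD('n)
     - 1 / two_upper CARD('n) * Lp_norm (two_upper CARD('n)) u powr two_upper CARD('n)"

definition virial :: "(real ^ 'n::finite \<Rightarrow> complex) \<Rightarrow> real" where
  "virial u =
     (Lp_norm 2 (weak_gradient u))\<^sup>2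
     + real CARD('n) / (real CARD('n) + 2)
         * Lp_norm (two_lower CARD('n)) u powr two_lower CARD('n)
     - Lp_norm (two_upper CARD('n)) u powr two_upper CARD('n)"

definition critical_energy :: "(real ^ 'n::finite \<Rightarrow> complex) \<Rightarrow> real" where
  "critical_energy u =
     1 / 2 * (Lp_norm 2 (weak_gradient u))\<^sup>2
     - 1 / two_upper CARD('n) * Lp_norm (two_upper CARD('n)) u powr two_upper CARD('n)"

text \<open>
  For \<open>d = 3, 4\<close> this function is not in \<open>L\<^sup>2\<close>; it is locally integrable with a
  square-integrable weak gradient, which is all that \<open>critical_energy\<close> needs.
\<close>

definition ground_state :: "real ^ 'n::finite \<Rightarrow> complex" where
  "ground_state x = complex_of_real
     ((1 + (norm x)\<^sup>2 / (real CARD('n) * (real CARD('n) - 2))) powr (- (real CARD('n) - 2) / 2))"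

definition constraint_set :: "real \<Rightarrow> (real ^ 'n::finite \<Rightarrow> complex) set" where
  "constraint_set c = {u \<in> sobolev_H1. mass u = c \<and> virial u = 0}"

text \<open>
  The infimum is taken in the extended reals, where it is \<open>\<infinity>\<close> for an empty set and \<open>-\<infinity>\<close> for
  a set that is unbounded below; the real-valued \<open>Inf\<close> is unspecified in these cases.
\<close>

definition min_energy :: "'n::finite itself \<Rightarrow> real \<Rightarrow> ereal" where
  "min_energy _ c = (INF u \<in> (constraint_set c :: (real ^ 'n \<Rightarrow> complex) set). ereal (energy u))"

end

theory Submission
  imports Defs
begin

text \<open>
On the constraint \<open>virial u = 0\<close> the energy equals \<open>1/d\<close> times the critical norm of \<open>u\<close> to
the power \<open>2\<^sup>*\<close>, and this quantity strictly exceeds the squared norm of the gradient. The sharp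
Sobolev inequality, whose equality case is the ground state, therefore gives the lower bound and
its strictness. Conversely, a mass-preserving rescaling puts any profile on the constraint, with
an energy that tends to the critical energy of the ground state along truncated ground states
carrying a wide plateau of large mass.

The sharp Sobolev inequality is proved by mass transport in the spirit of Cordero-Erausquin,
Nazaret and Villani, with the triangular Knothe map in place of the Brenier map: \<open>u\<close> to the power
\<open>2\<^sup>*\<close> is transported to the Cauchy-like density \<open>(1 + |y|\<^sup>2)\<^sup>-\<^sup>d\<close>, the arithmetic-geometric mean
inequality bounds the divergence of the map from below, and an integration by parts produces the
gradient of \<open>u\<close>. The conditional densities of the target are one-dimensional densities of the
same kind, so that the map is explicit up to one-dimensional distribution functions.
\<close>

section \<open>One-dimensional slices of Lebesgue integrals\<close>

text \<open>The sharp constant survives only if every reduction is lossless. Complex-valued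
  functions are therefore not estimated through their real and imaginary parts separately but
  through a regularised modulus; cutoffs and mollifiers do not increase the gradient norm in the
  limit, and the critical norm passes to the limit by Fatou. A triangular map serves as well as the
  Brenier map because its Jacobian determinant is the product of the diagonal entries and its
  divergence is their sum, exactly the two quantities of the arithmetic-geometric mean inequality.
  For the chosen target the Jacobian equation reads det = f Z (1 + |T|^2)^N, so the N-th root is (f
  Z)^(1/N) times 1 + |T|^2. Weighted with f, this factor and the |T|^2 left over by Young's
  inequality are governed by the same second moment of the target, a product of one-dimensional
  integrals. Sharpness is checked by integrating the ground state directly: the same one-dimensional
  integrals give the same number.\<close>

definition upd :: "real ^ 'n::finite \<Rightarrow> 'n \<Rightarrow> real \<Rightarrow> real ^ 'n" where
  "upd x i t = x + (t - x $ i) *\<^sub>R axis i 1"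

lemma upd_nth: "upd x i t $ j = (if j = i then t else x $ j)"
  by (simp add: upd_def axis_def)

lemma upd_same [simp]: "upd x i t $ i = t"
  by (simp add: upd_nth)

lemma upd_other [simp]: "j \<noteq> i \<Longrightarrow> upd x i t $ j = x $ j"
  by (simp add: upd_nth)

lemma upd_upd [simp]: "upd (upd x i s) i t = upd x i t"
  by (simp add: vec_eq_iff upd_nth)

lemma upd_id [simp]: "upd x i (x $ i) = x"
  by (simp add: vec_eq_iff upd_nth)

lemma continuous_on_upd [continuous_intros]:
  fixes f :: "'a::topological_space \<Rightarrow> real ^ 'n::finite"
  shows "continuous_on S f \<Longrightarrow> continuous_on S g \<Longrightarrow> continuous_on S (\<lambda>x. upd (f x) i (g x))"
  unfolding upd_def by (intro continuous_intros)

lemma borel_measurable_vec_nth' [measurable]: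
  "f \<in> borel_measurable M \<Longrightarrow> (\<lambda>x. (f x :: real ^ 'n::finite) $ i) \<in> borel_measurable M"
  by (rule borel_measurable_continuous_on[of "\<lambda>v. v $ i"]) (auto intro!: continuous_intros)

lemma measurable_upd [measurable (raw)]:
  fixes f :: "'a \<Rightarrow> real ^ 'n::finite"
  assumes [measurable]: "f \<in> borel_measurable M" "g \<in> borel_measurable M"
  shows "(\<lambda>x. upd (f x) i (g x)) \<in> borel_measurable M"
  unfolding upd_def by measurable

lemma nn_integral_lborel_translate:
  fixes h :: "'a::euclidean_space \<Rightarrow> ennreal"
  assumes [measurable]: "h \<in> borel_measurable borel"
  shows "(\<integral>\<^sup>+x. h (x + c) \<partial>lborel) = (\<integral>\<^sup>+x. h x \<partial>lborel)"
proof -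
  have "(\<integral>\<^sup>+x. h x \<partial>lborel) = (\<integral>\<^sup>+x. h x \<partial>distr lborel borel ((+) c))"
    by (simp add: lborel_distr_plus)
  also have "\<dots> = (\<integral>\<^sup>+x. h (c + x) \<partial>lborel)"
    by (rule nn_integral_distr) auto
  finally show ?thesis by (simp add: add.commute)
qed

lemma
  fixes h :: "'a::euclidean_space \<Rightarrow> 'b::{banach, second_countable_topology}"
  assumes "integrable lborel h"
  shows integrable_lborel_translate: "integrable lborel (\<lambda>x. h (x + c))"
    and integral_lborel_translate: "(LINT x|lborel. h (x + c)) = (LINT x|lborel. h x)"
proof -
  have [measurable]: "h \<in> borel_measurable borel" using assms by auto
  have "integrable (distr lborel borel ((+) c)) h" using assms by (simp add: lborel_distr_plus)
  then have "integrable lborel (\<lambda>x. h (c + x))" by (subst (asm) integrable_distr_eq) auto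
  then show "integrable lborel (\<lambda>x. h (x + c))" by (simp add: add.commute)
  have "(LINT x|lborel. h x) = (LINT x|distr lborel borel ((+) c). h x)"
    by (simp add: lborel_distr_plus)
  also have "\<dots> = (LINT x|lborel. h (c + x))" by (rule integral_distr) auto
  finally show "(LINT x|lborel. h (x + c)) = (LINT x|lborel. h x)" by (simp add: add.commute)
qed

text \<open>Fubini in one coordinate without leaving \<open>real ^ 'n\<close>: the inner integral no
  longer depends on coordinate \<open>i\<close>, so this coordinate is confined to an interval of
  length one. The proof averages over translations along the axis; the translates of the unit
  interval integrate to one at every point.\<close>

lemma nn_integral_strip:
  fixes h :: "real ^ 'n::finite \<Rightarrow> ennreal"
  assumes h [measurable]: "h \<in> borel_measurable borel"
  shows "(\<integral>\<^sup>+x. h x \<partial>lborel) =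
    (\<integral>\<^sup>+x. indicator {0..1::real} (x $ i) * (\<integral>\<^sup>+t. h (upd x i t) \<partial>lborel) \<partial>lborel)"
proof -
  let ?e = "axis i 1 :: real ^ 'n"
  have unit: "(\<integral>\<^sup>+s. indicator {0..1::real} (r - s) \<partial>lborel) = 1" for r
  proof -
    have "(\<integral>\<^sup>+s. indicator {0..1::real} (r - s) \<partial>lborel) = (\<integral>\<^sup>+s. indicator {r - 1..r} s \<partial>lborel)"
      by (intro nn_integral_cong) (auto simp: indicator_def)
    then show ?thesis by simp
  qed
  have "(\<integral>\<^sup>+x. indicator {0..1::real} (x $ i) * (\<integral>\<^sup>+t. h (upd x i t) \<partial>lborel) \<partial>lborel)
      = (\<integral>\<^sup>+x. \<integral>\<^sup>+s. indicator {0..1::real} (x $ i) * h (x + s *\<^sub>R ?e) \<partial>lborel \<partial>lborel)"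
  proof (rule nn_integral_cong)
    fix x :: "real ^ 'n"
    have "(\<integral>\<^sup>+t. h (upd x i t) \<partial>lborel) = (\<integral>\<^sup>+t. h (upd x i (t + x $ i)) \<partial>lborel)"
      by (rule nn_integral_lborel_translate[symmetric]) simp
    also have "\<dots> = (\<integral>\<^sup>+s. h (x + s *\<^sub>R ?e) \<partial>lborel)"
      by (simp add: upd_def)
    finally show "indicator {0..1::real} (x $ i) * (\<integral>\<^sup>+t. h (upd x i t) \<partial>lborel)
        = (\<integral>\<^sup>+s. indicator {0..1::real} (x $ i) * h (x + s *\<^sub>R ?e) \<partial>lborel)"
      by (simp add: nn_integral_cmult)
  qed
  also have "\<dots> = (\<integral>\<^sup>+s. \<integral>\<^sup>+x. indicator {0..1::real} (x $ i) * h (x + s *\<^sub>R ?e) \<partial>lborel \<partial>lborel)"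
    by (rule lborel_pair.Fubini') simp
  also have "\<dots> = (\<integral>\<^sup>+s. \<integral>\<^sup>+x. indicator {0..1::real} (x $ i - s) * h x \<partial>lborel \<partial>lborel)"
  proof (rule nn_integral_cong)
    fix s
    show "(\<integral>\<^sup>+x. indicator {0..1::real} (x $ i) * h (x + s *\<^sub>R ?e) \<partial>lborel) =
        (\<integral>\<^sup>+x. indicator {0..1::real} (x $ i - s) * h x \<partial>lborel)"
      using nn_integral_lborel_translate[of "\<lambda>x. indicator {0..1::real} (x $ i - s) * h x" "s *\<^sub>R ?e"]
      by (simp add: axis_def)
  qed
  also have "\<dots> = (\<integral>\<^sup>+x. \<integral>\<^sup>+s. indicator {0..1::real} (x $ i - s) * h x \<partial>lborel \<partial>lborel)"
    by (rule lborel_pair.Fubini') simp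
  also have "\<dots> = (\<integral>\<^sup>+x. h x \<partial>lborel)"
    by (simp add: nn_integral_multc unit)
  finally show ?thesis by simp
qed

text \<open>
  The fundamental theorem of calculus along segments of length one, integrated over the whole
  space: translation invariance makes the left-hand side vanish, so no boundary terms appear.
\<close>

lemma line_integration_by_parts:
  fixes p D E :: "real ^ 'n::finite \<Rightarrow> real"
  assumes p: "integrable lborel p" and E: "integrable lborel E"
    and D [measurable]: "D \<in> borel_measurable borel" and D0: "\<And>x. 0 \<le> D x"
    and deriv: "\<And>x. ((\<lambda>s. p (x + s *\<^sub>R axis i 1)) has_real_derivative (D x + E x)) (at 0)"
    and contD: "\<And>x. continuous_on UNIV (\<lambda>s. D (x + s *\<^sub>R axis i 1))"
    and contE: "\<And>x. continuous_on UNIV (\<lambda>s. E (x + s *\<^sub>R axis i 1))"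
  shows "integrable lborel D" and "(LINT x|lborel. D x) = - (LINT x|lborel. E x)"
proof -
  let ?e = "axis i 1 :: real ^ 'n"
  have [measurable]: "p \<in> borel_measurable borel" "E \<in> borel_measurable borel" using p E by auto
  have deriv': "((\<lambda>s. p (x + s *\<^sub>R ?e)) has_real_derivative (D (x + r *\<^sub>R ?e) + E (x + r *\<^sub>R ?e))) (at r)" for x r
  proof -
    have "((\<lambda>s. p (x + (s + r) *\<^sub>R ?e)) has_real_derivative (D (x + r *\<^sub>R ?e) + E (x + r *\<^sub>R ?e))) (at 0)"
      using deriv[of "x + r *\<^sub>R ?e"] by (simp add: algebra_simps)
    then show ?thesis using DERIV_shift[of "\<lambda>s. p (x + s *\<^sub>R ?e)" _ 0 r] by simp
  qed
  \<comment> \<open>Averages over unit segments. By translation invariance they have the same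
    integrals as \<open>E\<close> and \<open>D\<close>, and the increments of \<open>p\<close> along
    the segments integrate to zero.\<close>
  define Eb where "Eb x = (LINT r|lborel. indicator {0..1} r * E (x + r *\<^sub>R ?e))" for x
  define Db where "Db x = (LINT r|lborel. indicator {0..1} r * D (x + r *\<^sub>R ?e))" for x
  have intE: "integrable lborel (\<lambda>r. indicator {0..1} r * E (x + r *\<^sub>R ?e))"
    and intD: "integrable lborel (\<lambda>r. indicator {0..1} r * D (x + r *\<^sub>R ?e))" for x
    using borel_integrable_compact[of "{0..1::real}" "\<lambda>r. E (x + r *\<^sub>R ?e)"]
      borel_integrable_compact[of "{0..1::real}" "\<lambda>r. D (x + r *\<^sub>R ?e)"]
      continuous_on_subset[OF contE] continuous_on_subset[OF contD]
    by auto
  have FTC: "Db x = p (x + ?e) - p x - Eb x" for x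
  proof -
    have "(LINT r|lborel. (D (x + r *\<^sub>R ?e) + E (x + r *\<^sub>R ?e)) * indicator {0..1} r)
        = p (x + 1 *\<^sub>R ?e) - p (x + 0 *\<^sub>R ?e)"
      by (rule integral_FTC_Icc_real)
        (use deriv' contE contD in \<open>auto intro!: continuous_intros simp: continuous_on_eq_continuous_at\<close>)
    moreover have "(LINT r|lborel. (D (x + r *\<^sub>R ?e) + E (x + r *\<^sub>R ?e)) * indicator {0..1} r) = Db x + Eb x"
      unfolding Db_def Eb_def using intE intD
      by (subst Bochner_Integration.integral_add[symmetric]) (auto simp: algebra_simps)
    ultimately show ?thesis by simp
  qed
  have intEp: "integrable (lborel \<Otimes>\<^sub>M lborel) (\<lambda>(r, x). indicator {0..1::real} r * E (x + r *\<^sub>R ?e))"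
  proof (rule lborel_pair.Fubini_integrable)
    have "(LINT x|lborel. norm (case (r, x) of (r, x) \<Rightarrow> indicator {0..1::real} r * E (x + r *\<^sub>R ?e)))
      = indicator {0..1::real} r * (LINT x|lborel. \<bar>E x\<bar>)" for r
      using integral_lborel_translate[OF integrable_abs[OF E], of "r *\<^sub>R ?e"]
      by (simp add: abs_mult)
    moreover have "integrable lborel (\<lambda>r. indicator {0..1::real} r * (LINT x|lborel. \<bar>E x\<bar>))"
      by (intro integrable_mult_left) auto
    ultimately show "integrable lborel (\<lambda>r. LINT x|lborel.
        norm (case (r, x) of (r, x) \<Rightarrow> indicator {0..1::real} r * E (x + r *\<^sub>R ?e)))" by simp
    show "AE r in lborel. integrable lborel (\<lambda>x. case (r, x) of (r, x) \<Rightarrow> indicator {0..1::real} r * E (x + r *\<^sub>R ?e))"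
      using integrable_lborel_translate[OF E] by auto
  qed simp
  have intEb: "integrable lborel Eb"
    unfolding Eb_def using lborel_pair.integrable_snd[OF intEp] by simp
  have "(LINT x|lborel. Eb x) = (LINT r|lborel. LINT x|lborel. indicator {0..1::real} r * E (x + r *\<^sub>R ?e))"
    unfolding Eb_def by (rule lborel_pair.Fubini_integral[symmetric, OF intEp, symmetric])
  also have "\<dots> = (LINT r|lborel. indicator {0..1::real} r * (LINT x|lborel. E x))"
    using integral_lborel_translate[OF E] by simp
  finally have Eb: "(LINT x|lborel. Eb x) = (LINT x|lborel. E x)" by simp
  have intDb: "integrable lborel Db"
    unfolding FTC using intEb p integrable_lborel_translate[OF p] by auto
  have "(LINT x|lborel. Db x) = - (LINT x|lborel. E x)"
    unfolding FTC using intEb p integrable_lborel_translate[OF p] integral_lborel_translate[OF p] Eb by simp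
  \<comment> \<open>Integrability of \<open>D\<close> is not known yet, so from here on the argument
    uses nonnegative integrals: the sign of \<open>D\<close> permits Tonelli, and finiteness of the
    result yields integrability.\<close>
  then have "(\<integral>\<^sup>+x. ennreal (Db x) \<partial>lborel) = ennreal (- (LINT x|lborel. E x))"
  proof -
    have "0 \<le> Db x" for x unfolding Db_def using D0 by (intro Bochner_Integration.integral_nonneg) auto
    then show ?thesis
      using nn_integral_eq_integral[OF intDb] \<open>(LINT x|lborel. Db x) = - (LINT x|lborel. E x)\<close> by simp
  qed
  moreover have "(\<integral>\<^sup>+x. ennreal (Db x) \<partial>lborel)
      = (\<integral>\<^sup>+x. \<integral>\<^sup>+r. ennreal (indicator {0..1} r * D (x + r *\<^sub>R ?e)) \<partial>lborel \<partial>lborel)"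
    unfolding Db_def using intD D0 by (intro nn_integral_cong nn_integral_eq_integral[symmetric]) auto
  moreover have "\<dots> = (\<integral>\<^sup>+r. \<integral>\<^sup>+x. ennreal (indicator {0..1} r * D (x + r *\<^sub>R ?e)) \<partial>lborel \<partial>lborel)"
    by (rule lborel_pair.Fubini') simp
  moreover have "\<dots> = (\<integral>\<^sup>+r. indicator {0..1::real} r * (\<integral>\<^sup>+x. ennreal (D x) \<partial>lborel) \<partial>lborel)"
  proof (rule nn_integral_cong)
    fix r :: real
    show "(\<integral>\<^sup>+x. ennreal (indicator {0..1} r * D (x + r *\<^sub>R ?e)) \<partial>lborel)
        = indicator {0..1::real} r * (\<integral>\<^sup>+x. ennreal (D x) \<partial>lborel)"
      using nn_integral_lborel_translate[of "\<lambda>x. ennreal (D x)" "r *\<^sub>R ?e"]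
      by (auto split: split_indicator)
  qed
  moreover have "\<dots> = (\<integral>\<^sup>+x. ennreal (D x) \<partial>lborel)"
    by (simp add: nn_integral_multc)
  ultimately have nnD: "(\<integral>\<^sup>+x. ennreal (D x) \<partial>lborel) = ennreal (- (LINT x|lborel. E x))" by simp
  then show "integrable lborel D"
    by (intro integrableI_nonneg) (auto simp: D0)
  moreover have "0 \<le> - (LINT x|lborel. E x)"
    using \<open>(LINT x|lborel. Db x) = - (LINT x|lborel. E x)\<close> D0
    by (metis (no_types, lifting) Db_def Bochner_Integration.integral_nonneg mult_nonneg_nonneg indicator_pos_le)
  ultimately show "(LINT x|lborel. D x) = - (LINT x|lborel. E x)"
    using nnD by (subst integral_eq_nn_integral) (auto simp: D0)
qed


section \<open>Integrals of powers of brackets\<close>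

text \<open>A Beta integral, equal to \<open>sqrt pi * Gamma (b - 1/2) / Gamma b\<close> for b >
  1/2; the proof works with its positivity and its recurrence in \<open>b\<close>.\<close>

definition bessel :: "real \<Rightarrow> real" where
  "bessel b = (LINT s|lborel. (1 + s\<^sup>2) powr - b)"

lemma one_plus_sq_pos [simp]: "0 < 1 + (s::real)\<^sup>2"
  by (simp add: add_pos_nonneg)

lemma one_plus_sq_nonzero [simp]: "1 + (s::real)\<^sup>2 \<noteq> 0"
  using one_plus_sq_pos[of s] by linarith

text \<open>Comparison with \<open>(1 + |s|) powr (- 2 * b)\<close>, whose primitive is explicit,
  through (1 + |s|)^2 \<le> 2 (1 + s^2).\<close>

lemma integrable_bessel:
  assumes "1 / 2 < b"
  shows "integrable lborel (\<lambda>s::real. (1 + s\<^sup>2) powr - b)"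
proof -
  define h where "h s = indicator {0..} s * (1 + s) powr (- 2 * b)" for s :: real
  define F where "F s = - ((1 + s) powr (1 - 2 * b)) / (2 * b - 1)" for s :: real
  have "(\<integral>\<^sup>+s. ennreal ((1 + s) powr (- 2 * b)) * indicator {0..} s \<partial>lborel) = ennreal (0 - F 0)"
  proof (rule nn_integral_FTC_atLeast)
    fix s :: real assume "0 \<le> s"
    then have "DERIV (\<lambda>s. (1 + s) powr (1 - 2 * b)) s :> (1 - 2 * b) * (1 + s) powr (- 2 * b)"
      using DERIV_fun_powr[of "\<lambda>s. 1 + s" 1 s "1 - 2 * b"] by (auto intro!: derivative_eq_intros)
    then have "DERIV F s :> - ((1 - 2 * b) * (1 + s) powr (- 2 * b)) / (2 * b - 1)"
      unfolding F_def by (intro DERIV_cdivide DERIV_minus)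
    then show "DERIV F s :> (1 + s) powr (- 2 * b)"
      using assms by (elim DERIV_cong) (simp add: field_simps)
  next
    have "filterlim (\<lambda>s::real. 1 + s) at_top at_top"
      by (intro filterlim_tendsto_add_at_top[OF tendsto_const] filterlim_ident)
    from tendsto_neg_powr[of "1 - 2 * b", OF _ this] have "((\<lambda>s. (1 + s) powr (1 - 2 * b)) \<longlongrightarrow> 0) at_top"
      using assms by simp
    from tendsto_mult_right_zero[OF this, of "- 1 / (2 * b - 1)"] show "(F \<longlongrightarrow> 0) at_top"
      by (simp add: F_def[abs_def])
  qed (auto intro: measurable_If)
  then have "(\<integral>\<^sup>+s. ennreal (h s) \<partial>lborel) = ennreal (0 - F 0)"
    unfolding h_def by (subst (asm) nn_integral_cong[where v = "\<lambda>s. ennreal (indicator {0..} s * (1 + s) powr (- 2 * b))"])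
      (auto split: split_indicator)
  then have h: "integrable lborel h"
    unfolding h_def by (intro integrableI_nonneg) auto
  have h': "integrable lborel (\<lambda>s. h (- s))"
    using lborel_integrable_real_affine[OF h, of "-1" 0] by simp
  show ?thesis
  proof (rule Bochner_Integration.integrable_bound)
    show "integrable lborel (\<lambda>s. 2 powr b * (h s + h (- s)))" using h h' by auto
    show "AE s in lborel. norm ((1 + s\<^sup>2) powr - b) \<le> norm (2 powr b * (h s + h (- s)))"
    proof (rule AE_I2)
      fix s :: real
      have "(1 + \<bar>s\<bar>)\<^sup>2 \<le> 2 * (1 + s\<^sup>2)"
        using zero_le_power2[of "1 - \<bar>s\<bar>"] by (simp add: power2_eq_square algebra_simps)
      then have "((1 + \<bar>s\<bar>)\<^sup>2 / 2) powr b \<le> (1 + s\<^sup>2) powr b"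
        using assms by (intro powr_mono2) auto
      moreover have "((1 + \<bar>s\<bar>)\<^sup>2 / 2) powr b = (1 + \<bar>s\<bar>) powr (2 * b) / 2 powr b"
        by (simp add: powr_divide powr_powr flip: powr_numeral)
      ultimately have "(1 + s\<^sup>2) powr - b \<le> 2 powr b * (1 + \<bar>s\<bar>) powr (- 2 * b)"
        by (auto simp: powr_minus divide_simps mult_ac)
      also have "(1 + \<bar>s\<bar>) powr (- 2 * b) \<le> h s + h (- s)"
        by (auto simp: h_def indicator_def)
      finally show "norm ((1 + s\<^sup>2) powr - b) \<le> norm (2 powr b * (h s + h (- s)))"
        by (auto simp: h_def)
    qed
  qed auto
qed

lemma bessel_pos:
  assumes "1 / 2 < b" shows "0 < bessel b"
proof -
  have "bessel b \<noteq> 0"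
    unfolding bessel_def
    by (subst integral_nonneg_eq_0_iff_AE[OF integrable_bessel[OF assms]])
      (auto simp: eventually_ae_filter null_sets_def space_lborel emeasure_lborel_UNIV dest: top.extremum_uniqueI)
  moreover have "0 \<le> bessel b" unfolding bessel_def by (intro Bochner_Integration.integral_nonneg) auto
  ultimately show ?thesis by simp
qed

text \<open>Integrates the derivative of s (1 + s^2)^(1 - a) over the line. This function is at most
  (1 + s^2)^(3/2 - a) in modulus, so the boundary terms vanish precisely because a > 3/2.\<close>

lemma bessel_rec:
  assumes "3 / 2 < a"
  shows "(2 * a - 3) * bessel (a - 1) = (2 * a - 2) * bessel a"
proof -
  define g where "g s = (2 * a - 2) * (1 + s\<^sup>2) powr - a - (2 * a - 3) * (1 + s\<^sup>2) powr - (a - 1)" for s :: real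
  define F where "F s = s * (1 + s\<^sup>2) powr (1 - a)" for s :: real
  have int: "integrable lborel (\<lambda>s::real. (1 + s\<^sup>2) powr - a)" "integrable lborel (\<lambda>s::real. (1 + s\<^sup>2) powr - (a - 1))"
    using integrable_bessel[of a] integrable_bessel[of "a - 1"] assms by auto
  then have g: "integrable lborel g" unfolding g_def by auto
  have F: "DERIV F s :> g s" for s
  proof -
    have "DERIV F s :> (1 + s\<^sup>2) powr (1 - a) + s * ((1 - a) * (1 + s\<^sup>2) powr (- a) * (2 * s))"
      unfolding F_def by (auto intro!: derivative_eq_intros simp: powr_diff powr_minus divide_simps)
        (simp add: algebra_simps power2_eq_square)
    moreover have "(1 + s\<^sup>2) powr (1 - a) = (1 + s\<^sup>2) powr (- a) * (1 + s\<^sup>2)"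
      by (simp add: powr_diff powr_minus divide_simps)
    ultimately show ?thesis by (auto simp: g_def algebra_simps power2_eq_square elim!: DERIV_cong)
  qed
  have "(\<lambda>N. LINT s|lborel. g s * indicator {- real N..real N} s) \<longlonglongrightarrow> (LINT s|lborel. g s)"
  proof (rule integral_dominated_convergence[where w = "\<lambda>s. \<bar>g s\<bar>"])
    show "AE s in lborel. (\<lambda>N. g s * indicator {- real N..real N} s) \<longlonglongrightarrow> g s"
    proof (rule AE_I2, rule tendsto_eventually)
      fix s
      show "\<forall>\<^sub>F N in sequentially. g s * indicator {- real N..real N} s = g s"
        using eventually_ge_at_top[of "nat \<lceil>\<bar>s\<bar>\<rceil>"]
        by eventually_elim (auto simp: indicator_def abs_le_iff nat_le_iff ceiling_le_iff)
    qed
  qed (use g in \<open>auto split: split_indicator\<close>)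
  moreover have "(LINT s|lborel. g s * indicator {- real N..real N} s) = F (real N) - F (- real N)" for N
    by (rule integral_FTC_Icc_real) (use F in \<open>auto simp: g_def intro!: continuous_intros\<close>)
  moreover have "(\<lambda>N. F (real N) - F (- real N)) \<longlonglongrightarrow> 0"
  proof (rule tendsto_sandwich[OF _ _ tendsto_const])
    have lim: "filterlim (\<lambda>N. 1 + (real N)\<^sup>2) at_top sequentially"
      by (intro filterlim_tendsto_add_at_top[OF tendsto_const] filterlim_pow_at_top filterlim_real_sequentially) auto
    have "(\<lambda>N. (1 + (real N)\<^sup>2) powr (3 / 2 - a)) \<longlonglongrightarrow> 0"
      using tendsto_neg_powr[OF _ lim, of "3 / 2 - a"] assms by simp
    from tendsto_mult_right_zero[OF this, of 2] show "(\<lambda>N. 2 * (1 + (real N)\<^sup>2) powr (3 / 2 - a)) \<longlonglongrightarrow> 0" .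
    show "\<forall>\<^sub>F N in sequentially. F (real N) - F (- real N) \<le> 2 * (1 + (real N)\<^sup>2) powr (3 / 2 - a)"
    proof (rule always_eventually, rule allI)
      fix N
      have "real N \<le> (1 + (real N)\<^sup>2) powr (1 / 2)"
        by (simp add: powr_half_sqrt real_le_rsqrt)
      then have "real N * (1 + (real N)\<^sup>2) powr (1 - a) \<le> (1 + (real N)\<^sup>2) powr (1 / 2) * (1 + (real N)\<^sup>2) powr (1 - a)"
        by (intro mult_right_mono) auto
      also have "\<dots> = (1 + (real N)\<^sup>2) powr (3 / 2 - a)"
        by (simp flip: powr_add)
      finally show "F (real N) - F (- real N) \<le> 2 * (1 + (real N)\<^sup>2) powr (3 / 2 - a)"
        by (simp add: F_def)
    qed
    show "\<forall>\<^sub>F N in sequentially. 0 \<le> F (real N) - F (- real N)" by (simp add: F_def)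
  qed
  ultimately have "(LINT s|lborel. g s) = 0" by (simp add: LIMSEQ_unique)
  moreover have "(LINT s|lborel. g s) = (2 * a - 2) * bessel a - (2 * a - 3) * bessel (a - 1)"
    unfolding g_def bessel_def using int by simp
  ultimately show ?thesis by simp
qed

lemma nn_integral_bessel_scaled:
  assumes "0 < A" "1 / 2 < b"
  shows "(\<integral>\<^sup>+s. ennreal ((A + s\<^sup>2) powr - b) \<partial>lborel) = ennreal (A powr (1 / 2 - b) * bessel b)"
proof -
  have "(\<integral>\<^sup>+s. ennreal ((A + s\<^sup>2) powr - b) \<partial>lborel)
      = ennreal \<bar>sqrt A\<bar> * (\<integral>\<^sup>+s. ennreal ((A + (0 + sqrt A * s)\<^sup>2) powr - b) \<partial>lborel)"
    by (rule nn_integral_real_affine) (use assms in auto)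
  also have "(\<integral>\<^sup>+s. ennreal ((A + (0 + sqrt A * s)\<^sup>2) powr - b) \<partial>lborel)
      = (\<integral>\<^sup>+s. ennreal (A powr - b) * ennreal ((1 + s\<^sup>2) powr - b) \<partial>lborel)"
  proof (rule nn_integral_cong)
    fix s :: real
    have "A + (0 + sqrt A * s)\<^sup>2 = A * (1 + s\<^sup>2)" using assms by (simp add: power_mult_distrib algebra_simps)
    then show "ennreal ((A + (0 + sqrt A * s)\<^sup>2) powr - b) = ennreal (A powr - b) * ennreal ((1 + s\<^sup>2) powr - b)"
      using assms by (simp add: powr_mult ennreal_mult')
  qed
  also have "\<dots> = ennreal (A powr - b) * ennreal (bessel b)"
    unfolding bessel_def
    by (subst nn_integral_cmult) (auto simp: nn_integral_eq_integral[OF integrable_bessel[OF assms(2)]])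
  also have "ennreal \<bar>sqrt A\<bar> * (ennreal (A powr - b) * ennreal (bessel b)) = ennreal (A powr (1 / 2 - b) * bessel b)"
  proof -
    have "sqrt A * (A powr - b * bessel b) = A powr (1 / 2 - b) * bessel b"
      using assms by (simp add: powr_half_sqrt[symmetric] mult.assoc[symmetric] powr_add[symmetric])
    then show ?thesis using assms bessel_pos[OF assms(2)] by (simp flip: ennreal_mult')
  qed
  finally show ?thesis .
qed

lemma nn_integral_unit_cube:
  "(\<integral>\<^sup>+x. (\<Prod>i\<in>(UNIV :: 'n::finite set). indicator {0..1::real} ((x :: real ^ 'n) $ i)) \<partial>lborel) = 1"
proof -
  have "(\<integral>\<^sup>+x. (\<Prod>i\<in>(UNIV :: 'n::finite set). indicator {0..1::real} ((x :: real ^ 'n) $ i)) \<partial>lborel)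
     = (\<integral>\<^sup>+x. indicator (cbox 0 One :: (real ^ 'n) set) x \<partial>lborel)"
  proof (rule nn_integral_cong)
    fix x :: "real ^ 'n"
    have "(One :: real ^ 'n) $ i = 1" for i
      using inner_sum_left_Basis[of "axis i 1 :: real ^ 'n"] by (simp add: cart_eq_inner_axis axis_in_Basis_iff)
    then have "x \<in> cbox 0 One \<longleftrightarrow> (\<forall>i. x $ i \<in> {0..1})"
      by (simp add: mem_box_cart)
    then show "(\<Prod>i\<in>UNIV. indicator {0..1::real} (x $ i)) = (indicator (cbox 0 One) x :: ennreal)"
      by (auto simp: indicator_def)
  qed
  also have "\<dots> = 1" by (simp add: emeasure_lborel_cbox)
  finally show ?thesis .
qed

text \<open>\<open>S\<close> collects the coordinates that are integrated over the whole line; the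
  others stay in the unit interval, as \<open>nn_integral_strip\<close> requires. Each integration
  rescales by the square root of the remaining bracket and so lowers the exponent by 1/2.\<close>

lemma nn_integral_bessel_partial:
  fixes S :: "'n::finite set"
  assumes "real (card S) / 2 < b"
  shows "(\<integral>\<^sup>+x. (\<Prod>i\<in>- S. indicator {0..1::real} (x $ i)) *
      ennreal ((1 + (\<Sum>i\<in>S. (x $ i)\<^sup>2)) powr - b) \<partial>(lborel :: (real ^ 'n) measure))
    = ennreal (\<Prod>j<card S. bessel (b - real j / 2))"
  using finite[of S] assms
proof (induction S arbitrary: b rule: finite_induct)
  case empty
  then show ?case using nn_integral_unit_cube[where 'n = 'n] by simp
next
  case (insert i S)
  let ?A = "\<lambda>x::real ^ 'n. 1 + (\<Sum>i\<in>S. (x $ i)\<^sup>2)"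
  have A: "0 < ?A x" for x by (simp add: add_pos_nonneg sum_nonneg)
  have b: "1 / 2 < b" "real (card S) / 2 < b - 1 / 2" using insert by auto
  have "(\<integral>\<^sup>+x. (\<Prod>i\<in>- insert i S. indicator {0..1::real} (x $ i)) *
      ennreal ((1 + (\<Sum>i\<in>insert i S. (x $ i)\<^sup>2)) powr - b) \<partial>(lborel :: (real ^ 'n) measure))
    = (\<integral>\<^sup>+x. indicator {0..1::real} (x $ i) * (\<integral>\<^sup>+t. (\<Prod>j\<in>- insert i S. indicator {0..1::real} (upd x i t $ j)) *
      ennreal ((1 + (\<Sum>j\<in>insert i S. (upd x i t $ j)\<^sup>2)) powr - b) \<partial>lborel) \<partial>(lborel :: (real ^ 'n) measure))"
    by (rule nn_integral_strip) measurable
  also have "\<dots> = (\<integral>\<^sup>+x. ennreal (bessel b) * ((\<Prod>i\<in>- S. indicator {0..1::real} (x $ i)) *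
      ennreal (?A x powr - (b - 1 / 2))) \<partial>(lborel :: (real ^ 'n) measure))"
  proof (rule nn_integral_cong)
    fix x :: "real ^ 'n"
    have "(\<Prod>j\<in>- insert i S. indicator {0..1::real} (upd x i t $ j)) = (\<Prod>j\<in>- insert i S. indicator {0..1::real} (x $ j) :: ennreal)" for t
      by (intro prod.cong) auto
    moreover have "1 + (\<Sum>j\<in>insert i S. (upd x i t $ j)\<^sup>2) = ?A x + t\<^sup>2" for t
    proof -
      have "(\<Sum>j\<in>S. (upd x i t $ j)\<^sup>2) = (\<Sum>j\<in>S. (x $ j)\<^sup>2)" using insert by (intro sum.cong) (auto simp: upd_nth)
      then show ?thesis using insert by simp
    qed
    moreover have "(\<Prod>i\<in>- S. indicator {0..1::real} (x $ i)) = indicator {0..1::real} (x $ i) * (\<Prod>j\<in>- insert i S. indicator {0..1::real} (x $ j) :: ennreal)"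
      using insert by (subst prod.remove[of _ i]) (auto simp: Compl_insert)
    ultimately show "indicator {0..1::real} (x $ i) * (\<integral>\<^sup>+t. (\<Prod>j\<in>- insert i S. indicator {0..1::real} (upd x i t $ j)) *
      ennreal ((1 + (\<Sum>j\<in>insert i S. (upd x i t $ j)\<^sup>2)) powr - b) \<partial>lborel)
      = ennreal (bessel b) * ((\<Prod>i\<in>- S. indicator {0..1::real} (x $ i)) * ennreal (?A x powr - (b - 1 / 2)))"
      using bessel_pos[OF b(1)] nn_integral_bessel_scaled[OF A[of x] b(1)]
      by (simp add: nn_integral_cmult ennreal_mult' mult_ac add.assoc)
  qed
  also have "\<dots> = ennreal (bessel b) * ennreal (\<Prod>j<card S. bessel (b - 1 / 2 - real j / 2))"
    by (subst nn_integral_cmult) (measurable, simp only: insert.IH[OF b(2)])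
  also have "\<dots> = ennreal (\<Prod>j<card (insert i S). bessel (b - real j / 2))"
  proof -
    have "(\<Prod>j<card (insert i S). bessel (b - real j / 2)) = bessel b * (\<Prod>j<card S. bessel (b - real (Suc j) / 2))"
      using insert.hyps by (simp add: prod.lessThan_Suc_shift del: prod.lessThan_Suc of_nat_Suc)
    also have "(\<Prod>j<card S. bessel (b - real (Suc j) / 2)) = (\<Prod>j<card S. bessel (b - 1 / 2 - real j / 2))"
      by (intro prod.cong refl arg_cong[of _ _ bessel]) (simp add: field_simps)
    finally show ?thesis using bessel_pos[OF b(1)] by (simp only: ennreal_mult' less_imp_le)
  qed
  finally show ?case .
qed

lemma norm_sq_vec: "(norm (x :: real ^ 'n::finite))\<^sup>2 = (\<Sum>i\<in>UNIV. (x $ i)\<^sup>2)"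
  by (simp add: norm_vec_def L2_set_def real_sqrt_pow2 sum_nonneg)

lemma
  assumes "real CARD('n::finite) / 2 < b"
  shows integrable_bracket: "integrable lborel (\<lambda>x::real ^ 'n. (1 + (norm x)\<^sup>2) powr - b)"
    and integral_bracket: "(LINT x|lborel. (1 + (norm (x::real ^ 'n))\<^sup>2) powr - b)
      = (\<Prod>j<CARD('n). bessel (b - real j / 2))"
proof -
  have pos: "0 \<le> (\<Prod>j<CARD('n). bessel (b - real j / 2))"
    using assms by (intro prod_nonneg less_imp_le bessel_pos) auto
  have *: "(\<integral>\<^sup>+x. ennreal ((1 + (norm (x::real ^ 'n))\<^sup>2) powr - b) \<partial>lborel)
      = ennreal (\<Prod>j<CARD('n). bessel (b - real j / 2))"
    using nn_integral_bessel_partial[of "UNIV :: 'n set" b] assms by (simp add: norm_sq_vec)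
  show 1: "integrable lborel (\<lambda>x::real ^ 'n. (1 + (norm x)\<^sup>2) powr - b)"
    by (rule integrableI_nonneg) (auto simp: *)
  show "(LINT x|lborel. (1 + (norm (x::real ^ 'n))\<^sup>2) powr - b) = (\<Prod>j<CARD('n). bessel (b - real j / 2))"
    using * pos by (subst integral_eq_nn_integral) auto
qed

text \<open>The recurrence at a = n - j/2 has the coefficients 2n - 3 - j and 2n - 2 - j. Their
  products over j < n agree up to a shift by one, so only the last factor n - 2 of one and the first
  factor 2n - 2 of the other survive.\<close>

lemma prod_bessel_ratio:
  assumes "3 \<le> n"
  shows "(real n - 2) * (\<Prod>j<n. bessel (real n - 1 - real j / 2))
    = (2 * real n - 2) * (\<Prod>j<n. bessel (real n - real j / 2))"
proof -
  have "(\<Prod>j<m. (2 * real n - 3 - real j) * bessel (real n - 1 - real j / 2))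
    = (\<Prod>j<m. (2 * real n - 2 - real j) * bessel (real n - real j / 2))" if "m \<le> n" for m
  proof (rule prod.cong[OF refl])
    fix j assume "j \<in> {..<m}"
    then have "real j \<le> real n - 1" using that by auto
    then have "3 / 2 < real n - real j / 2" using assms by simp
    from bessel_rec[OF this] show "(2 * real n - 3 - real j) * bessel (real n - 1 - real j / 2)
      = (2 * real n - 2 - real j) * bessel (real n - real j / 2)"
      by (simp add: algebra_simps)
  qed
  from this[of n] have *: "(\<Prod>j<n. 2 * real n - 3 - real j) * (\<Prod>j<n. bessel (real n - 1 - real j / 2))
    = (\<Prod>j<n. 2 * real n - 2 - real j) * (\<Prod>j<n. bessel (real n - real j / 2))"
    by (simp add: prod.distrib)
  obtain m where m: "n = Suc m" using assms by (cases n) auto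
  define P where "P = (\<Prod>j<m. 2 * real n - 3 - real j)"
  have "(\<Prod>j<n. 2 * real n - 3 - real j) = P * (real n - 2)"
    unfolding P_def m by simp
  moreover have "(\<Prod>j<n. 2 * real n - 2 - real j) = (2 * real n - 2) * P"
    unfolding P_def m by (subst prod.lessThan_Suc_shift) (simp add: algebra_simps)
  moreover have "P \<noteq> 0"
  proof -
    have "2 * real n - 3 - real j \<noteq> 0" if "j < m" for j using that assms m by auto
    then show ?thesis unfolding P_def by auto
  qed
  ultimately show ?thesis using * by (simp add: mult_ac)
qed


section \<open>Monotone transport on the line\<close>

lemma continuous_on_LINT:
  fixes F :: "'a::metric_space \<Rightarrow> 'b \<Rightarrow> 'c::{banach, second_countable_topology}"
  assumes cont: "\<And>t. continuous_on UNIV (\<lambda>x. F x t)"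
    and meas [measurable]: "\<And>x. F x \<in> borel_measurable M"
    and dom: "\<And>x0. \<exists>w. integrable M w \<and> (\<forall>\<^sub>F x in nhds x0. \<forall>t. norm (F x t) \<le> w t)"
  shows "continuous_on UNIV (\<lambda>x. LINT t|M. F x t)"
proof -
  have "isCont (\<lambda>x. LINT t|M. F x t) x0" for x0
    unfolding continuous_at_sequentially o_def
  proof (intro allI impI)
    fix u :: "nat \<Rightarrow> 'a" assume u: "u \<longlonglongrightarrow> x0"
    obtain w where w: "integrable M w" "\<forall>\<^sub>F x in nhds x0. \<forall>t. norm (F x t) \<le> w t"
      using dom by blast
    from u w(2) have "\<forall>\<^sub>F k in sequentially. \<forall>t. norm (F (u k) t) \<le> w t"
      by (auto simp: filterlim_iff)
    then obtain N where N: "\<And>k t. N \<le> k \<Longrightarrow> norm (F (u k) t) \<le> w t"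
      by (auto simp: eventually_sequentially)
    have "(\<lambda>k. LINT t|M. F (u (k + N)) t) \<longlonglongrightarrow> (LINT t|M. F x0 t)"
    proof (rule integral_dominated_convergence[OF _ _ w(1)])
      show "AE t in M. (\<lambda>k. F (u (k + N)) t) \<longlonglongrightarrow> F x0 t"
        using continuous_on_tendsto_compose[OF cont LIMSEQ_ignore_initial_segment[OF u]] by auto
    qed (use N in auto)
    then show "(\<lambda>k. LINT t|M. F (u k) t) \<longlonglongrightarrow> (LINT t|M. F x0 t)"
      by (rule LIMSEQ_offset)
  qed
  then show ?thesis by (simp add: continuous_on_eq_continuous_at)
qed

section \<open>Distribution functions of positive continuous densities\<close>

definition primitive :: "(real \<Rightarrow> real) \<Rightarrow> real \<Rightarrow> real" where
  "primitive h s = (LINT t|lborel. indicator {..s} t * h t)"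

context
  fixes h :: "real \<Rightarrow> real"
  assumes cont: "continuous_on UNIV h" and int: "integrable lborel h" and pos: "\<And>t. 0 < h t"
begin

lemma primitive_measurable: "h \<in> borel_measurable borel"
  using cont by (rule borel_measurable_continuous_onI)

lemma primitive_deriv: "(primitive h has_real_derivative h s) (at s)"
proof -
  note [measurable] = primitive_measurable
  have int': "integrable lborel (\<lambda>t. indicator {..r} t * h t)" for r
    using integrable_mult_indicator[OF _ int, of "{..r}"] by simp
  have eq: "primitive h r = primitive h (s - 1) + integral {s - 1..r} h" if "r \<in> {s - 1..s + 1}" for r
  proof -
    have "set_integrable lborel {s - 1..r} h"
      unfolding set_integrable_def using integrable_mult_indicator[OF _ int, of "{s - 1..r}"] by simp
    then have "(LINT t : {s - 1..r} | lborel. h t) = integral {s - 1..r} h"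
      by (rule set_borel_integral_eq_integral)
    moreover have "primitive h r - primitive h (s - 1) = (LINT t|lborel. indicator {..r} t * h t - indicator {..s - 1} t * h t)"
      unfolding primitive_def using int' by simp
    moreover have "\<dots> = (LINT t : {s - 1..r} | lborel. h t)"
      unfolding set_lebesgue_integral_def
      by (rule integral_cong_AE) (use that AE_lborel_singleton[of "s - 1"] in \<open>auto simp: indicator_def elim!: eventually_mono\<close>)
    ultimately show ?thesis by simp
  qed
  have "((\<lambda>r. primitive h (s - 1) + integral {s - 1..r} h) has_real_derivative 0 + h s) (at s within {s - 1..s + 1})"
    by (intro DERIV_add DERIV_const integral_has_real_derivative) (auto intro: continuous_on_subset[OF cont])
  then have "((\<lambda>r. primitive h (s - 1) + integral {s - 1..r} h) has_real_derivative h s) (at s)"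
    by (simp add: at_within_Icc_at)
  then show ?thesis
    by (rule has_field_derivative_transform_within[of _ _ _ _ 1]) (auto simp: dist_real_def abs_le_iff abs_less_iff intro!: eq[symmetric])
qed

lemma primitive_strict_mono: "strict_mono (primitive h)"
  by (rule strict_monoI, rule DERIV_pos_imp_increasing) (use primitive_deriv pos in auto)

lemma primitive_tendsto_top: "(primitive h \<longlongrightarrow> (LINT t|lborel. h t)) at_top"
  using tendsto_integral_at_top[OF _ int] by (simp add: primitive_def[abs_def])

text \<open>Reflection t to -t turns this into the limit at plus infinity, subtracted from the total
  mass.\<close>

lemma primitive_tendsto_bot: "(primitive h \<longlongrightarrow> 0) at_bot"
proof -
  note [measurable] = primitive_measurable
  have int2: "integrable lborel (\<lambda>t. h (- t))"
    using lborel_integrable_real_affine[OF int, of "-1" 0] by simp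
  have "primitive h (- y) = (LINT t|lborel. h t) - (LINT t|lborel. indicator {..y} t * h (- t))" for y
  proof -
    have "primitive h (- y) = (LINT t|lborel. indicator {..- y} (- t) * h (- t))"
      unfolding primitive_def using lborel_integral_real_affine[of "-1" "\<lambda>t. indicator {..- y} t * h t" 0] by simp
    also have "\<dots> = (LINT t|lborel. h (- t) - indicator {..y} t * h (- t))"
      by (rule integral_cong_AE) (use int2 AE_lborel_singleton[of y] in \<open>auto simp: indicator_def elim!: eventually_mono\<close>)
    also have "\<dots> = (LINT t|lborel. h (- t)) - (LINT t|lborel. indicator {..y} t * h (- t))"
      using int2 integrable_mult_indicator[OF _ int2, of "{..y}"] by (intro Bochner_Integration.integral_diff) auto
    finally show ?thesis using lborel_integral_real_affine[of "-1" h 0] by simp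
  qed
  moreover have "((\<lambda>y. (LINT t|lborel. h t) - (LINT t|lborel. indicator {..y} t * h (- t))) \<longlongrightarrow> (LINT t|lborel. h t) - (LINT t|lborel. h (- t))) at_top"
    using tendsto_integral_at_top[OF _ int2] by (intro tendsto_intros) auto
  ultimately have "((\<lambda>y. primitive h (- y)) \<longlongrightarrow> 0) at_top"
    using lborel_integral_real_affine[of "-1" h 0] by simp
  then show ?thesis by (simp add: filterlim_at_bot_mirror)
qed

lemma primitive_bounds: "0 < primitive h s" "primitive h s < (LINT t|lborel. h t)"
proof -
  have "primitive h (s - 1) \<ge> 0"
    unfolding primitive_def using pos by (intro Bochner_Integration.integral_nonneg) (simp add: less_imp_le)
  then show "0 < primitive h s" using strict_monoD[OF primitive_strict_mono, of "s - 1" s] by simp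
  have "primitive h (s + 1) \<le> (LINT t|lborel. h t)"
    unfolding primitive_def using integrable_mult_indicator[OF _ int, of "{..s + 1}"] pos int
    by (intro integral_mono) (auto simp: indicator_def intro: less_imp_le)
  then show "primitive h s < (LINT t|lborel. h t)" using strict_monoD[OF primitive_strict_mono, of s "s + 1"] by simp
qed

lemma primitive_surj:
  assumes "0 < r" "r < (LINT t|lborel. h t)"
  shows "\<exists>s. primitive h s = r"
proof -
  obtain a where a: "primitive h a < r"
    using order_tendstoD(2)[OF primitive_tendsto_bot assms(1)] by (auto simp: eventually_at_bot_linorder)
  obtain b where b: "r < primitive h b"
    using order_tendstoD(1)[OF primitive_tendsto_top assms(2)] by (auto simp: eventually_at_top_linorder)
  have "a < b" using a b strict_mono_less[OF primitive_strict_mono, of a b] by linarith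
  moreover have "continuous_on {a..b} (primitive h)"
    by (meson DERIV_isCont continuous_at_imp_continuous_on primitive_deriv)
  ultimately show ?thesis using IVT'[of "primitive h" a r b] a b by auto
qed

end

text \<open>Substitution on the intervals from -N-1 to N+1 and monotone convergence on both sides;
  surjectivity together with monotonicity makes the images exhaust the line.\<close>

lemma nn_integral_substitution_UNIV:
  fixes \<psi> :: "real \<Rightarrow> ennreal"
  assumes [measurable]: "\<psi> \<in> borel_measurable borel"
    and deriv: "\<And>t. (Y has_real_derivative Y' t) (at t)"
    and cont: "continuous_on UNIV Y'" and pos: "\<And>t. 0 \<le> Y' t" and surj: "surj Y"
  shows "(\<integral>\<^sup>+t. \<psi> (Y t) * ennreal (Y' t) \<partial>lborel) = (\<integral>\<^sup>+s. \<psi> s \<partial>lborel)"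
proof -
  have mono: "Y s \<le> Y t" if "s \<le> t" for s t
    by (rule DERIV_nonneg_imp_nondecreasing[OF that]) (use deriv pos in auto)
  have [measurable]: "Y \<in> borel_measurable borel" "Y' \<in> borel_measurable borel"
    using cont DERIV_isCont[OF deriv] by (auto intro!: borel_measurable_continuous_onI simp: continuous_on_eq_continuous_at)
  have A: "(\<integral>\<^sup>+s. \<psi> s * indicator {Y (- real (Suc N))..Y (real (Suc N))} s \<partial>lborel)
     = (\<integral>\<^sup>+t. \<psi> (Y t) * ennreal (Y' t) * indicator {- real (Suc N)..real (Suc N)} t \<partial>lborel)" for N
    by (rule nn_integral_substitution_aux) (use deriv pos continuous_on_subset[OF cont] in auto)
  have "(\<lambda>N. \<integral>\<^sup>+s. \<psi> s * indicator {Y (- real (Suc N))..Y (real (Suc N))} s \<partial>lborel) \<longlonglongrightarrow> (\<integral>\<^sup>+s. \<psi> s \<partial>lborel)"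
  proof (rule nn_integral_LIMSEQ)
    show "incseq (\<lambda>N s. \<psi> s * indicator {Y (- real (Suc N))..Y (real (Suc N))} s)"
    proof (intro monoI le_funI mult_left_mono)
      fix m k :: nat and s assume "m \<le> k"
      then have "Y (- real (Suc k)) \<le> Y (- real (Suc m))" "Y (real (Suc m)) \<le> Y (real (Suc k))"
        by (auto intro!: mono)
      then show "(indicator {Y (- real (Suc m))..Y (real (Suc m))} s :: ennreal) \<le> indicator {Y (- real (Suc k))..Y (real (Suc k))} s"
        by (auto simp: indicator_def)
    qed auto
    fix s
    obtain t where t: "s = Y t" using surj by auto
    have "\<forall>\<^sub>F N in sequentially. \<psi> s * indicator {Y (- real (Suc N))..Y (real (Suc N))} s = \<psi> s"
      using eventually_ge_at_top[of "nat \<lceil>\<bar>t\<bar>\<rceil>"]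
    proof eventually_elim
      case (elim N)
      then have "- real (Suc N) \<le> t" "t \<le> real (Suc N)" by (auto simp: nat_le_iff ceiling_le_iff)
      then show ?case using mono t by (auto simp: indicator_def)
    qed
    then show "(\<lambda>N. \<psi> s * indicator {Y (- real (Suc N))..Y (real (Suc N))} s) \<longlonglongrightarrow> \<psi> s"
      by (rule tendsto_eventually)
  qed measurable
  moreover have "(\<lambda>N. \<integral>\<^sup>+t. \<psi> (Y t) * ennreal (Y' t) * indicator {- real (Suc N)..real (Suc N)} t \<partial>lborel)
     \<longlonglongrightarrow> (\<integral>\<^sup>+t. \<psi> (Y t) * ennreal (Y' t) \<partial>lborel)"
  proof (rule nn_integral_LIMSEQ)
    show "incseq (\<lambda>N t. \<psi> (Y t) * ennreal (Y' t) * indicator {- real (Suc N)..real (Suc N)} t)"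
      by (intro monoI le_funI mult_left_mono) (auto simp: indicator_def)
    fix t
    have "\<forall>\<^sub>F N in sequentially. \<psi> (Y t) * ennreal (Y' t) * indicator {- real (Suc N)..real (Suc N)} t = \<psi> (Y t) * ennreal (Y' t)"
      using eventually_ge_at_top[of "nat \<lceil>\<bar>t\<bar>\<rceil>"]
      by eventually_elim (auto simp: nat_le_iff ceiling_le_iff indicator_def)
    then show "(\<lambda>N. \<psi> (Y t) * ennreal (Y' t) * indicator {- real (Suc N)..real (Suc N)} t) \<longlonglongrightarrow> \<psi> (Y t) * ennreal (Y' t)"
      by (rule tendsto_eventually)
  qed measurable
  ultimately show ?thesis unfolding A using LIMSEQ_unique by blast
qed

section \<open>Transport of a density on the line to a Cauchy-type density\<close>

definition bessel_cdf :: "real \<Rightarrow> real \<Rightarrow> real" where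
  "bessel_cdf a s = primitive (\<lambda>t. (1 + t\<^sup>2) powr - a) s / bessel a"

text \<open>The range of \<open>bessel_cdf a\<close> is the open unit interval, and
  \<open>inv\<close> is arbitrary off it. All levels that occur are strictly between 0 and 1 because
  the densities are positive everywhere.\<close>

definition bessel_quantile :: "real \<Rightarrow> real \<Rightarrow> real" where
  "bessel_quantile a = inv (bessel_cdf a)"

context
  fixes a :: real
  assumes a: "1 / 2 < a"
begin

lemma bessel_density: "continuous_on UNIV (\<lambda>t::real. (1 + t\<^sup>2) powr - a)"
  "integrable lborel (\<lambda>t::real. (1 + t\<^sup>2) powr - a)" "\<And>t::real. 0 < (1 + t\<^sup>2) powr - a"
  using integrable_bessel[OF a] by (auto intro!: continuous_intros)

lemma bessel_cdf_deriv: "(bessel_cdf a has_real_derivative (1 + s\<^sup>2) powr - a / bessel a) (at s)"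
  unfolding bessel_cdf_def[abs_def] by (intro DERIV_cdivide primitive_deriv bessel_density)

lemma bessel_cdf_strict_mono: "strict_mono (bessel_cdf a)"
  using primitive_strict_mono[OF bessel_density] bessel_pos[OF a]
  by (auto simp: strict_mono_def bessel_cdf_def divide_strict_right_mono)

lemma bessel_cdf_bounds: "0 < bessel_cdf a s" "bessel_cdf a s < 1"
  using primitive_bounds[OF bessel_density, of s] bessel_pos[OF a]
  by (auto simp: bessel_cdf_def bessel_def[symmetric])

lemma bessel_quantile_cdf: "bessel_quantile a (bessel_cdf a s) = s"
  unfolding bessel_quantile_def by (rule inv_f_f[OF strict_mono_imp_inj_on[OF bessel_cdf_strict_mono]])

lemma bessel_cdf_quantile:
  assumes "0 < r" "r < 1" shows "bessel_cdf a (bessel_quantile a r) = r"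
proof -
  obtain s where "primitive (\<lambda>t. (1 + t\<^sup>2) powr - a) s = r * bessel a"
    using assms bessel_pos[OF a] by (atomize_elim, intro primitive_surj[OF bessel_density]) (auto simp: bessel_def[symmetric])
  then have "r = bessel_cdf a s"
    using bessel_pos[OF a] by (simp add: bessel_cdf_def)
  then have "r \<in> range (bessel_cdf a)" by simp
  then show ?thesis unfolding bessel_quantile_def by (rule f_inv_into_f)
qed

lemma bessel_quantile_deriv:
  assumes "0 < r" "r < 1"
  shows "(bessel_quantile a has_real_derivative bessel a * (1 + (bessel_quantile a r)\<^sup>2) powr a) (at r)"
proof -
  let ?s = "bessel_quantile a r"
  have "(bessel_quantile a has_derivative (*) (inverse ((1 + ?s\<^sup>2) powr - a / bessel a))) (at (bessel_cdf a ?s))"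
  proof (rule has_derivative_inverse_strong[where S = UNIV and f = "bessel_cdf a" and x = ?s and f' = "(*) ((1 + ?s\<^sup>2) powr - a / bessel a)"])
    show "(bessel_cdf a has_derivative (*) ((1 + ?s\<^sup>2) powr - a / bessel a)) (at ?s)"
      using bessel_cdf_deriv by (simp add: has_field_derivative_def)
    show "continuous_on UNIV (bessel_cdf a)"
      by (meson DERIV_isCont continuous_at_imp_continuous_on bessel_cdf_deriv)
  qed (use bessel_quantile_cdf bessel_pos[OF a] in \<open>auto simp: fun_eq_iff\<close>)
  then show ?thesis
    by (simp add: bessel_cdf_quantile assms has_field_derivative_def powr_minus field_simps)
qed

lemma bessel_quantile_measurable:
  assumes [measurable]: "F \<in> borel_measurable M" and F: "\<And>x. 0 < F x" "\<And>x. F x < 1"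
  shows "(\<lambda>x. bessel_quantile a (F x)) \<in> borel_measurable M"
proof (rule borel_measurableI_le)
  fix y
  have "bessel_quantile a (F x) \<le> y \<longleftrightarrow> F x \<le> bessel_cdf a y" for x
    using strict_mono_less_eq[OF bessel_cdf_strict_mono, of "bessel_quantile a (F x)" y] F
    by (simp add: bessel_cdf_quantile)
  then show "{x \<in> space M. bessel_quantile a (F x) \<le> y} \<in> sets M" by simp
qed

end

context
  fixes a :: real and h :: "real \<Rightarrow> real"
  assumes a: "3 / 2 < a" 
    and h: "continuous_on UNIV h" "integrable lborel h" "\<And>t. 0 < h t"
begin

abbreviation (input) "h_mass \<equiv> (LINT t|lborel. h t)"

lemma transport_total_pos: "0 < h_mass"
  using primitive_bounds[OF h, of 0] by simp

lemma transport_level: "0 < primitive h t / h_mass" "primitive h t / h_mass < 1"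
  using primitive_bounds[OF h, of t] by auto

lemma transport_deriv:
  "((\<lambda>t. bessel_quantile a (primitive h t / h_mass)) has_real_derivative
     h t / h_mass * (bessel a * (1 + (bessel_quantile a (primitive h t / h_mass))\<^sup>2) powr a)) (at t)"
proof -
  have "((\<lambda>t. bessel_quantile a (primitive h t / h_mass)) has_real_derivative
     (bessel a * (1 + (bessel_quantile a (primitive h t / h_mass))\<^sup>2) powr a) * (h t / h_mass)) (at t)"
    by (rule DERIV_chain2[OF bessel_quantile_deriv DERIV_cdivide[OF primitive_deriv[OF h]]])
      (use a transport_level in auto)
  then show ?thesis by (simp add: mult_ac)
qed

lemma transport_surj: "surj (\<lambda>t. bessel_quantile a (primitive h t / h_mass))"
proof -
  have "\<exists>t. s = bessel_quantile a (primitive h t / h_mass)" for s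
  proof -
    have a': "1 / 2 < a" using a by simp
    have "\<exists>t. primitive h t = bessel_cdf a s * h_mass"
      using bessel_cdf_bounds[OF a', of s] transport_total_pos by (intro primitive_surj[OF h]) auto
    then obtain t where "primitive h t / h_mass = bessel_cdf a s" using transport_total_pos by (metis less_numeral_extra(3) nonzero_mult_div_cancel_right)
    then show ?thesis using bessel_quantile_cdf[OF a', of s] by metis
  qed
  then show ?thesis by (auto simp: surj_def)
qed

text \<open>The derivative of the transport map contains the factor (1 + Y^2)^a, so substituting s =
  Y(t) in the integral of (1 + s^2)^-(a - 1) leaves h (1 + Y^2) up to constants. The hypothesis a >
  3/2 is what keeps this integral finite.\<close>

lemma transport_moment:
  "(\<integral>\<^sup>+t. ennreal (h t * (1 + (bessel_quantile a (primitive h t / h_mass))\<^sup>2)) \<partial>lborel)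
    = ennreal (h_mass * (bessel (a - 1) / bessel a))"
proof -
  let ?Y = "\<lambda>t. bessel_quantile a (primitive h t / h_mass)"
  let ?Y' = "\<lambda>t. h t / h_mass * (bessel a * (1 + (?Y t)\<^sup>2) powr a)"
  have b: "0 < bessel a" "0 < bessel (a - 1)" using a bessel_pos by auto
  have contY: "continuous_on UNIV ?Y"
    using DERIV_isCont[OF transport_deriv] by (simp add: continuous_on_eq_continuous_at)
  have "(\<integral>\<^sup>+t. ennreal ((1 + (?Y t)\<^sup>2) powr - (a - 1)) * ennreal (?Y' t) \<partial>lborel)
      = (\<integral>\<^sup>+s. ennreal ((1 + s\<^sup>2) powr - (a - 1)) \<partial>lborel)"
  proof (rule nn_integral_substitution_UNIV)
    show "continuous_on UNIV ?Y'" using transport_total_pos b by (intro continuous_intros h contY) auto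
    show "0 \<le> ?Y' t" for t using transport_total_pos b h(3)[of t] by auto
  qed (use transport_deriv transport_surj in auto)
  also have "\<dots> = ennreal (bessel (a - 1))"
    unfolding bessel_def using a integrable_bessel[of "a - 1"] by (intro nn_integral_eq_integral) auto
  also have "(\<lambda>t. ennreal ((1 + (?Y t)\<^sup>2) powr - (a - 1)) * ennreal (?Y' t))
      = (\<lambda>t. ennreal (bessel a / h_mass) * ennreal (h t * (1 + (?Y t)\<^sup>2)))"
  proof
    fix t
    have "(1 + (?Y t)\<^sup>2) powr - (a - 1) * (1 + (?Y t)\<^sup>2) powr a = 1 + (?Y t)\<^sup>2"
      by (simp flip: powr_add)
    then have "(1 + (?Y t)\<^sup>2) powr - (a - 1) * ?Y' t = bessel a / h_mass * (h t * (1 + (?Y t)\<^sup>2))"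
      by (simp add: field_simps)
    then show "ennreal ((1 + (?Y t)\<^sup>2) powr - (a - 1)) * ennreal (?Y' t)
      = ennreal (bessel a / h_mass) * ennreal (h t * (1 + (?Y t)\<^sup>2))"
      using b transport_total_pos h(3)[of t] by (simp only: ennreal_mult'[symmetric] powr_ge_zero divide_nonneg_nonneg less_imp_le)
  qed
  finally have *: "(\<integral>\<^sup>+t. ennreal (bessel a / h_mass) * ennreal (h t * (1 + (?Y t)\<^sup>2)) \<partial>lborel) = ennreal (bessel (a - 1))" .
  have [measurable]: "h \<in> borel_measurable borel" "?Y \<in> borel_measurable borel"
    using h contY by (auto intro!: borel_measurable_continuous_onI)
  have "(\<integral>\<^sup>+t. ennreal (h t * (1 + (?Y t)\<^sup>2)) \<partial>lborel)
    = (\<integral>\<^sup>+t. ennreal (h_mass / bessel a) * (ennreal (bessel a / h_mass) * ennreal (h t * (1 + (?Y t)\<^sup>2))) \<partial>lborel)"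
    using b transport_total_pos by (intro nn_integral_cong) (simp add: mult.assoc[symmetric] ennreal_mult'[symmetric])
  also have "\<dots> = ennreal (h_mass / bessel a) * ennreal (bessel (a - 1))"
    by (subst nn_integral_cmult) (simp_all add: *)
  also have "\<dots> = ennreal (h_mass * (bessel (a - 1) / bessel a))"
    using b transport_total_pos by (simp flip: ennreal_mult')
  finally show ?thesis .
qed

end


section \<open>The Knothe map\<close>

lemma upd_commute: "i \<noteq> j \<Longrightarrow> upd (upd x i s) j t = upd (upd x j t) i s"
  by (auto simp: vec_eq_iff upd_nth)

lemma line_upd: "x + s *\<^sub>R axis i 1 = upd x i (x $ i + s)"
  by (simp add: upd_def)

lemma DERIV_line:
  assumes "((\<lambda>t. f (upd x i t)) has_real_derivative D) (at (x $ i))"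
  shows "((\<lambda>s. f (x + s *\<^sub>R axis i 1)) has_real_derivative D) (at 0)"
  unfolding line_upd using assms DERIV_shift[of "\<lambda>t. f (upd x i t)" D 0 "x $ i"] by (simp add: add.commute)

lemma continuous_line:
  assumes "continuous_on UNIV (\<lambda>t. f (upd x i t))"
  shows "continuous_on UNIV (\<lambda>s. f (x + s *\<^sub>R axis i 1))"
  unfolding line_upd
  by (rule continuous_on_compose2[OF assms]) (auto intro!: continuous_intros)

text \<open>\<open>f\<close> is a probability density and \<open>e\<close> fixes the order in which
  coordinates are integrated out. The product form of the bound makes \<open>f\<close> integrable in
  each coordinate uniformly in the others, and integrating a coordinate out leaves a bound of the
  same form.\<close>

locale knothe =
  fixes f :: "real ^ 'n::finite \<Rightarrow> real" and e :: "nat \<Rightarrow> 'n" and C :: real and N :: nat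
  assumes cont: "continuous_on UNIV f" and pos: "\<And>x. 0 < f x"
    and bound: "\<And>x. f x \<le> C * (\<Prod>i\<in>UNIV. (1 + (x $ i)\<^sup>2) powr - 1)"
    and total: "(\<integral>\<^sup>+x. ennreal (f x) \<partial>lborel) = 1"
    and e: "bij_betw e {..<N} UNIV" and dim: "3 \<le> N"
begin

lemma e_eq_iff: "i < N \<Longrightarrow> j < N \<Longrightarrow> e i = e j \<longleftrightarrow> i = j"
  using e by (auto simp: bij_betw_def inj_on_def)

text \<open>All marginals live on the full space and are constant in the coordinates already
  integrated out, which avoids spaces of varying dimension.\<close>

primrec marginal :: "nat \<Rightarrow> real ^ 'n \<Rightarrow> real" where
  "marginal 0 = f"
| "marginal (Suc j) = (\<lambda>x. LINT t|lborel. marginal j (upd x (e j) t))"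

lemma decay_le_1: "(1 + (s::real)\<^sup>2) powr - 1 \<le> 1"
  by (simp add: powr_minus field_simps)

lemma section_props:
  assumes "j < N" "continuous_on UNIV (marginal j)" "\<And>x. 0 < marginal j x"
    "\<And>x. marginal j x \<le> B * (\<Prod>m\<in>{j..<N}. (1 + (x $ e m)\<^sup>2) powr - 1)"
  shows "continuous_on UNIV (\<lambda>t. marginal j (upd x (e j) t))"
    and "integrable lborel (\<lambda>t. marginal j (upd x (e j) t))"
    and "marginal j (upd x (e j) t) \<le> B * (\<Prod>m\<in>{Suc j..<N}. (1 + (x $ e m)\<^sup>2) powr - 1) * (1 + t\<^sup>2) powr - 1"
    and "0 < B"
proof -
  have "0 < B * (\<Prod>m\<in>{j..<N}. (1 + ((0::real^'n) $ e m)\<^sup>2) powr - 1)"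
    using assms(3,4)[of 0] by (rule less_le_trans)
  then show B: "0 < B" by simp
  show c: "continuous_on UNIV (\<lambda>t. marginal j (upd x (e j) t))"
    by (rule continuous_on_compose2[OF assms(2)]) (auto intro!: continuous_intros)
  show le: "marginal j (upd x (e j) t) \<le> B * (\<Prod>m\<in>{Suc j..<N}. (1 + (x $ e m)\<^sup>2) powr - 1) * (1 + t\<^sup>2) powr - 1" for t
  proof -
    have "(\<Prod>m\<in>{Suc j..<N}. (1 + (upd x (e j) t $ e m)\<^sup>2) powr - 1) = (\<Prod>m\<in>{Suc j..<N}. (1 + (x $ e m)\<^sup>2) powr - 1)"
      using assms(1) by (intro prod.cong) (auto simp: upd_nth e_eq_iff)
    then show ?thesis
      using assms(4)[of "upd x (e j) t"] assms(1) by (simp add: prod.atLeast_Suc_lessThan mult_ac)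
  qed
  show "integrable lborel (\<lambda>t. marginal j (upd x (e j) t))"
  proof (rule Bochner_Integration.integrable_bound)
    show "integrable lborel (\<lambda>t. B * (\<Prod>m\<in>{Suc j..<N}. (1 + (x $ e m)\<^sup>2) powr - 1) * (1 + t\<^sup>2) powr - 1)"
      using integrable_bessel[of 1] by (intro integrable_mult_right) auto
    show "AE t in lborel. norm (marginal j (upd x (e j) t)) \<le> norm (B * (\<Prod>m\<in>{Suc j..<N}. (1 + (x $ e m)\<^sup>2) powr - 1) * (1 + t\<^sup>2) powr - 1)"
    proof (rule AE_I2)
      fix t
      show "norm (marginal j (upd x (e j) t)) \<le> norm (B * (\<Prod>m\<in>{Suc j..<N}. (1 + (x $ e m)\<^sup>2) powr - 1) * (1 + t\<^sup>2) powr - 1)"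
        using le[of t] assms(3)[of "upd x (e j) t"] by (smt (verit) real_norm_def)
    qed
  qed (use c in \<open>auto intro: borel_measurable_continuous_onI\<close>)
qed

text \<open>The four properties go through the induction together: the decay bound at stage
  \<open>j\<close> is the dominating function that gives integrability of the sections and
  continuity at stage \<open>Suc j\<close>, and positivity makes the next marginal positive.\<close>

lemma marginal_props:
  "j \<le> N \<Longrightarrow> continuous_on UNIV (marginal j) \<and> (\<forall>x. 0 < marginal j x)
    \<and> (\<exists>B. \<forall>x. marginal j x \<le> B * (\<Prod>m\<in>{j..<N}. (1 + (x $ e m)\<^sup>2) powr - 1))
    \<and> (\<forall>m<j. \<forall>x t. marginal j (upd x (e m) t) = marginal j x)"
proof (induction j)
  case 0
  have "(\<Prod>i\<in>UNIV. (1 + (x $ i)\<^sup>2) powr - 1) = (\<Prod>m<N. (1 + (x $ e m)\<^sup>2) powr - 1)" for x :: "real ^ 'n"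
    using prod.reindex_bij_betw[OF e, of "\<lambda>i. (1 + (x $ i)\<^sup>2) powr - 1"] by simp
  then show ?case using cont pos bound by (auto simp: lessThan_atLeast0)
next
  case (Suc j)
  then have j: "j < N" by simp
  from Suc obtain B where IH: "continuous_on UNIV (marginal j)" "\<And>x. 0 < marginal j x"
    "\<And>x. marginal j x \<le> B * (\<Prod>m\<in>{j..<N}. (1 + (x $ e m)\<^sup>2) powr - 1)"
    and inv: "\<And>m x t. m < j \<Longrightarrow> marginal j (upd x (e m) t) = marginal j x" by auto
  note sec = section_props[OF j IH]
  have [measurable]: "marginal j \<in> borel_measurable borel"
    using IH(1) by (rule borel_measurable_continuous_onI)
  have prod1: "(\<Prod>m\<in>{Suc j..<N}. (1 + (x $ e m)\<^sup>2) powr - 1) \<le> 1" for x :: "real ^ 'n"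
    using decay_le_1 by (intro prod_le_1) auto
  have "continuous_on UNIV (marginal (Suc j))"
    unfolding marginal.simps
  proof (rule continuous_on_LINT)
    show "continuous_on UNIV (\<lambda>x. marginal j (upd x (e j) t))" for t
      by (rule continuous_on_compose2[OF IH(1)]) (auto intro!: continuous_intros)
    fix x0 :: "real ^ 'n"
    have "norm (marginal j (upd x (e j) t)) \<le> B * (1 + t\<^sup>2) powr - 1" for x t
    proof -
      have "B * (\<Prod>m\<in>{Suc j..<N}. (1 + (x $ e m)\<^sup>2) powr - 1) * (1 + t\<^sup>2) powr - 1 \<le> B * 1 * (1 + t\<^sup>2) powr - 1"
        using prod1[of x] sec(4) by (intro mult_right_mono mult_left_mono) auto
      then show ?thesis using sec(3)[of x t] IH(2)[of "upd x (e j) t"] by simp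
    qed
    moreover have "integrable lborel (\<lambda>t::real. B * (1 + t\<^sup>2) powr - 1)"
      using integrable_bessel[of 1] by (intro integrable_mult_right) auto
    ultimately show "\<exists>w. integrable lborel w \<and> (\<forall>\<^sub>F x in nhds x0. \<forall>t. norm (marginal j (upd x (e j) t)) \<le> w t)"
      by (intro exI[of _ "\<lambda>t. B * (1 + t\<^sup>2) powr - 1"]) auto
  qed measurable
  moreover have "0 < marginal (Suc j) x" for x
    using primitive_bounds[OF sec(1,2), of x 0] IH(2) by simp
  moreover have "marginal (Suc j) x \<le> B * bessel 1 * (\<Prod>m\<in>{Suc j..<N}. (1 + (x $ e m)\<^sup>2) powr - 1)" for x
  proof -
    have "marginal (Suc j) x \<le> (LINT t|lborel. B * (\<Prod>m\<in>{Suc j..<N}. (1 + (x $ e m)\<^sup>2) powr - 1) * (1 + t\<^sup>2) powr - 1)"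
      unfolding marginal.simps using integrable_bessel[of 1] sec
      by (intro integral_mono integrable_mult_right) auto
    also have "\<dots> = B * (\<Prod>m\<in>{Suc j..<N}. (1 + (x $ e m)\<^sup>2) powr - 1) * bessel 1"
      unfolding bessel_def by (rule integral_mult_right_zero)
    finally show ?thesis by (simp only: mult_ac)
  qed
  moreover have "marginal (Suc j) (upd x (e m) t) = marginal (Suc j) x" if "m < Suc j" for m x t
  proof (cases "m = j")
    case False
    then have "m < j" "e m \<noteq> e j" using that j by (auto simp: e_eq_iff)
    then show ?thesis by (simp add: upd_commute[of "e m" "e j"] inv)
  qed simp
  ultimately show ?case by blast
qed

lemma marginal_cont: "j \<le> N \<Longrightarrow> continuous_on UNIV (marginal j)"
  and marginal_pos: "j \<le> N \<Longrightarrow> 0 < marginal j x"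
  and marginal_upd: "j \<le> N \<Longrightarrow> m < j \<Longrightarrow> marginal j (upd x (e m) t) = marginal j x"
  using marginal_props[of j] by auto

lemma marginal_measurable: "j \<le> N \<Longrightarrow> marginal j \<in> borel_measurable borel"
  by (intro borel_measurable_continuous_onI marginal_cont)

lemma
  assumes "j < N"
  shows section_cont: "continuous_on UNIV (\<lambda>t. marginal j (upd x (e j) t))"
    and section_int: "integrable lborel (\<lambda>t. marginal j (upd x (e j) t))"
    and section_pos: "0 < marginal j (upd x (e j) t)"
proof -
  obtain B where "\<And>x. marginal j x \<le> B * (\<Prod>m\<in>{j..<N}. (1 + (x $ e m)\<^sup>2) powr - 1)"
    using marginal_props[of j] assms by auto
  from section_props(1,2)[OF assms marginal_cont marginal_pos this]
  show "continuous_on UNIV (\<lambda>t. marginal j (upd x (e j) t))"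
    "integrable lborel (\<lambda>t. marginal j (upd x (e j) t))" using assms by auto
qed (use assms marginal_pos in auto)

text \<open>
  Coordinates are integrated out in the order \<open>e 0, e 1, \<dots>\<close>. Integrating the target density
  \<open>(1 + |y|\<^sup>2)\<^sup>-\<^sup>N\<close> over the first \<open>j\<close> of them lowers the exponent to \<open>N - j/2\<close>, and its
  conditional densities are dilations of \<open>(1 + s\<^sup>2)\<close> to that power by \<open>sqrt (q (Suc j))\<close>. The
  variables \<open>Y j\<close> undo this dilation; under the source density they are independent.
\<close>

definition expo :: "nat \<Rightarrow> real" where "expo j = real N - real j / 2"

definition level :: "nat \<Rightarrow> real ^ 'n \<Rightarrow> real" where
  "level j x = primitive (\<lambda>t. marginal j (upd x (e j) t)) (x $ e j) / marginal (Suc j) x"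

definition Y :: "nat \<Rightarrow> real ^ 'n \<Rightarrow> real" where
  "Y j x = bessel_quantile (expo j) (level j x)"

definition q :: "nat \<Rightarrow> real ^ 'n \<Rightarrow> real" where
  "q j x = (\<Prod>m\<in>{j..<N}. 1 + (Y m x)\<^sup>2)"

definition T :: "nat \<Rightarrow> real ^ 'n \<Rightarrow> real" where
  "T j x = sqrt (q (Suc j) x) * Y j x"

text \<open>The diagonal entry of the Jacobian of the map. \<open>q (Suc j)\<close> involves only
  the variables \<open>Y m\<close> with m > j, which do not depend on coordinate \<open>e j\<close>;
  hence only \<open>Y j\<close> gets differentiated.\<close>

definition T' :: "nat \<Rightarrow> real ^ 'n \<Rightarrow> real" where
  "T' j x = sqrt (q (Suc j) x) * (marginal j x / marginal (Suc j) x * (bessel (expo j) * (1 + (Y j x)\<^sup>2) powr expo j))"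

lemma expo: "j < N \<Longrightarrow> 3 / 2 < expo j"
  using dim by (auto simp: expo_def)

lemma level_upd_same: "level j (upd x (e j) t)
    = primitive (\<lambda>t. marginal j (upd x (e j) t)) t / (LINT t|lborel. marginal j (upd x (e j) t))"
  by (simp add: level_def)

lemma level_upd: "j < N \<Longrightarrow> m < j \<Longrightarrow> level j (upd x (e m) t) = level j x"
  by (simp add: level_def marginal_upd upd_commute[of "e m" "e j"] e_eq_iff upd_nth del: marginal.simps)

lemma Y_upd: "j < N \<Longrightarrow> m < j \<Longrightarrow> Y j (upd x (e m) t) = Y j x"
  by (simp add: Y_def level_upd)

lemma q_upd: "j < N \<Longrightarrow> q (Suc j) (upd x (e j) t) = q (Suc j) x"
  unfolding q_def by (intro prod.cong) (auto simp: Y_upd)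

lemma q_Suc: "j < N \<Longrightarrow> q j x = (1 + (Y j x)\<^sup>2) * q (Suc j) x"
  by (simp add: q_def prod.atLeast_Suc_lessThan)

lemma q_pos: "0 < q j x"
  unfolding q_def by (intro prod_pos) (simp add: add_pos_nonneg)

lemma Y_deriv:
  assumes "j < N"
  shows "((\<lambda>t. Y j (upd x (e j) t)) has_real_derivative
    marginal j (upd x (e j) t) / marginal (Suc j) x * (bessel (expo j) * (1 + (Y j (upd x (e j) t))\<^sup>2) powr expo j)) (at t)"
  unfolding Y_def level_upd_same marginal.simps
  by (rule transport_deriv[OF expo[OF assms] section_cont section_int section_pos]) (use assms in auto)

lemma T_deriv: "j < N \<Longrightarrow> ((\<lambda>t. T j (upd x (e j) t)) has_real_derivative T' j (upd x (e j) t)) (at t)"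
  unfolding T_def T'_def using DERIV_cmult[OF Y_deriv, of j "sqrt (q (Suc j) x)"]
  by (simp add: q_upd marginal_upd del: marginal.simps)

lemma Y_line_cont: "j < N \<Longrightarrow> continuous_on UNIV (\<lambda>t. Y j (upd x (e j) t))"
  using DERIV_isCont[OF Y_deriv] by (simp add: continuous_on_eq_continuous_at)

text \<open>The divergence contains the derivative of \<open>T j\<close> along coordinate
  \<open>e j\<close> alone, so smoothness along that line, combined with Borel measurability in all
  variables, is the regularity that the integration by parts asks for.\<close>

lemma T_line_cont: "j < N \<Longrightarrow> continuous_on UNIV (\<lambda>t. T j (upd x (e j) t))"
  using DERIV_isCont[OF T_deriv] by (simp add: continuous_on_eq_continuous_at)

lemma T'_line_cont: "j < N \<Longrightarrow> continuous_on UNIV (\<lambda>t. T' j (upd x (e j) t))"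
  unfolding T'_def using marginal_pos[of "Suc j" x]
  by (auto simp: q_upd marginal_upd intro!: continuous_intros section_cont Y_line_cont simp del: marginal.simps)

lemma level_measurable: 
  assumes "j < N" shows "level j \<in> borel_measurable borel"
proof -
  have [measurable]: "marginal j \<in> borel_measurable borel" "marginal (Suc j) \<in> borel_measurable borel"
    using assms marginal_measurable[of j] marginal_measurable[of "Suc j"] by auto
  \<comment> \<open>The half-line varies with \<open>x\<close>; writing its indicator as a
    conditional exhibits the joint measurability in \<open>x\<close> and \<open>t\<close>.\<close>
  have "level j = (\<lambda>x. (LINT t|lborel. (if t \<le> x $ e j then 1 else 0) * marginal j (upd x (e j) t)) / marginal (Suc j) x)"
  proof (rule ext)
    fix x :: "real ^ 'n"
    have "primitive (\<lambda>t. marginal j (upd x (e j) t)) (x $ e j)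
        = (LINT t|lborel. (if t \<le> x $ e j then 1 else 0) * marginal j (upd x (e j) t))"
      unfolding primitive_def by (rule Bochner_Integration.integral_cong) (auto simp: indicator_def)
    then show "level j x = (LINT t|lborel. (if t \<le> x $ e j then 1 else 0) * marginal j (upd x (e j) t)) / marginal (Suc j) x"
      by (simp only: level_def)
  qed
  also have "\<dots> \<in> borel_measurable borel" by measurable
  finally show ?thesis .
qed

lemma level_bounds: "j < N \<Longrightarrow> 0 < level j x" "j < N \<Longrightarrow> level j x < 1"
  unfolding level_def marginal.simps
  by (rule transport_level[OF expo section_cont section_int section_pos]; simp)+

lemma Y_measurable: "j < N \<Longrightarrow> Y j \<in> borel_measurable borel"
  unfolding Y_def[abs_def]
  by (rule bessel_quantile_measurable[OF _ level_measurable]) (use expo[of j] level_bounds in auto)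

lemma q_measurable: "q j \<in> borel_measurable borel"
  unfolding q_def[abs_def] using Y_measurable by (intro borel_measurable_prod) auto

lemma T_measurable: "j < N \<Longrightarrow> T j \<in> borel_measurable borel"
  unfolding T_def[abs_def] using Y_measurable[of j] q_measurable[of "Suc j"] by simp

lemma T'_measurable: "j < N \<Longrightarrow> T' j \<in> borel_measurable borel"
  unfolding T'_def[abs_def] using Y_measurable[of j] q_measurable[of "Suc j"] marginal_measurable[of j] marginal_measurable[of "Suc j"]
  by (simp del: marginal.simps)

lemma T'_nonneg: "j < N \<Longrightarrow> 0 \<le> T' j x"
  unfolding T'_def using q_pos[of "Suc j" x] marginal_pos[of j x] marginal_pos[of "Suc j" x] bessel_pos[of "expo j"] expo[of j]
  by (intro mult_nonneg_nonneg) (auto simp del: marginal.simps)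

section \<open>Expectations under the source density, one coordinate at a time\<close>

lemma cube_strip:
  assumes "j < N" and [measurable]: "g \<in> borel_measurable borel"
  shows "(\<integral>\<^sup>+x. (\<Prod>m<j. indicator {0..1::real} (x $ e m)) * ennreal (g x) \<partial>lborel)
    = (\<integral>\<^sup>+x. (\<Prod>m<Suc j. indicator {0..1::real} (x $ e m)) * (\<integral>\<^sup>+t. ennreal (g (upd x (e j) t)) \<partial>lborel) \<partial>lborel)"
proof -
  have "(\<integral>\<^sup>+x. (\<Prod>m<j. indicator {0..1::real} (x $ e m)) * ennreal (g x) \<partial>lborel)
    = (\<integral>\<^sup>+x. indicator {0..1::real} (x $ e j) * (\<integral>\<^sup>+t. (\<Prod>m<j. indicator {0..1::real} (upd x (e j) t $ e m)) * ennreal (g (upd x (e j) t)) \<partial>lborel) \<partial>lborel)"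
    by (rule nn_integral_strip) measurable
  also have "\<dots> = (\<integral>\<^sup>+x. (\<Prod>m<Suc j. indicator {0..1::real} (x $ e m)) * (\<integral>\<^sup>+t. ennreal (g (upd x (e j) t)) \<partial>lborel) \<partial>lborel)"
  proof (rule nn_integral_cong)
    fix x :: "real ^ 'n"
    have "(\<Prod>m<j. indicator {0..1::real} (upd x (e j) t $ e m)) = (\<Prod>m<j. indicator {0..1::real} (x $ e m) :: ennreal)" for t
      using assms(1) by (intro prod.cong) (auto simp: upd_nth e_eq_iff)
    then show "indicator {0..1::real} (x $ e j) * (\<integral>\<^sup>+t. (\<Prod>m<j. indicator {0..1::real} (upd x (e j) t $ e m)) * ennreal (g (upd x (e j) t)) \<partial>lborel)
      = (\<Prod>m<Suc j. indicator {0..1::real} (x $ e m)) * (\<integral>\<^sup>+t. ennreal (g (upd x (e j) t)) \<partial>lborel)"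
      by (simp add: nn_integral_cmult) (simp add: mult_ac)
  qed
  finally show ?thesis .
qed

lemma cube_marginal:
  "j \<le> N \<Longrightarrow> (\<integral>\<^sup>+x. (\<Prod>m<j. indicator {0..1::real} (x $ e m)) * ennreal (marginal j x) \<partial>lborel) = 1"
proof (induction j)
  case 0
  then show ?case by (simp add: total)
next
  case (Suc j)
  then have j: "j < N" "j \<le> N" by auto
  have "(\<integral>\<^sup>+t. ennreal (marginal j (upd x (e j) t)) \<partial>lborel) = ennreal (marginal (Suc j) x)" for x
    unfolding marginal.simps
    using section_int[OF j(1)] section_pos[OF j(1)] by (intro nn_integral_eq_integral) (simp_all add: less_imp_le)
  then show ?case using Suc.IH[OF j(2)] cube_strip[OF j(1) marginal_measurable[OF j(2)]]
    by (simp del: marginal.simps prod.lessThan_Suc)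
qed

text \<open>\<open>k\<close> counts the coordinates still to be integrated out, so the induction
  runs from the last coordinate back to the first. By independence of the variables
  \<open>Y j\<close>, each step contributes its own one-dimensional moment as a factor.\<close>

lemma cube_moment:
  assumes "k \<le> N"
  shows "(\<integral>\<^sup>+x. (\<Prod>m<N - k. indicator {0..1::real} (x $ e m)) * ennreal (marginal (N - k) x * q (N - k) x) \<partial>lborel)
    = ennreal (\<Prod>m\<in>{N - k..<N}. bessel (expo m - 1) / bessel (expo m))"
  using assms
proof (induction k)
  case 0
  then show ?case using cube_marginal[of N] by (simp add: q_def)
next
  case (Suc k)
  define j where "j = N - Suc k"
  have j: "j < N" "N - k = Suc j" using Suc by (auto simp: j_def)
  have [measurable]: "marginal j \<in> borel_measurable borel" "marginal (Suc j) \<in> borel_measurable borel"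
    "q j \<in> borel_measurable borel" "q (Suc j) \<in> borel_measurable borel"
    using j marginal_measurable[of j] marginal_measurable[of "Suc j"] q_measurable by auto
  let ?r = "bessel (expo j - 1) / bessel (expo j)"
  have r: "0 < ?r" using expo[OF j(1)] bessel_pos by auto
  have inner: "(\<integral>\<^sup>+t. ennreal (marginal j (upd x (e j) t) * q j (upd x (e j) t)) \<partial>lborel) = ennreal ?r * ennreal (marginal (Suc j) x * q (Suc j) x)" for x
  proof -
    have [measurable]: "(\<lambda>t. Y j (upd x (e j) t)) \<in> borel_measurable borel"
      by (intro borel_measurable_continuous_onI Y_line_cont j)
    have "(\<integral>\<^sup>+t. ennreal (marginal j (upd x (e j) t) * q j (upd x (e j) t)) \<partial>lborel)
      = (\<integral>\<^sup>+t. ennreal (q (Suc j) x) * ennreal (marginal j (upd x (e j) t) * (1 + (Y j (upd x (e j) t))\<^sup>2)) \<partial>lborel)"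
      using q_pos[of "Suc j" x]
      by (intro nn_integral_cong) (simp add: q_Suc[OF j(1)] q_upd[OF j(1)] ennreal_mult'[symmetric] mult_ac)
    also have "\<dots> = ennreal (q (Suc j) x) * (\<integral>\<^sup>+t. ennreal (marginal j (upd x (e j) t) * (1 + (Y j (upd x (e j) t))\<^sup>2)) \<partial>lborel)"
      by (rule nn_integral_cmult) measurable
    also have "(\<integral>\<^sup>+t. ennreal (marginal j (upd x (e j) t) * (1 + (Y j (upd x (e j) t))\<^sup>2)) \<partial>lborel) = ennreal (marginal (Suc j) x * ?r)"
      unfolding Y_def level_upd_same marginal.simps
      by (rule transport_moment[OF expo[OF j(1)] section_cont[OF j(1)] section_int[OF j(1)] section_pos[OF j(1)]])
    also have "ennreal (q (Suc j) x) * ennreal (marginal (Suc j) x * ?r) = ennreal ?r * ennreal (marginal (Suc j) x * q (Suc j) x)"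
      using q_pos[of "Suc j" x] r marginal_pos[of "Suc j" x] j
      by (simp add: ennreal_mult'[symmetric] mult_ac del: marginal.simps)
    finally show ?thesis .
  qed
  have "(\<integral>\<^sup>+x. (\<Prod>m<j. indicator {0..1::real} (x $ e m)) * ennreal (marginal j x * q j x) \<partial>lborel)
    = (\<integral>\<^sup>+x. (\<Prod>m<Suc j. indicator {0..1::real} (x $ e m)) * (ennreal ?r * ennreal (marginal (Suc j) x * q (Suc j) x)) \<partial>lborel)"
    using cube_strip[OF j(1), of "\<lambda>x. marginal j x * q j x"] by (simp add: inner del: marginal.simps prod.lessThan_Suc)
  also have "\<dots> = (\<integral>\<^sup>+x. ennreal ?r * ((\<Prod>m<Suc j. indicator {0..1::real} (x $ e m)) * ennreal (marginal (Suc j) x * q (Suc j) x)) \<partial>lborel)"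
    by (intro nn_integral_cong) (simp only: mult_ac)
  also have "\<dots> = ennreal ?r * (\<integral>\<^sup>+x. (\<Prod>m<Suc j. indicator {0..1::real} (x $ e m)) * ennreal (marginal (Suc j) x * q (Suc j) x) \<partial>lborel)"
    by (rule nn_integral_cmult) measurable
  also have "\<dots> = ennreal ?r * ennreal (\<Prod>m\<in>{Suc j..<N}. bessel (expo m - 1) / bessel (expo m))"
    using Suc.IH Suc.prems unfolding j by simp
  also have "\<dots> = ennreal (\<Prod>m\<in>{j..<N}. bessel (expo m - 1) / bessel (expo m))"
    using r j by (simp only: ennreal_mult'[symmetric] less_imp_le prod.atLeast_Suc_lessThan[of j N])
  finally show ?case by (simp add: j_def)
qed

definition Z :: real where "Z = (\<Prod>m<N. bessel (expo m))"

lemma Z_pos: "0 < Z"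
  unfolding Z_def using expo bessel_pos by (intro prod_pos) fastforce

text \<open>The expectation of 1 + |T|^2, a number that depends on the target only: the moments of
  the single coordinates multiply, and \<open>prod_bessel_ratio\<close> evaluates the
  product.\<close>

lemma transport_integral:
  "(\<integral>\<^sup>+x. ennreal (f x * q 0 x) \<partial>lborel) = ennreal ((2 * real N - 2) / (real N - 2))"
proof -
  have "(\<Prod>m<N. bessel (expo m - 1)) = (\<Prod>j<N. bessel (real N - 1 - real j / 2))"
    unfolding expo_def by (intro prod.cong refl arg_cong[of _ _ bessel]) auto
  then have "(real N - 2) * (\<Prod>m<N. bessel (expo m - 1)) = (2 * real N - 2) * Z"
    using prod_bessel_ratio[OF dim] unfolding Z_def expo_def by simp
  then have "(\<Prod>m\<in>{0..<N}. bessel (expo m - 1) / bessel (expo m)) = (2 * real N - 2) / (real N - 2)"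
    using Z_pos dim by (simp add: prod_dividef Z_def[symmetric] lessThan_atLeast0[symmetric] field_simps)
  then show ?thesis using cube_moment[of N] by simp
qed

text \<open>After all coordinates are integrated out the marginal is invariant under changing any
  coordinate, hence constant; its integral over the unit cube identifies the constant with the total
  mass.\<close>

lemma marginal_N: "marginal N x = 1"
proof -
  have agree: "marginal N x = marginal N y" if "finite S" "\<And>i. i \<notin> S \<Longrightarrow> x $ i = y $ i" for S and x y :: "real ^ 'n"
    using that
  proof (induction S arbitrary: y rule: finite_induct)
    case empty
    then show ?case by (metis empty_iff vec_eq_iff)
  next
    case (insert i S)
    have "marginal N x = marginal N (upd y i (x $ i))"
      using insert by (intro insert.IH) (auto simp: upd_nth)
    moreover obtain m where "m < N" "i = e m" using e unfolding bij_betw_def by blast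
    ultimately show ?case by (simp add: marginal_upd)
  qed
  have cube: "(\<Prod>m<N. indicator {0..1::real} (y $ e m)) = (\<Prod>i\<in>UNIV. indicator {0..1::real} (y $ i) :: ennreal)" for y :: "real ^ 'n"
    by (rule prod.reindex_bij_betw[OF e])
  have "1 = (\<integral>\<^sup>+y. (\<Prod>i\<in>UNIV. indicator {0..1::real} (y $ i)) * ennreal (marginal N y) \<partial>(lborel :: (real ^ 'n) measure))"
    using cube_marginal[of N] by (simp only: cube order_refl)
  also have "\<dots> = (\<integral>\<^sup>+y. (\<Prod>i\<in>UNIV. indicator {0..1::real} (y $ i)) * ennreal (marginal N x) \<partial>(lborel :: (real ^ 'n) measure))"
  proof (rule nn_integral_cong)
    fix y :: "real ^ 'n"
    have "marginal N y = marginal N x" by (rule agree[of UNIV]) auto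
    then show "(\<Prod>i\<in>UNIV. indicator {0..1::real} (y $ i)) * ennreal (marginal N y)
      = (\<Prod>i\<in>UNIV. indicator {0..1::real} (y $ i)) * ennreal (marginal N x)" by (simp only:)
  qed
  also have "\<dots> = ennreal (marginal N x)"
    by (simp add: nn_integral_multc nn_integral_unit_cube)
  finally show ?thesis by (metis ennreal_eq_1)
qed

text \<open>The square of \<open>T j\<close> is q (Suc j) (Y j)^2 = q j - q (Suc j), so the sum
  telescopes down to the empty product \<open>q N\<close>. Thus \<open>q 0\<close> is one plus the
  squared norm of the transported point.\<close>

lemma T_sq_sum: "(\<Sum>j<N. (T j x)\<^sup>2) = q 0 x - 1"
proof -
  have "(\<Sum>j<N. (T j x)\<^sup>2) = (\<Sum>j<N. q j x - q (Suc j) x)"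
    using q_pos by (intro sum.cong) (auto simp: T_def q_Suc power_mult_distrib algebra_simps less_imp_le)
  also have "\<dots> = q 0 x - q N x"
    by (rule sum_lessThan_telescope')
  finally show ?thesis by (simp add: q_def)
qed

lemma prod_sqrt: "sqrt (\<Prod>i\<in>S. g i) = (\<Prod>i\<in>S. sqrt (g i))"
  by (induction S rule: infinite_finite_induct) (auto simp: real_sqrt_mult)

text \<open>The Jacobian equation of the transport, with the determinant as product of the diagonal.
  The quotients of marginals telescope to \<open>f\<close>. The factor 1 + (Y m)^2 carries the
  exponent N - m/2 from \<open>T' m\<close> itself and 1/2 from each of the m roots with smaller
  index, N in total.\<close>

lemma T'_prod: "(\<Prod>j<N. T' j x) = f x * Z * q 0 x ^ N"
proof -
  let ?y = "\<lambda>m. 1 + (Y m x)\<^sup>2"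
  have "(\<Prod>j<k. marginal j x / marginal (Suc j) x) = f x / marginal k x" if "k \<le> N" for k
    using that
  proof (induction k)
    case (Suc k)
    then show ?case using marginal_pos[of k x] by (simp del: marginal.simps(2))
  qed (use pos[of x] in simp)
  then have 1: "(\<Prod>j<N. marginal j x / marginal (Suc j) x) = f x"
    by (simp add: marginal_N del: marginal.simps)
  \<comment> \<open>Among the first k roots, 1 + (Y m)^2 occurs in those with index below m, which
    is \<open>min m k\<close> times.\<close>
  have "(\<Prod>j<k. sqrt (q (Suc j) x)) = (\<Prod>m<N. ?y m powr (real (min m k) / 2))" if "k \<le> N" for k
    using that
  proof (induction k)
    case (Suc k)
    have "(\<Prod>m<N. ?y m powr (real (min m (Suc k)) / 2))
      = (\<Prod>m<N. ?y m powr (real (min m k) / 2) * (if m \<in> {Suc k..<N} then sqrt (?y m) else 1))"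
    proof (rule prod.cong[OF refl])
      fix m assume "m \<in> {..<N}"
      then show "?y m powr (real (min m (Suc k)) / 2) = ?y m powr (real (min m k) / 2) * (if m \<in> {Suc k..<N} then sqrt (?y m) else 1)"
        by (auto simp: min_def powr_half_sqrt[symmetric] powr_add[symmetric] add_divide_distrib not_less_eq_eq add.commute)
    qed
    also have "\<dots> = (\<Prod>m<N. ?y m powr (real (min m k) / 2)) * (\<Prod>m<N. if m \<in> {Suc k..<N} then sqrt (?y m) else 1)"
      by (rule prod.distrib)
    also have "(\<Prod>m<N. if m \<in> {Suc k..<N} then sqrt (?y m) else 1) = sqrt (q (Suc k) x)"
    proof -
      have "{..<N} \<inter> {Suc k..<N} = {Suc k..<N}" by auto
      then show ?thesis by (subst prod.inter_restrict[symmetric]) (auto simp: q_def prod_sqrt)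
    qed
    finally show ?case using Suc by simp
  qed simp
  from this[of N] have "(\<Prod>j<N. sqrt (q (Suc j) x)) = (\<Prod>m<N. ?y m powr (real m / 2))"
    by (simp add: min_def)
  moreover have "(\<Prod>m<N. ?y m powr (real m / 2)) * (\<Prod>m<N. ?y m powr expo m) = q 0 x ^ N"
    by (simp add: prod.distrib[symmetric] powr_add[symmetric] expo_def powr_realpow prod_power_distrib q_def lessThan_atLeast0)
  moreover have "(\<Prod>j<N. T' j x) = (\<Prod>j<N. sqrt (q (Suc j) x)) * (f x * (Z * (\<Prod>m<N. ?y m powr expo m)))"
    by (simp only: T'_def prod.distrib 1 Z_def[symmetric])
  ultimately show ?thesis
    by (metis (no_types, lifting) mult.assoc mult.commute)
qed

text \<open>Arithmetic-geometric mean inequality for the nonnegative diagonal entries. The N-th root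
  of the determinant is a multiple of \<open>q 0\<close>, not of a power of it, because the target
  exponent equals the dimension.\<close>

lemma T'_sum_ge: "real N * (f x * Z) powr (1 / real N) * q 0 x \<le> (\<Sum>j<N. T' j x)"
proof -
  have "(\<Prod>j<N. T' j x) powr (1 / real N) \<le> (\<Sum>j<N. T' j x / real N)"
    using arith_geom_mean[of "{..<N}" "\<lambda>j. T' j x"] T'_nonneg dim by (auto simp: lessThan_empty_iff)
  moreover have "(\<Prod>j<N. T' j x) powr (1 / real N) = (f x * Z) powr (1 / real N) * q 0 x"
    using pos[of x] Z_pos q_pos[of 0 x] dim by (simp add: T'_prod powr_mult powr_realpow[symmetric] powr_powr)
  ultimately show ?thesis using dim by (simp add: sum_divide_distrib[symmetric] field_simps)
qed

end


section \<open>The sharp Sobolev inequality for positive functions\<close>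

text \<open>By \<open>integral_bracket\<close> the product is the integral of (1 + |x|^2)^-n; this
  is the sharp constant in front of the squared critical norm.\<close>

definition sobolev_const :: "nat \<Rightarrow> real" where
  "sobolev_const n = real n * (real n - 2) * (\<Prod>j<n. bessel (real n - real j / 2)) powr (2 / real n)"

lemma two_upper_eq: "3 \<le> n \<Longrightarrow> two_upper n = 2 * real n / (real n - 2)"
  by (auto simp: two_upper_def field_simps)

lemma two_upper_gt: "3 \<le> n \<Longrightarrow> 2 < two_upper n"
  by (auto simp: two_upper_def)

lemma young: "0 < \<alpha> \<Longrightarrow> (a::real) * b \<le> \<alpha> / 2 * a\<^sup>2 + 1 / (2 * \<alpha>) * b\<^sup>2"
  using zero_le_power2[of "\<alpha> * a - b"] by (simp add: power2_eq_square field_simps)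

text \<open>Positivity makes the powers of \<open>u\<close> differentiable and their marginals
  positive. The decay passes to every power with exponent at least one, so that \<open>u\<close> to
  the critical power is an admissible source density for \<open>knothe\<close>.\<close>

locale smooth_decaying =
  fixes u :: "real ^ 'n::finite \<Rightarrow> real" and G :: "'n \<Rightarrow> real ^ 'n \<Rightarrow> real" and C :: real
  assumes dim: "3 \<le> CARD('n)" and cont: "continuous_on UNIV u" and pos: "\<And>x. 0 < u x"
    and deriv: "\<And>i x. ((\<lambda>s. u (x + s *\<^sub>R axis i 1)) has_real_derivative G i x) (at 0)"
    and G_cont: "\<And>i. continuous_on UNIV (G i)"
    and u_sq: "integrable lborel (\<lambda>x. (u x)\<^sup>2)" and G_sq: "\<And>i. integrable lborel (\<lambda>x. (G i x)\<^sup>2)"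
    and bound: "\<And>x. u x \<le> C * (\<Prod>i\<in>UNIV. (1 + (x $ i)\<^sup>2) powr - 1)"
begin

lemma C_pos: "0 < C"
  using less_le_trans[OF pos[of 0] bound[of 0]] by simp

lemma prod_decay:
  fixes x :: "real ^ 'n"
  shows "0 < (\<Prod>i\<in>UNIV. (1 + (x $ i)\<^sup>2) powr - 1)"
  "(\<Prod>i\<in>UNIV. (1 + (x $ i)\<^sup>2) powr - 1) \<le> 1"
  by (auto intro!: prod_pos prod_le_1 simp: powr_minus field_simps)

lemma powr_bound:
  assumes "1 \<le> p"
  shows "u x powr p \<le> C powr p * (\<Prod>i\<in>UNIV. (1 + (x $ i)\<^sup>2) powr - 1)"
proof -
  let ?P = "\<Prod>i\<in>UNIV. (1 + (x $ i)\<^sup>2) powr - 1"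
  have "u x powr p \<le> (C * ?P) powr p"
    using pos[of x] bound[of x] assms by (intro powr_mono2) auto
  also have "\<dots> = C powr p * ?P powr p"
    using C_pos prod_decay[of x] by (simp add: powr_mult)
  also have "?P powr p \<le> ?P powr 1"
    using prod_decay[of x] assms by (intro powr_mono') auto
  finally show ?thesis using prod_decay[of x] C_pos by (simp add: mult_left_mono)
qed

lemma powr_integrable:
  assumes "2 \<le> p"
  shows "integrable lborel (\<lambda>x. u x powr p)"
proof (rule Bochner_Integration.integrable_bound)
  show "integrable lborel (\<lambda>x. C powr (p - 2) * (u x)\<^sup>2)" using u_sq by simp
  show "AE x in lborel. norm (u x powr p) \<le> norm (C powr (p - 2) * (u x)\<^sup>2)"
  proof (rule AE_I2)
    fix x :: "real ^ 'n"
    have "C * (\<Prod>i\<in>UNIV. (1 + (x $ i)\<^sup>2) powr - 1) \<le> C * 1"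
      using prod_decay[of x] C_pos by (intro mult_left_mono) auto
    then have "u x \<le> C" using bound[of x] by simp
    then have "u x powr (p - 2) \<le> C powr (p - 2)" using pos[of x] assms by (intro powr_mono2) auto
    moreover have "u x powr p = u x powr (p - 2) * (u x)\<^sup>2"
      using pos[of x] powr_add[of "u x" "p - 2" 2] by simp
    ultimately show "norm (u x powr p) \<le> norm (C powr (p - 2) * (u x)\<^sup>2)"
      by (simp add: mult_right_mono)
  qed
qed (use cont pos in \<open>auto intro!: borel_measurable_continuous_onI continuous_intros simp: less_imp_neq[THEN not_sym]\<close>)

text \<open>Tests the divergence bound of the transport with the weight u^r. From below this gives n
  z times the integral of f (1 + |T|^2). Integration by parts turns the divergence into -r times the
  integral of sqrt f times the gradient of u against T, and Young's inequality splits this into the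
  gradient norm and the integral of f |T|^2.\<close>

lemma sobolev_normalized:
  assumes norm: "(LINT x|lborel. u x powr two_upper CARD('n)) = 1"
  shows "sobolev_const CARD('n) \<le> (LINT x|lborel. (\<Sum>i\<in>UNIV. (G i x)\<^sup>2))"
proof -
  define n where "n = CARD('n)"
  define p where "p = two_upper n"
  \<comment> \<open>This is p (1 - 1/n): multiplied by the factor f^(1/n) of the divergence bound,
    u^r becomes f again, and differentiating u^r produces u^(p/2), the square root of f.\<close>
  define r where "r = (2 * real n - 2) / (real n - 2)"
  have n: "3 \<le> n" "3 \<le> real n" using dim by (auto simp: n_def)
  have p: "p = 2 * real n / (real n - 2)" "2 < p"
    using two_upper_eq[OF n(1)] two_upper_gt[OF n(1)] by (auto simp: p_def)
  have r: "r - 1 = p / 2" "r + p / real n = p" "1 < r"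
    using n p by (auto simp: r_def field_simps)
  define f where "f x = u x powr p" for x
  have upos: "u x \<noteq> 0" for x using pos[of x] by simp
  obtain e :: "nat \<Rightarrow> 'n" where e: "bij_betw e {..<n} UNIV"
    using ex_bij_betw_nat_finite[of "UNIV :: 'n set"] by (auto simp: n_def lessThan_atLeast0)
  have f_int: "integrable lborel f" unfolding f_def using p by (intro powr_integrable) simp
  have f_nn: "(\<integral>\<^sup>+x. ennreal (f x) \<partial>lborel) = 1"
    using norm nn_integral_eq_integral[OF f_int] by (simp add: f_def[abs_def] p_def n_def)
  interpret k: knothe f e "C powr p" n
  proof
    show "continuous_on UNIV f" unfolding f_def using cont upos by (intro continuous_intros) auto
    show "f x \<le> C powr p * (\<Prod>i\<in>UNIV. (1 + (x $ i)\<^sup>2) powr - 1)" for x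
      unfolding f_def using p by (intro powr_bound) simp
  qed (use upos f_nn e n in \<open>auto simp: f_def\<close>)
  \<comment> \<open>The moment coincides with the exponent \<open>r\<close>, so the factor
    \<open>r\<close> produced by differentiating u^r cancels at the end.\<close>
  define K where "K = r"
  have fq_nn: "(\<integral>\<^sup>+x. ennreal (f x * k.q 0 x) \<partial>lborel) = ennreal K"
    using k.transport_integral by (simp add: K_def r_def)
  have [measurable]: "f \<in> borel_measurable borel" "k.q 0 \<in> borel_measurable borel"
    "u \<in> borel_measurable borel" "G i \<in> borel_measurable borel" for i
    using k.cont cont G_cont k.q_measurable by (auto intro: borel_measurable_continuous_onI)
  have fpos: "0 < f x" for x using pos[of x] by (simp add: f_def)
  have fq0: "0 \<le> f x * k.q 0 x" for x using fpos[of x] k.q_pos[of 0 x] by simp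
  have fq_int: "integrable lborel (\<lambda>x. f x * k.q 0 x)"
    by (rule integrableI_nonneg) (use fq_nn fq0 in auto)
  have fq: "(LINT x|lborel. f x * k.q 0 x) = K"
    using fq_nn fq0 r by (subst integral_eq_nn_integral) (auto simp: K_def)
  have half: "(u x powr (p / 2))\<^sup>2 = f x" for x
    by (simp add: f_def power2_eq_square flip: powr_add)
  have T_le: "(k.T j x)\<^sup>2 \<le> k.q 0 x" if "j < n" for j x
  proof -
    have "(k.T j x)\<^sup>2 \<le> (\<Sum>j<n. (k.T j x)\<^sup>2)" using that by (intro member_le_sum) auto
    then show ?thesis by (simp add: k.T_sq_sum)
  qed
  \<comment> \<open>The two terms of the product rule for u^r T j: in \<open>E\<close> the
    derivative falls on u^r, in \<open>D\<close> on T j. Only \<open>D\<close> has a sign.\<close>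
  define E where "E j x = r * (u x powr (p / 2) * G (e j) x * k.T j x)" for j x
  define D where "D j x = u x powr r * k.T' j x" for j x
  have E_int: "integrable lborel (E j)" if "j < n" for j
  proof (rule Bochner_Integration.integrable_bound)
    show "integrable lborel (\<lambda>x. r * ((G (e j) x)\<^sup>2 + f x * k.q 0 x))"
      using G_sq fq_int by auto
    show "AE x in lborel. norm (E j x) \<le> norm (r * ((G (e j) x)\<^sup>2 + f x * k.q 0 x))"
    proof (rule AE_I2)
      fix x
      have "\<bar>G (e j) x\<bar> * \<bar>u x powr (p / 2) * k.T j x\<bar> \<le> 1 / 2 * (G (e j) x)\<^sup>2 + 1 / 2 * (f x * (k.T j x)\<^sup>2)"
        using young[of 1 "\<bar>G (e j) x\<bar>" "\<bar>u x powr (p / 2) * k.T j x\<bar>"] half[of x] by (simp add: power_mult_distrib)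
      also have "\<dots> \<le> (G (e j) x)\<^sup>2 + f x * k.q 0 x"
        using T_le[OF that, of x] fpos[of x] mult_left_mono[OF T_le[OF that, of x], of "f x"] zero_le_power2[of "G (e j) x"] fq0[of x] by linarith
      finally have "\<bar>u x powr (p / 2) * G (e j) x * k.T j x\<bar> \<le> (G (e j) x)\<^sup>2 + f x * k.q 0 x"
        by (simp add: abs_mult mult_ac)
      then have "r * \<bar>u x powr (p / 2) * G (e j) x * k.T j x\<bar> \<le> r * ((G (e j) x)\<^sup>2 + f x * k.q 0 x)"
        using r by (intro mult_left_mono) auto
      then show "norm (E j x) \<le> norm (r * ((G (e j) x)\<^sup>2 + f x * k.q 0 x))"
        using r fq0[of x] by (simp add: E_def abs_mult)
    qed
    show "E j \<in> borel_measurable lborel"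
      unfolding E_def[abs_def] using k.T_measurable[OF that] by measurable
  qed
  have p_int: "integrable lborel (\<lambda>x. u x powr r * k.T j x)" if "j < n" for j
  proof (rule Bochner_Integration.integrable_bound)
    show "integrable lborel (\<lambda>x. (u x)\<^sup>2 + f x * k.q 0 x)"
      using u_sq fq_int by auto
    show "AE x in lborel. norm (u x powr r * k.T j x) \<le> norm ((u x)\<^sup>2 + f x * k.q 0 x)"
    proof (rule AE_I2)
      fix x
      have "u x powr r = u x * u x powr (p / 2)"
      proof -
        have "r = 1 + p / 2" using r(1) by simp
        then show ?thesis using pos[of x] by (simp only: powr_add) simp
      qed
      then have "norm (u x powr r * k.T j x) = \<bar>u x\<bar> * \<bar>u x powr (p / 2) * k.T j x\<bar>"
        by (simp add: abs_mult)
      also have "\<dots> \<le> 1 / 2 * (u x)\<^sup>2 + 1 / 2 * (f x * (k.T j x)\<^sup>2)"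
        using young[of 1 "\<bar>u x\<bar>" "\<bar>u x powr (p / 2) * k.T j x\<bar>"] half[of x] by (simp add: power_mult_distrib)
      also have "\<dots> \<le> (u x)\<^sup>2 + f x * k.q 0 x"
        using mult_left_mono[OF T_le[OF that, of x], of "f x"] zero_le_power2[of "u x"] fq0[of x] fpos[of x] by linarith
      finally show "norm (u x powr r * k.T j x) \<le> norm ((u x)\<^sup>2 + f x * k.q 0 x)"
        using fq0[of x] by simp
    qed
    show "(\<lambda>x. u x powr r * k.T j x) \<in> borel_measurable lborel"
      using k.T_measurable[OF that] by measurable
  qed
  have u_line: "continuous_on UNIV (\<lambda>s. u (x + s *\<^sub>R axis i 1))" for x i
    by (rule continuous_on_compose2[OF cont]) (auto intro!: continuous_intros)
  have G_line: "continuous_on UNIV (\<lambda>s. G j (x + s *\<^sub>R axis i 1))" for x i j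
    by (rule continuous_on_compose2[OF G_cont]) (auto intro!: continuous_intros)
  have parts: "integrable lborel (D j)" "(LINT x|lborel. D j x) = - (LINT x|lborel. E j x)" if j: "j < n" for j
  proof -
    have D_meas: "D j \<in> borel_measurable borel"
        unfolding D_def[abs_def] using k.T'_measurable[OF j] by measurable
    have D_nonneg: "0 \<le> D j x" for x unfolding D_def using k.T'_nonneg[OF j, of x] by simp
    have uT_deriv: "((\<lambda>s. u (x + s *\<^sub>R axis (e j) 1) powr r * k.T j (x + s *\<^sub>R axis (e j) 1)) has_real_derivative
          D j x + E j x) (at 0)" for x
    proof -
      have "((\<lambda>s. u (x + s *\<^sub>R axis (e j) 1) powr r * k.T j (x + s *\<^sub>R axis (e j) 1)) has_real_derivative
        (r * u (x + 0 *\<^sub>R axis (e j) 1) powr (r - 1) * G (e j) x) * k.T j (x + 0 *\<^sub>R axis (e j) 1)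
          + k.T' j x * u (x + 0 *\<^sub>R axis (e j) 1) powr r) (at 0)"
        using DERIV_fun_powr[OF deriv[of x "e j"], of r] pos DERIV_line[of "k.T j" x "e j"] k.T_deriv[OF j, of x "x $ e j"]
        by (intro DERIV_mult) auto
      then show ?thesis
        by (rule DERIV_cong) (simp add: D_def E_def r mult_ac)
    qed
    have D_cont: "continuous_on UNIV (\<lambda>s. D j (x + s *\<^sub>R axis (e j) 1))" for x
        unfolding D_def using upos u_line continuous_line[OF k.T'_line_cont[OF j]] by (intro continuous_intros) auto
    have E_cont: "continuous_on UNIV (\<lambda>s. E j (x + s *\<^sub>R axis (e j) 1))" for x
        unfolding E_def using upos u_line G_line continuous_line[OF k.T_line_cont[OF j]] by (intro continuous_intros) auto
    show "integrable lborel (D j)" "(LINT x|lborel. D j x) = - (LINT x|lborel. E j x)"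
      using line_integration_by_parts[OF p_int[OF j] E_int[OF j] D_meas D_nonneg uT_deriv D_cont E_cont] by auto
  qed
  define z where "z = k.Z powr (1 / real n)"
  have z: "0 < z" using k.Z_pos by (simp add: z_def)
  define A where "A = (LINT x|lborel. (\<Sum>i\<in>UNIV. (G i x)\<^sup>2))"
  \<comment> \<open>The optimal weight in Young's inequality. As K - 1 = n / (n - 2), the moment
    term becomes exactly half of the left-hand side n z, and the other half bounds the gradient
    term.\<close>
  define \<alpha> where "\<alpha> = 1 / (z * (real n - 2))"
  have \<alpha>: "0 < \<alpha>" using z n by (simp add: \<alpha>_def)
  have "real n * z * K = (LINT x|lborel. real n * z * (f x * k.q 0 x))"
    using fq by simp
  also have "\<dots> \<le> (LINT x|lborel. (\<Sum>j<n. D j x))"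
  proof (rule integral_mono)
    show "integrable lborel (\<lambda>x. \<Sum>j<n. D j x)" using parts by auto
    fix x
    have "u x powr r * (f x * k.Z) powr (1 / real n) = z * f x"
    proof -
      have "(f x * k.Z) powr (1 / real n) = u x powr (p / real n) * z"
        using k.Z_pos by (simp add: f_def z_def powr_mult powr_powr)
      then show ?thesis using r by (simp add: f_def mult.assoc[symmetric] powr_add[symmetric])
    qed
    then have "real n * z * (f x * k.q 0 x) = u x powr r * (real n * (f x * k.Z) powr (1 / real n) * k.q 0 x)"
      by (metis (no_types, opaque_lifting) mult.assoc mult.left_commute)
    also have "\<dots> \<le> u x powr r * (\<Sum>j<n. k.T' j x)"
      using k.T'_sum_ge[of x] by (intro mult_left_mono) auto
    finally show "real n * z * (f x * k.q 0 x) \<le> (\<Sum>j<n. D j x)"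
      by (simp add: D_def sum_distrib_left)
  qed (use fq_int in auto)
  also have "\<dots> = (LINT x|lborel. (\<Sum>j<n. - E j x))"
    using parts E_int by (simp add: Bochner_Integration.integral_sum)
  also have "\<dots> \<le> (LINT x|lborel. r * (\<alpha> / 2 * (\<Sum>i\<in>UNIV. (G i x)\<^sup>2) + 1 / (2 * \<alpha>) * (f x * k.q 0 x - f x)))"
  proof (rule integral_mono)
    show "integrable lborel (\<lambda>x. r * (\<alpha> / 2 * (\<Sum>i\<in>UNIV. (G i x)\<^sup>2) + 1 / (2 * \<alpha>) * (f x * k.q 0 x - f x)))"
      using fq_int f_int G_sq by auto
    fix x
    have "(\<Sum>j<n. - E j x) \<le> (\<Sum>j<n. r * (\<alpha> / 2 * (G (e j) x)\<^sup>2 + 1 / (2 * \<alpha>) * (f x * (k.T j x)\<^sup>2)))"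
    proof (rule sum_mono)
      fix j
      have "- (G (e j) x) * (u x powr (p / 2) * k.T j x) \<le> \<alpha> / 2 * (G (e j) x)\<^sup>2 + 1 / (2 * \<alpha>) * (f x * (k.T j x)\<^sup>2)"
        using young[OF \<alpha>, of "- (G (e j) x)" "u x powr (p / 2) * k.T j x"] half[of x] by (simp add: power_mult_distrib)
      from mult_left_mono[OF this, of r] show "- E j x \<le> r * (\<alpha> / 2 * (G (e j) x)\<^sup>2 + 1 / (2 * \<alpha>) * (f x * (k.T j x)\<^sup>2))"
        using r by (simp add: E_def mult_ac)
    qed
    also have "\<dots> = r * (\<alpha> / 2 * (\<Sum>j<n. (G (e j) x)\<^sup>2) + 1 / (2 * \<alpha>) * (f x * (\<Sum>j<n. (k.T j x)\<^sup>2)))"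
      by (simp only: sum_distrib_left[symmetric] sum.distrib)
    also have "(\<Sum>j<n. (G (e j) x)\<^sup>2) = (\<Sum>i\<in>UNIV. (G i x)\<^sup>2)"
      by (rule sum.reindex_bij_betw[OF e])
    finally show "(\<Sum>j<n. - E j x) \<le> r * (\<alpha> / 2 * (\<Sum>i\<in>UNIV. (G i x)\<^sup>2) + 1 / (2 * \<alpha>) * (f x * k.q 0 x - f x))"
      by (simp add: k.T_sq_sum algebra_simps)
  qed (use E_int in auto)
  also have "\<dots> = r * (\<alpha> / 2 * A + 1 / (2 * \<alpha>) * (K - 1))"
  proof -
    have lin: "(LINT x|lborel. r * (\<alpha> / 2 * S x + 1 / (2 * \<alpha>) * (P x - f x)))
        = r * (\<alpha> / 2 * (LINT x|lborel. S x) + 1 / (2 * \<alpha>) * ((LINT x|lborel. P x) - (LINT x|lborel. f x)))"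
      if "integrable lborel S" "integrable lborel P" for S P :: "real ^ 'n \<Rightarrow> real"
      using that f_int by (simp del: times_divide_eq_left)
    have "(LINT x|lborel. f x) = 1" using norm by (simp add: f_def[abs_def] p_def n_def)
    moreover have "integrable lborel (\<lambda>x. \<Sum>i\<in>UNIV. (G i x)\<^sup>2)" using G_sq by auto
    ultimately show ?thesis using lin[OF _ fq_int] by (simp only: fq A_def)
  qed
  finally have "real n * z \<le> \<alpha> / 2 * A + 1 / (2 * \<alpha>) * (K - 1)"
    using r(3) by (simp add: K_def mult.commute[of _ r])
  moreover have "1 / (2 * \<alpha>) * (K - 1) = real n * z / 2"
  proof -
    have "K - 1 = real n / (real n - 2)" using n by (simp add: K_def r_def field_simps)
    moreover have "1 / (2 * \<alpha>) = z * (real n - 2) / 2" by (simp add: \<alpha>_def)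
    ultimately have "1 / (2 * \<alpha>) * (K - 1) = z * (real n - 2) / 2 * (real n / (real n - 2))" by (simp only:)
    also have "\<dots> = real n * z / 2"
    proof -
      have "z * w / 2 * (real n / w) = real n * z / 2" if "w \<noteq> 0" for w using that by simp
      from this[of "real n - 2"] n show ?thesis by simp
    qed
    finally show ?thesis .
  qed
  ultimately have "real n * z / 2 \<le> \<alpha> / 2 * A" by linarith
  then have "real n * z / 2 \<le> A / (2 * (z * (real n - 2)))"
    by (simp add: \<alpha>_def)
  then have "real n * (real n - 2) * z\<^sup>2 \<le> A"
    using n z by (simp add: field_simps power2_eq_square)
  moreover have "z\<^sup>2 = k.Z powr (2 / real n)"
    by (simp add: z_def power2_eq_square powr_add[symmetric])
  ultimately show ?thesis
    by (simp add: sobolev_const_def n_def[symmetric] k.Z_def k.expo_def A_def)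
qed

end

lemma (in smooth_decaying) scaled: 
  assumes "0 < a" shows "smooth_decaying (\<lambda>x. a * u x) (\<lambda>i x. a * G i x) (a * C)"
proof
  show "((\<lambda>s. a * u (x + s *\<^sub>R axis i 1)) has_real_derivative a * G i x) (at 0)" for i x
    by (rule DERIV_cmult[OF deriv])
  show "a * u x \<le> a * C * (\<Prod>i\<in>UNIV. (1 + (x $ i)\<^sup>2) powr - 1)" for x
    using bound[of x] assms by (simp add: mult.assoc)
qed (use assms dim cont pos G_cont u_sq G_sq in \<open>auto simp: power_mult_distrib intro!: continuous_intros\<close>)

text \<open>Both sides are homogeneous of degree two in \<open>u\<close>, so normalising the
  critical norm to one loses nothing.\<close>

lemma (in smooth_decaying) sobolev:
  "sobolev_const CARD('n) * (LINT x|lborel. u x powr two_upper CARD('n)) powr (2 / two_upper CARD('n))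
    \<le> (LINT x|lborel. (\<Sum>i\<in>UNIV. (G i x)\<^sup>2))"
proof -
  let ?p = "two_upper CARD('n)"
  have p: "2 < ?p" using two_upper_gt[OF dim] .
  define J where "J = (LINT x|lborel. u x powr ?p)"
  have "J \<noteq> 0"
    unfolding J_def using pos p
    by (subst integral_nonneg_eq_0_iff_AE[OF powr_integrable])
      (auto simp: eventually_ae_filter null_sets_def emeasure_lborel_UNIV less_imp_neq[THEN not_sym] dest: top.extremum_uniqueI)
  moreover have "0 \<le> J" unfolding J_def by (intro Bochner_Integration.integral_nonneg) auto
  ultimately have J: "0 < J" by simp
  define a where "a = J powr (- 1 / ?p)"
  have a: "0 < a" using J by (simp add: a_def)
  interpret s: smooth_decaying "\<lambda>x. a * u x" "\<lambda>i x. a * G i x" "a * C" by (rule scaled[OF a])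
  have "(a * u x) powr ?p = u x powr ?p / J" for x
  proof -
    have "a powr ?p = J powr (- 1 / ?p * ?p)" unfolding a_def by (rule powr_powr)
    then have "a powr ?p = 1 / J" using J p by (simp add: powr_minus_divide)
    then show ?thesis using a pos[of x] by (simp add: powr_mult less_imp_le)
  qed
  then have "(LINT x|lborel. (a * u x) powr ?p) = 1" using J by (simp add: J_def[symmetric])
  from s.sobolev_normalized[OF this]
  have "sobolev_const CARD('n) \<le> (LINT x|lborel. a\<^sup>2 * (\<Sum>i\<in>UNIV. (G i x)\<^sup>2))"
    by (simp add: power_mult_distrib sum_distrib_left)
  then have *: "sobolev_const CARD('n) \<le> a\<^sup>2 * (LINT x|lborel. (\<Sum>i\<in>UNIV. (G i x)\<^sup>2))" by simp
  have "a\<^sup>2 * J powr (2 / ?p) = 1"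
    using J by (simp add: a_def power2_eq_square powr_add[symmetric])
  then show ?thesis
    using mult_right_mono[OF *, of "J powr (2 / ?p)"] unfolding J_def[symmetric]
    by (metis (no_types, lifting) mult.assoc mult.commute mult.right_neutral powr_ge_zero)
qed


section \<open>Test functions and uniqueness of weak gradients\<close>

lemma partial_deriv_eq: "(f has_derivative f') (at x) \<Longrightarrow> partial_deriv i f x = f' (axis i 1)"
  unfolding partial_deriv_def using frechet_derivative_at by metis

lemma Ck_Suc_imp: "Ck (Suc k) f \<Longrightarrow> Ck k f"
proof (induction k arbitrary: f)
  case 0
  then show ?case
    by (auto intro!: continuous_at_imp_continuous_on differentiable_imp_continuous_within)
qed auto

lemma Ck_const: "Ck k (\<lambda>_. c)"
proof (induction k arbitrary: c)
  case (Suc k)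
  have "partial_deriv i (\<lambda>_. c) = (\<lambda>_. 0)" for i :: 'a
    by (rule ext, subst partial_deriv_eq) (auto intro: has_derivative_const)
  then show ?case using Suc[of 0] by simp
qed simp

lemma Ck_add: "Ck k f \<Longrightarrow> Ck k g \<Longrightarrow> Ck k (\<lambda>x. f x + g x)"
proof (induction k arbitrary: f g)
  case 0
  then show ?case by (auto intro: continuous_intros)
next
  case (Suc k)
  then have d: "f differentiable (at x)" "g differentiable (at x)" for x by auto
  have "partial_deriv i (\<lambda>x. f x + g x) = (\<lambda>x. partial_deriv i f x + partial_deriv i g x)" for i
    using partial_deriv_eq[OF has_derivative_add[OF d[unfolded frechet_derivative_works]]]
    by (simp add: fun_eq_iff partial_deriv_def)
  then show ?case using Suc d by auto
qed

lemma Ck_mult: "Ck k f \<Longrightarrow> Ck k g \<Longrightarrow> Ck k (\<lambda>x. f x * g x)"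
proof (induction k arbitrary: f g)
  case 0
  then show ?case by (auto intro: continuous_intros)
next
  case (Suc k)
  then have d: "f differentiable (at x)" "g differentiable (at x)" for x by auto
  have "partial_deriv i (\<lambda>x. f x * g x) = (\<lambda>x. f x * partial_deriv i g x + partial_deriv i f x * g x)" for i
    using partial_deriv_eq[OF has_derivative_mult[OF d[unfolded frechet_derivative_works]]]
    by (simp add: fun_eq_iff partial_deriv_def)
  moreover have "Ck k f" "Ck k g" using Suc.prems Ck_Suc_imp by blast+
  ultimately show ?case using Suc d by (auto intro!: Ck_add)
qed

lemma Ck_prod: "(\<And>i. i \<in> S \<Longrightarrow> Ck k (f i)) \<Longrightarrow> Ck k (\<lambda>x. \<Prod>i\<in>S. f i x)"
proof (induction S rule: infinite_finite_induct)
  case (insert i S)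
  have "Ck k (\<lambda>x. f i x * (\<Prod>i\<in>S. f i x))" using insert by (intro Ck_mult) auto
  then show ?case using insert by simp
qed (simp_all add: Ck_const)

section \<open>Smooth bump functions supported in boxes\<close>

definition flat :: "nat \<Rightarrow> real \<Rightarrow> real" where
  "flat m t = (if 0 < t then inverse t ^ m * exp (- inverse t) else 0)"

text \<open>The functions t^-m exp(-1/t), extended by zero, form a family whose derivatives are
  combinations of its members. Proving differentiability for all \<open>m\<close> at once therefore
  gives smoothness by a plain induction. At the origin the exponential beats every power of
  1/t.\<close>

lemma flat_deriv: "(flat m has_real_derivative flat (m + 2) t - real m * flat (m + 1) t) (at t)"
proof -
  consider "0 < t" | "t < 0" | "t = 0" by linarith
  then show ?thesis
  proof cases
    case 1
    have "((\<lambda>t. inverse t ^ m * exp (- inverse t)) has_real_derivative flat (m + 2) t - real m * flat (m + 1) t) (at t)"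
    proof -
      have inv: "((\<lambda>t. inverse t) has_real_derivative - (inverse t * inverse t)) (at t)"
        using DERIV_inverse[of t] 1 by (simp add: power2_eq_square)
      have "((\<lambda>t. inverse t ^ m * exp (- inverse t)) has_real_derivative
          (real m * inverse t ^ (m - 1) * - (inverse t * inverse t)) * exp (- inverse t)
          + (exp (- inverse t) * - (- (inverse t * inverse t))) * inverse t ^ m) (at t)"
        using DERIV_power[OF inv, of m] DERIV_chain2[OF DERIV_exp DERIV_minus[OF inv]]
        by (intro DERIV_mult) (simp_all add: mult_ac)
      then show ?thesis
        by (rule DERIV_cong) (use 1 in \<open>cases m; simp add: flat_def algebra_simps\<close>)
    qed
    moreover have "\<forall>\<^sub>F s in nhds t. flat m s = inverse s ^ m * exp (- inverse s)"
      using eventually_nhds_in_open[of "{0<..}" t] 1 by (auto elim!: eventually_mono simp: flat_def)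
    ultimately show ?thesis by (subst DERIV_cong_ev[OF refl _ refl])
  next
    case 2
    have "\<forall>\<^sub>F s in nhds t. flat m s = 0"
      using eventually_nhds_in_open[of "{..<0}" t] 2 by (auto elim!: eventually_mono simp: flat_def)
    moreover have "((\<lambda>_. 0) has_real_derivative flat (m + 2) t - real m * flat (m + 1) t) (at t)"
      using 2 by (simp add: flat_def)
    ultimately show ?thesis by (subst DERIV_cong_ev[OF refl _ refl])
  next
    case 3
    have "((\<lambda>s. (flat m s - flat m 0) / (s - 0)) \<longlongrightarrow> 0) (at 0)"
    proof (rule filterlim_split_at)
      show "((\<lambda>s. (flat m s - flat m 0) / (s - 0)) \<longlongrightarrow> 0) (at_left 0)"
        by (rule tendsto_eventually) (auto simp: eventually_at_filter flat_def)
      have "((\<lambda>s::real. inverse s ^ (m + 1) / exp (inverse s)) \<longlongrightarrow> 0) (at_right 0)"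
        by (rule filterlim_compose[OF tendsto_power_div_exp_0 filterlim_inverse_at_top_right])
      then show "((\<lambda>s. (flat m s - flat m 0) / (s - 0)) \<longlongrightarrow> 0) (at_right 0)"
        by (rule Lim_transform_eventually) (auto simp: eventually_at_filter flat_def exp_minus field_simps)
    qed
    then show ?thesis using 3 by (simp add: has_field_derivative_iff flat_def)
  qed
qed

lemma Ck_flat: "Ck k (\<lambda>x::real ^ 'n::finite. flat m (c * x $ i + d))"
proof (induction k arbitrary: m)
  case 0
  have "continuous_on UNIV (flat m)"
    using DERIV_isCont[OF flat_deriv] by (simp add: continuous_on_eq_continuous_at)
  then show ?case
    by (auto intro!: continuous_intros elim: continuous_on_compose2)
next
  case (Suc k)
  have d: "((\<lambda>x::real ^ 'n. flat m (c * x $ i + d)) has_derivative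
      (\<lambda>v. (c * v $ i) * (flat (m + 2) (c * x $ i + d) - real m * flat (m + 1) (c * x $ i + d)))) (at x)" for x
  proof -
    have "((\<lambda>x::real ^ 'n. c * x $ i + d) has_derivative (\<lambda>v. c * v $ i)) (at x)"
      by (intro has_derivative_add_const has_derivative_mult_right bounded_linear_imp_has_derivative bounded_linear_vec_nth)
    from DERIV_compose_FDERIV[OF flat_deriv this] show ?thesis .
  qed
  have "partial_deriv j (\<lambda>x::real ^ 'n. flat m (c * x $ i + d))
    = (\<lambda>x. (c * axis j 1 $ i) * flat (m + 2) (c * x $ i + d) + (- (c * axis j 1 $ i) * real m) * flat (m + 1) (c * x $ i + d))" for j
    by (rule ext, subst partial_deriv_eq[OF d]) (simp add: algebra_simps)
  moreover have "Ck k (\<lambda>x. (c * axis j 1 $ i) * flat (m + 2) (c * x $ i + d) + (- (c * axis j 1 $ i) * real m) * flat (m + 1) (c * x $ i + d))" for j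
    by (intro Ck_add Ck_mult Ck_const Suc.IH)
  moreover have "(\<lambda>x::real ^ 'n. flat m (c * x $ i + d)) differentiable (at x)" for x
    using d by (rule differentiableI)
  ultimately show ?case by (simp only: Ck.simps simp_thms)
qed

text \<open>\<open>m\<close> controls the steepness and leaves the support in the box from
  \<open>a\<close> to \<open>b\<close>; for growing \<open>m\<close> the bumps approach the
  indicator of the open box from below, so that dominated convergence applies.\<close>

definition box_bump :: "real ^ 'n::finite \<Rightarrow> real ^ 'n \<Rightarrow> real \<Rightarrow> real ^ 'n \<Rightarrow> real" where
  "box_bump a b m x = (\<Prod>i\<in>UNIV. flat 0 (m * (x $ i - a $ i)) * flat 0 (m * (b $ i - x $ i)))"

lemma flat_0: "0 \<le> flat 0 t" "flat 0 t \<le> 1"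
  by (auto simp: flat_def)

lemma box_bump_bounds: "0 \<le> box_bump a b m x" "box_bump a b m x \<le> 1"
proof -
  have "0 \<le> flat 0 s * flat 0 t" "flat 0 s * flat 0 t \<le> 1" for s t
    using flat_0 by (auto intro: mult_le_one)
  then show "0 \<le> box_bump a b m x" "box_bump a b m x \<le> 1"
    unfolding box_bump_def by (auto intro!: prod_nonneg prod_le_1)
qed

lemma box_bump_outside: "0 < m \<Longrightarrow> x \<notin> box a b \<Longrightarrow> box_bump a b m x = 0"
proof -
  assume m: "0 < m" and "x \<notin> box a b"
  then obtain i where "\<not> (a $ i < x $ i \<and> x $ i < b $ i)" by (auto simp: mem_box_cart)
  with m have "flat 0 (m * (x $ i - a $ i)) * flat 0 (m * (b $ i - x $ i)) = 0"
    by (auto simp: flat_def zero_less_mult_iff)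
  then show "box_bump a b m x = 0" unfolding box_bump_def by (intro prod_zero) auto
qed

lemma box_bump_shift: "box_bump (a + z) (b + z) m x = box_bump a b m (x - z)"
  unfolding box_bump_def by (intro prod.cong refl arg_cong2[of _ _ _ _ "(*)"] arg_cong[of _ _ "flat 0"]) (simp_all add: algebra_simps)

lemma box_bump_tendsto: "(\<lambda>k. box_bump a b (real (Suc k)) x) \<longlonglongrightarrow> indicator (box a b) x"
proof (cases "x \<in> box a b")
  case True
  have flat: "(\<lambda>k. flat 0 (real (Suc k) * t)) \<longlonglongrightarrow> 1" if "0 < t" for t
  proof -
    have "(\<lambda>k. exp (- (inverse (real (Suc k)) * inverse t))) \<longlonglongrightarrow> exp (- (0 * inverse t))"
      by (intro tendsto_intros LIMSEQ_inverse_real_of_nat)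
    then show ?thesis using that by (simp add: flat_def inverse_mult_distrib)
  qed
  have "(\<lambda>k. \<Prod>i\<in>UNIV. flat 0 (real (Suc k) * (x $ i - a $ i)) * flat 0 (real (Suc k) * (b $ i - x $ i)))
    \<longlonglongrightarrow> (\<Prod>i\<in>(UNIV::'a set). 1 * 1)"
    using True by (intro tendsto_prod tendsto_mult flat) (auto simp: mem_box_cart)
  then show ?thesis using True by (simp add: box_bump_def del: of_nat_Suc)
next
  case False
  then show ?thesis by (simp add: box_bump_outside del: of_nat_Suc)
qed

lemma test_function_box_bump:
  assumes "0 < m" shows "test_function (box_bump a b m)"
proof -
  have "Ck k (box_bump a b m)" for k
  proof -
    have "box_bump a b m = (\<lambda>x. \<Prod>i\<in>UNIV. flat 0 (m * x $ i + (- m * a $ i)) * flat 0 ((- m) * x $ i + m * b $ i))"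
      by (auto simp: box_bump_def algebra_simps)
    moreover have "Ck k (\<lambda>x::real ^ 'a. \<Prod>i\<in>UNIV. flat 0 (m * x $ i + (- m * a $ i)) * flat 0 ((- m) * x $ i + m * b $ i))"
      by (rule Ck_prod, rule Ck_mult; rule Ck_flat)
    ultimately show ?thesis by (simp only:)
  qed
  moreover have "{x. box_bump a b m x \<noteq> 0} \<subseteq> cbox a b"
    using box_bump_outside[OF assms] box_subset_cbox by fast
  then have "compact (closure {x. box_bump a b m x \<noteq> 0})"
    by (meson bounded_cbox bounded_subset compact_closure)
  ultimately show ?thesis by (simp add: test_function_def)
qed

lemma
  assumes "test_function \<phi>"
  shows test_function_cont: "continuous_on UNIV \<phi>"
    and test_function_deriv: "((\<lambda>s. \<phi> (x + s *\<^sub>R axis i 1)) has_real_derivative partial_deriv i \<phi> x) (at 0)"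
    and partial_deriv_cont: "continuous_on UNIV (partial_deriv i \<phi>)"
    and test_function_support: "\<exists>K. compact K \<and> (\<forall>x. x \<notin> K \<longrightarrow> \<phi> x = 0 \<and> (\<forall>i. partial_deriv i \<phi> x = 0))"
proof -
  have C: "Ck k \<phi>" for k using assms by (simp add: test_function_def)
  show "continuous_on UNIV \<phi>" using C[of 0] by simp
  have d: "\<phi> differentiable (at x)" for x using C[of 1] by simp
  show "continuous_on UNIV (partial_deriv i \<phi>)" using C[of 1] by simp
  have D: "(\<phi> has_derivative frechet_derivative \<phi> (at x)) (at x)" for x
    using d by (simp add: frechet_derivative_works)
  have lin: "linear (frechet_derivative \<phi> (at x))"
    using has_derivative_bounded_linear[OF D[of x]] by (rule bounded_linear.linear)
  have "((\<lambda>s. x + s *\<^sub>R axis i 1) has_derivative (\<lambda>s. s *\<^sub>R axis i 1)) (at 0)"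
    by (auto intro!: derivative_eq_intros)
  from has_derivative_compose[OF this, of \<phi> "frechet_derivative \<phi> (at x)"] D[of x]
  have "((\<lambda>s. \<phi> (x + s *\<^sub>R axis i 1)) has_derivative (\<lambda>s. frechet_derivative \<phi> (at x) (s *\<^sub>R axis i 1))) (at 0)"
    by simp
  then show "((\<lambda>s. \<phi> (x + s *\<^sub>R axis i 1)) has_real_derivative partial_deriv i \<phi> x) (at 0)"
    unfolding has_field_derivative_def partial_deriv_def
    by (rule has_derivative_eq_rhs) (simp add: fun_eq_iff linear_cmul[OF lin])
  let ?K = "closure {x. \<phi> x \<noteq> 0}"
  have "partial_deriv i \<phi> x = 0" if "x \<notin> ?K" for x i
  proof -
    have "(\<phi> has_derivative (\<lambda>_. 0)) (at x)"
    proof (rule has_derivative_transform_within_open[of "\<lambda>_. 0" _ _ _ "- ?K"])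
      show "0 = \<phi> y" if "y \<in> - ?K" for y using that closure_subset[of "{x. \<phi> x \<noteq> 0}"] by auto
    qed (use that in auto)
    then show ?thesis by (simp add: partial_deriv_eq)
  qed
  moreover have "\<phi> x = 0" if "x \<notin> ?K" for x using that closure_subset[of "{x. \<phi> x \<noteq> 0}"] by auto
  moreover have "compact ?K" using assms by (simp add: test_function_def)
  ultimately show "\<exists>K. compact K \<and> (\<forall>x. x \<notin> K \<longrightarrow> \<phi> x = 0 \<and> (\<forall>i. partial_deriv i \<phi> x = 0))" by blast
qed

lemma box_bump_cont: "0 < m \<Longrightarrow> continuous_on UNIV (box_bump a b m)"
  by (intro test_function_cont test_function_box_bump)

section \<open>Box bumps determine locally integrable functions; uniqueness of weak
  gradients\<close>

lemma integrable_compact_scaleR: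
  fixes g :: "real ^ 'n::finite \<Rightarrow> 'b::euclidean_space"
  assumes "locally_integrable g" "continuous_on UNIV \<phi>" "compact K" "\<And>x. x \<notin> K \<Longrightarrow> \<phi> x = 0"
  shows "integrable lebesgue (\<lambda>x. \<phi> x *\<^sub>R g x)"
proof -
  have gK: "integrable lebesgue (\<lambda>x. indicator K x *\<^sub>R g x)"
    using assms(1,3) by (simp add: locally_integrable_def set_integrable_def)
  have eq: "\<phi> x *\<^sub>R g x = \<phi> x *\<^sub>R (indicator K x *\<^sub>R g x)" for x
    using assms(4)[of x] by (auto simp: indicator_def)
  have "bounded (\<phi> ` K)"
    using assms by (intro compact_imp_bounded compact_continuous_image) (auto intro: continuous_on_subset)
  then obtain B where B: "\<And>x. x \<in> K \<Longrightarrow> \<bar>\<phi> x\<bar> \<le> B"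
    by (auto simp: bounded_iff)
  have [measurable]: "\<phi> \<in> borel_measurable lebesgue"
    using borel_measurable_continuous_onI[OF assms(2)] by (auto intro: measurable_completion)
  show ?thesis
    unfolding eq
  proof (rule Bochner_Integration.integrable_bound)
    show "integrable lebesgue (\<lambda>x. \<bar>B\<bar> *\<^sub>R (indicator K x *\<^sub>R g x))" using gK by (rule integrable_scaleR_right)
    show "AE x in lebesgue. norm (\<phi> x *\<^sub>R (indicator K x *\<^sub>R g x)) \<le> norm (\<bar>B\<bar> *\<^sub>R (indicator K x *\<^sub>R g x))"
      using B by (intro AE_I2) (auto simp: indicator_def intro!: mult_right_mono order_trans[OF _ abs_ge_self])
    show "(\<lambda>x. \<phi> x *\<^sub>R (indicator K x *\<^sub>R g x)) \<in> borel_measurable lebesgue"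
      by (rule borel_measurable_scaleR[OF _ borel_measurable_integrable[OF gK]]) measurable
  qed
qed

text \<open>Steepening the bumps shows that \<open>g\<close> integrates to zero over every box.
  Lebesgue differentiation along cubes shrinking to a point then identifies \<open>g\<close> with
  zero almost everywhere.\<close>

lemma fundamental_lemma:
  fixes g :: "real ^ 'n::finite \<Rightarrow> 'b::euclidean_space"
  assumes g: "locally_integrable g"
    and zero: "\<And>a b m. 0 < m \<Longrightarrow> (LINT x|lebesgue. box_bump a b m x *\<^sub>R g x) = 0"
  shows "AE x in lebesgue. g x = 0"
proof -
  have gK: "integrable lebesgue (\<lambda>x. indicator (cbox a b) x *\<^sub>R g x)" for a b
    using g by (simp add: locally_integrable_def set_integrable_def)
  have gB: "integrable lebesgue (\<lambda>x. indicator (box a b) x *\<^sub>R g x)" for a b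
  proof -
    have "(\<lambda>x. indicator (box a b) x *\<^sub>R g x) = (\<lambda>x. indicator (box a b) x *\<^sub>R (indicator (cbox a b) x *\<^sub>R g x))"
      using box_subset_cbox[of a b] by (auto simp: indicator_def fun_eq_iff)
    then show ?thesis using integrable_mult_indicator[OF _ gK[of a b], of "box a b"] by simp
  qed
  have int0: "integral (cbox a b) g = 0" for a b
  proof -
    have "(\<lambda>k. LINT x|lebesgue. box_bump a b (real (Suc k)) x *\<^sub>R g x) \<longlonglongrightarrow> (LINT x|lebesgue. indicator (box a b) x *\<^sub>R g x)"
    proof (rule integral_dominated_convergence[where w = "\<lambda>x. norm (indicator (box a b) x *\<^sub>R g x)"])
      show "AE x in lebesgue. (\<lambda>k. box_bump a b (real (Suc k)) x *\<^sub>R g x) \<longlonglongrightarrow> indicator (box a b) x *\<^sub>R g x"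
        by (intro AE_I2 tendsto_scaleR box_bump_tendsto tendsto_const)
      show "AE x in lebesgue. norm (box_bump a b (real (Suc k)) x *\<^sub>R g x) \<le> norm (indicator (box a b) x *\<^sub>R g x)" for k
        using box_bump_bounds[of a b "real (Suc k)"] box_bump_outside[of "real (Suc k)" _ a b]
        by (intro AE_I2) (auto simp: indicator_def mult_left_le_one_le simp del: of_nat_Suc)
      show "(\<lambda>x. box_bump a b (real (Suc k)) x *\<^sub>R g x) \<in> borel_measurable lebesgue" for k
      proof -
        have "integrable lebesgue (\<lambda>x. box_bump a b (real (Suc k)) x *\<^sub>R g x)"
          by (rule integrable_compact_scaleR[OF g box_bump_cont compact_cbox[of a b]])
            (use box_bump_outside[of "real (Suc k)" _ a b] box_subset_cbox[of a b] in \<open>auto simp del: of_nat_Suc\<close>)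
        then show ?thesis by simp
      qed
    qed (use gB[THEN borel_measurable_integrable] gB[THEN integrable_norm] in auto)
    then have "(LINT x|lebesgue. indicator (box a b) x *\<^sub>R g x) = 0"
      by (simp add: zero LIMSEQ_const_iff del: of_nat_Suc)
    moreover have "(LINT x : box a b | lebesgue. g x) = integral (box a b) g"
      by (rule set_lebesgue_integral_eq_integral) (simp add: set_integrable_def gB)
    ultimately show ?thesis by (simp add: set_lebesgue_integral_def integral_open_interval)
  qed
  have "g integrable_on cbox a b" for a b
    by (rule set_lebesgue_integral_eq_integral) (simp add: set_integrable_def gK)
  then obtain N where N: "negligible N" "\<And>x \<epsilon>. \<lbrakk>x \<notin> N; 0 < \<epsilon>\<rbrakk> \<Longrightarrow>
      \<exists>d>0. \<forall>h. 0 < h \<and> h < d \<longrightarrow> norm (integral (cbox x (x + h *\<^sub>R One)) g /\<^sub>R h ^ DIM(real ^ 'n) - g x) < \<epsilon>"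
    using integrable_ccontinuous_explicit[of g] by metis
  have "g x = 0" if xN: "x \<notin> N" for x
  proof (rule ccontr)
    assume "g x \<noteq> 0"
    then obtain d where "d > 0" and d: "\<And>h. 0 < h \<and> h < d \<Longrightarrow> norm (integral (cbox x (x + h *\<^sub>R One)) g /\<^sub>R h ^ DIM(real ^ 'n) - g x) < norm (g x)"
      using N(2)[OF xN, of "norm (g x)"] by auto
    from d[of "d / 2"] \<open>d > 0\<close> show False by (simp add: int0)
  qed
  moreover have "N \<in> null_sets lebesgue" using N(1) by (simp add: negligible_iff_null_sets)
  ultimately show ?thesis by (intro AE_I'[of N]) auto
qed

lemma locally_integrable_component:
  assumes "locally_integrable (g :: real ^ 'n::finite \<Rightarrow> complex ^ 'n)"
  shows "locally_integrable (\<lambda>x. g x $ i)"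
  unfolding locally_integrable_def set_integrable_def
proof (intro allI impI)
  fix K :: "(real ^ 'n) set" assume "compact K"
  then have "integrable lebesgue (\<lambda>x. indicator K x *\<^sub>R g x)"
    using assms by (simp add: locally_integrable_def set_integrable_def)
  from integrable_bounded_linear[OF bounded_linear_vec_nth this, of i]
  show "integrable lebesgue (\<lambda>x. indicator K x *\<^sub>R g x $ i)" by simp
qed

lemma locally_integrable_diff:
  assumes "locally_integrable f" "locally_integrable g"
  shows "locally_integrable (\<lambda>x. f x - g x)"
  using assms by (auto simp: locally_integrable_def)

lemma weak_gradient_unique:
  fixes u :: "real ^ 'n::finite \<Rightarrow> complex"
  assumes "has_weak_gradient u g" "has_weak_gradient u g'"
  shows "AE x in lebesgue. g x = g' x"
proof -
  have "AE x in lebesgue. g x $ i - g' x $ i = 0" for i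
  proof (rule fundamental_lemma)
    have li: "locally_integrable (\<lambda>x. g x $ i)" "locally_integrable (\<lambda>x. g' x $ i)"
      using assms by (auto simp: has_weak_gradient_def intro: locally_integrable_component)
    then show "locally_integrable (\<lambda>x. g x $ i - g' x $ i)" by (rule locally_integrable_diff)
    fix a b :: "real ^ 'n" and m :: real assume m: "0 < m"
    have sup: "box_bump a b m x = 0" if "x \<notin> cbox a b" for x
      using box_bump_outside[OF m, of x a b] box_subset_cbox[of a b] that by auto
    have "(LINT x|lebesgue. box_bump a b m x *\<^sub>R (g x $ i)) = (LINT x|lebesgue. box_bump a b m x *\<^sub>R (g' x $ i))"
    proof -
      have "- (LINT x|lebesgue. box_bump a b m x *\<^sub>R (g x $ i)) = - (LINT x|lebesgue. box_bump a b m x *\<^sub>R (g' x $ i))"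
        using assms[unfolded has_weak_gradient_def, THEN conjunct2, THEN conjunct2, rule_format, OF test_function_box_bump[OF m, of a b], of i]
        by (simp only:)
      then show ?thesis by simp
    qed
    then show "(LINT x|lebesgue. box_bump a b m x *\<^sub>R (g x $ i - g' x $ i)) = 0"
      using integrable_compact_scaleR[OF li(1) box_bump_cont[OF m] compact_cbox sup]
        integrable_compact_scaleR[OF li(2) box_bump_cont[OF m] compact_cbox sup]
      by (simp add: scaleR_diff_right)
  qed
  then have "AE x in lebesgue. \<forall>i. g x $ i - g' x $ i = 0" by (simp add: AE_all_countable)
  then show ?thesis by (rule eventually_mono) (simp add: vec_eq_iff)
qed


section \<open>Removal of the decay assumption\<close>

text \<open>One family plays three roles: a slowly varying cutoff for small \<open>c\<close>, a
  positive corrector for c = 1, and the ground state for a special \<open>c\<close>.\<close>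

definition bracket :: "real \<Rightarrow> real \<Rightarrow> real ^ 'n::finite \<Rightarrow> real" where
  "bracket c b x = (1 + c * (norm x)\<^sup>2) powr b"

definition bracket_deriv :: "real \<Rightarrow> real \<Rightarrow> 'n::finite \<Rightarrow> real ^ 'n \<Rightarrow> real" where
  "bracket_deriv c b i x = b * (1 + c * (norm x)\<^sup>2) powr (b - 1) * (2 * c * x $ i)"

context
  fixes c :: real
  assumes c: "0 \<le> c"
begin

lemma bracket_base: "1 \<le> 1 + c * (norm x)\<^sup>2"
  using c by simp

lemma bracket_base_pos: "0 < 1 + c * (norm x)\<^sup>2" "1 + c * (norm x)\<^sup>2 \<noteq> 0"
  using bracket_base[of x] by linarith+

lemma bracket_pos: "0 < bracket c b x"
  using bracket_base_pos[of x] by (simp add: bracket_def)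

lemma bracket_le_1: "b \<le> 0 \<Longrightarrow> bracket c b x \<le> 1"
  unfolding bracket_def using powr_mono[of b 0 "1 + c * (norm x)\<^sup>2"] bracket_base[of x] bracket_base_pos[of x] by simp

lemma bracket_cont: "continuous_on UNIV (bracket c b)"
  unfolding bracket_def[abs_def] using bracket_base_pos by (intro continuous_intros) auto

lemma bracket_deriv_cont: "continuous_on UNIV (bracket_deriv c b i)"
  unfolding bracket_deriv_def[abs_def] using bracket_base_pos by (intro continuous_intros) auto

lemma bracket_line_deriv:
  "((\<lambda>s. bracket c b (x + s *\<^sub>R axis i 1)) has_real_derivative bracket_deriv c b i x) (at 0)"
proof -
  have sq: "(norm (x + s *\<^sub>R axis i 1))\<^sup>2 = (norm x)\<^sup>2 + 2 * s * x $ i + s\<^sup>2" for s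
    unfolding power2_norm_eq_inner
    by (simp add: inner_add_left inner_add_right inner_axis inner_axis' power2_eq_square algebra_simps)
  have "((\<lambda>s. 1 + c * ((norm x)\<^sup>2 + 2 * s * x $ i + s\<^sup>2)) has_real_derivative 2 * c * x $ i) (at 0)"
    by (auto intro!: derivative_eq_intros)
  from DERIV_fun_powr[OF this, of b] show ?thesis
    using bracket_base_pos[of x] by (simp add: bracket_def bracket_deriv_def sq)
qed

text \<open>The logarithmic derivative is of size sqrt c since 2 sqrt c |x_i| \<le> 1 + c |x|^2. A
  cutoff with small \<open>c\<close> thus costs little in the gradient.\<close>

lemma bracket_deriv_bound:
  "\<bar>bracket_deriv c b i x\<bar> \<le> \<bar>b\<bar> * sqrt c * bracket c b x"
proof -
  have "2 * sqrt c * \<bar>x $ i\<bar> \<le> 1 + (sqrt c * \<bar>x $ i\<bar>)\<^sup>2"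
    using zero_le_power2[of "1 - sqrt c * \<bar>x $ i\<bar>"] by (simp add: power2_eq_square algebra_simps)
  also have "\<dots> = 1 + c * (x $ i)\<^sup>2" using c by (simp add: power_mult_distrib)
  also have "\<dots> \<le> 1 + c * (norm x)\<^sup>2"
    using c component_le_norm_cart[of x i] by (auto intro!: mult_left_mono simp: abs_le_square_iff[symmetric])
  finally have "sqrt c * (2 * sqrt c * \<bar>x $ i\<bar>) \<le> sqrt c * (1 + c * (norm x)\<^sup>2)"
    using c by (intro mult_left_mono) auto
  moreover have "sqrt c * (2 * sqrt c * \<bar>x $ i\<bar>) = 2 * (sqrt c * sqrt c) * \<bar>x $ i\<bar>"
    by (simp only: mult_ac)
  ultimately have *: "\<bar>2 * c * x $ i\<bar> \<le> sqrt c * (1 + c * (norm x)\<^sup>2)"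
    using c by (simp add: abs_mult)
  have "\<bar>bracket_deriv c b i x\<bar> = \<bar>b\<bar> * (1 + c * (norm x)\<^sup>2) powr (b - 1) * \<bar>2 * c * x $ i\<bar>"
    by (simp add: bracket_deriv_def abs_mult)
  also have "\<dots> \<le> \<bar>b\<bar> * (1 + c * (norm x)\<^sup>2) powr (b - 1) * (sqrt c * (1 + c * (norm x)\<^sup>2))"
    using * by (intro mult_left_mono) auto
  also have "\<dots> = \<bar>b\<bar> * sqrt c * bracket c b x"
    using bracket_base_pos[of x] by (simp add: bracket_def powr_diff)
  finally show ?thesis .
qed

end

lemma bracket_mono:
  assumes "0 < c" "b \<le> 0"
  shows "bracket c b x \<le> min 1 c powr b * bracket 1 b x"
proof -
  have "min 1 c * (1 + 1 * (norm x)\<^sup>2) \<le> 1 + c * (norm x)\<^sup>2"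
    using assms mult_right_mono[of "min 1 c" c "(norm x)\<^sup>2"] by (simp add: algebra_simps add_mono)
  then have "bracket c b x \<le> (min 1 c * (1 + 1 * (norm x)\<^sup>2)) powr b"
    unfolding bracket_def using assms by (intro powr_mono2') (auto intro!: mult_pos_pos add_pos_nonneg)
  also have "\<dots> = min 1 c powr b * bracket 1 b x"
    using assms by (simp add: bracket_def powr_mult)
  finally show ?thesis .
qed

lemma integrable_bracket_1:
  "real CARD('n::finite) / 2 < b \<Longrightarrow> integrable lborel (bracket 1 (- b) :: real ^ 'n \<Rightarrow> real)"
  using integrable_bracket[of b] by (simp add: bracket_def[abs_def])

lemma integrable_bracket_scaled:
  assumes "0 < c" "real CARD('n::finite) / 2 < b"
  shows "integrable lborel (bracket c (- b) :: real ^ 'n \<Rightarrow> real)"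
proof (rule Bochner_Integration.integrable_bound)
  show "integrable lborel (\<lambda>x::real ^ 'n. min 1 c powr - b * bracket 1 (- b) x)"
    using integrable_bracket_1[OF assms(2)] by simp
  have "0 < b" using assms(2) by (rule order_le_less_trans[rotated]) simp
  then have "norm (bracket c (- b) x) \<le> norm (min 1 c powr - b * bracket 1 (- b) x)" for x :: "real ^ 'n"
    using assms bracket_mono[of c "- b" x] bracket_pos[of c "- b" x] bracket_pos[of 1 "- b" x]
    by (simp add: abs_mult less_imp_le)
  then show "AE x in lborel. norm (bracket c (- b) (x :: real ^ 'n)) \<le> norm (min 1 c powr - b * bracket 1 (- b) x)"
    by auto
  show "(bracket c (- b) :: real ^ 'n \<Rightarrow> real) \<in> borel_measurable lborel"
    using borel_measurable_continuous_onI[OF bracket_cont[of c "- b"]] assms by simp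
qed

text \<open>1 + |x|^2 dominates each 1 + x_i^2, and the exponent -n provides one such factor for
  every coordinate. This links radial decay to the product decay of
  \<open>smooth_decaying\<close>.\<close>

lemma bracket_le_decay:
  fixes x :: "real ^ 'n::finite"
  shows "bracket 1 (- real CARD('n)) x \<le> (\<Prod>i\<in>UNIV. (1 + (x $ i)\<^sup>2) powr - 1)"
proof -
  have "bracket 1 (- real CARD('n)) x = (\<Prod>i\<in>(UNIV :: 'n set). (1 + (norm x)\<^sup>2) powr - 1)"
    by (simp add: bracket_def powr_minus powr_realpow power_inverse)
  also have "\<dots> \<le> (\<Prod>i\<in>UNIV. (1 + (x $ i)\<^sup>2) powr - 1)"
  proof (rule prod_mono)
    fix i :: 'n
    have "(x $ i)\<^sup>2 \<le> (norm x)\<^sup>2" using component_le_norm_cart[of x i] by (simp add: abs_le_square_iff[symmetric])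
    then show "0 \<le> (1 + (norm x)\<^sup>2) powr - 1 \<and> (1 + (norm x)\<^sup>2) powr - 1 \<le> (1 + (x $ i)\<^sup>2) powr - 1"
      by (simp add: powr_minus_divide add_pos_nonneg frac_le)
  qed
  finally show ?thesis .
qed

text \<open>Fatou's lemma in the form in which the sharp inequality is carried through each limit:
  cutoff, steepness of the mollifier, size of the averaging cubes.\<close>

lemma nn_integral_limit_le:
  assumes [measurable]: "\<And>k. f k \<in> borel_measurable M" "h \<in> borel_measurable M"
    and lim: "AE x in M. (\<lambda>k::nat. f k x) \<longlonglongrightarrow> h x"
    and le: "\<And>k. (\<integral>\<^sup>+x. f k x \<partial>M) \<le> c k" and c: "c \<longlonglongrightarrow> (C :: ennreal)"
  shows "(\<integral>\<^sup>+x. h x \<partial>M) \<le> C"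
proof -
  have "(\<integral>\<^sup>+x. h x \<partial>M) = (\<integral>\<^sup>+x. liminf (\<lambda>k. f k x) \<partial>M)"
    using lim by (intro nn_integral_cong_AE) (auto elim!: eventually_mono simp: lim_imp_Liminf)
  also have "\<dots> \<le> liminf (\<lambda>k. \<integral>\<^sup>+x. f k x \<partial>M)"
    by (rule nn_integral_liminf) measurable
  also have "\<dots> \<le> liminf c"
    using le by (intro Liminf_mono) auto
  also have "\<dots> = C" using c by (simp add: lim_imp_Liminf)
  finally show ?thesis .
qed

section \<open>Functions with continuous partial derivatives, and their moduli\<close>

definition line_C1 :: "(real ^ 'n::finite \<Rightarrow> real) \<Rightarrow> ('n \<Rightarrow> real ^ 'n \<Rightarrow> real) \<Rightarrow> bool" where
  "line_C1 a a' \<longleftrightarrow> continuous_on UNIV a \<and> (\<forall>i. continuous_on UNIV (a' i)) \<and>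
    (\<forall>i x. ((\<lambda>s. a (x + s *\<^sub>R axis i 1)) has_real_derivative a' i x) (at 0))"

lemma line_C1_bracket: "0 \<le> c \<Longrightarrow> line_C1 (bracket c b) (bracket_deriv c b)"
  by (simp add: line_C1_def bracket_cont bracket_deriv_cont bracket_line_deriv)

lemma line_C1_mult:
  assumes "line_C1 a a'" "line_C1 b b'"
  shows "line_C1 (\<lambda>x. a x * b x) (\<lambda>i x. a x * b' i x + a' i x * b x)"
  unfolding line_C1_def
proof (intro conjI allI)
  fix i x
  show "((\<lambda>s. a (x + s *\<^sub>R axis i 1) * b (x + s *\<^sub>R axis i 1)) has_real_derivative a x * b' i x + a' i x * b x) (at 0)"
    using DERIV_mult[of "\<lambda>s. a (x + s *\<^sub>R axis i 1)" "a' i x" 0 UNIV "\<lambda>s. b (x + s *\<^sub>R axis i 1)" "b' i x"] assms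
    by (simp add: line_C1_def algebra_simps)
qed (use assms in \<open>auto simp: line_C1_def intro!: continuous_intros\<close>)

lemma line_C1_cmult:
  assumes "line_C1 a a'"
  shows "line_C1 (\<lambda>x. r * a x) (\<lambda>i x. r * a' i x)"
  using assms by (auto simp: line_C1_def intro!: continuous_intros DERIV_cmult)

lemma line_C1_measurable:
  assumes "line_C1 a a'" shows "a \<in> borel_measurable borel" "a' i \<in> borel_measurable borel"
  using assms by (auto simp: line_C1_def intro: borel_measurable_continuous_onI)

lemma cauchy_schwarz3: "((a::real) * a' + b * b' + c * c')\<^sup>2 \<le> (a\<^sup>2 + b\<^sup>2 + c\<^sup>2) * (a'\<^sup>2 + b'\<^sup>2 + c'\<^sup>2)"
proof -
  have "(a\<^sup>2 + b\<^sup>2 + c\<^sup>2) * (a'\<^sup>2 + b'\<^sup>2 + c'\<^sup>2) - (a * a' + b * b' + c * c')\<^sup>2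
    = (a * b' - b * a')\<^sup>2 + (a * c' - c * a')\<^sup>2 + (b * c' - c * b')\<^sup>2"
    by (simp add: power2_eq_square algebra_simps)
  moreover have "\<dots> \<ge> 0" by simp
  ultimately show ?thesis by linarith
qed

text \<open>The gradient of a modulus is at most the gradient of the vector, by Cauchy-Schwarz. The
  positive third component keeps the root away from zero, where it would not be
  differentiable.\<close>

lemma line_C1_modulus:
  fixes a b c :: "real ^ 'n::finite \<Rightarrow> real"
  assumes a: "line_C1 a a'" and b: "line_C1 b b'" and c: "line_C1 c c'" and pos: "\<And>x. 0 < c x"
  defines "U \<equiv> \<lambda>x. sqrt ((a x)\<^sup>2 + (b x)\<^sup>2 + (c x)\<^sup>2)"
    and "G \<equiv> \<lambda>i x. (a x * a' i x + b x * b' i x + c x * c' i x) / sqrt ((a x)\<^sup>2 + (b x)\<^sup>2 + (c x)\<^sup>2)"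
  shows "line_C1 U G" "0 < U x" "(G i x)\<^sup>2 \<le> (a' i x)\<^sup>2 + (b' i x)\<^sup>2 + (c' i x)\<^sup>2"
proof -
  have sq: "0 < (a x)\<^sup>2 + (b x)\<^sup>2 + (c x)\<^sup>2" for x
    using pos[of x] by (intro add_nonneg_pos) auto
  then show Upos: "0 < U x" for x by (simp add: U_def)
  have Une: "sqrt ((a x)\<^sup>2 + (b x)\<^sup>2 + (c x)\<^sup>2) \<noteq> 0" for x using sq[of x] by simp
  show "(G i x)\<^sup>2 \<le> (a' i x)\<^sup>2 + (b' i x)\<^sup>2 + (c' i x)\<^sup>2"
    using cauchy_schwarz3[of "a x" "a' i x" "b x" "b' i x" "c x" "c' i x"] sq[of x]
    by (simp add: G_def power_divide divide_le_eq mult.commute less_imp_le)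
  show "line_C1 U G"
    unfolding line_C1_def
  proof (intro conjI allI)
    show "continuous_on UNIV U" unfolding U_def using a b c by (auto simp: line_C1_def intro!: continuous_intros)
    show "continuous_on UNIV (G i)" for i
      unfolding G_def using a b c Une by (auto simp: line_C1_def simp del: real_sqrt_eq_zero_cancel_iff intro!: continuous_intros)
    fix i and x :: "real ^ 'n"
    let ?l = "\<lambda>f s. f (x + s *\<^sub>R axis i 1)"
    have d: "(?l a has_real_derivative a' i x) (at 0)" "(?l b has_real_derivative b' i x) (at 0)" "(?l c has_real_derivative c' i x) (at 0)"
      using a b c by (auto simp: line_C1_def)
    have "((\<lambda>s. (?l a s)\<^sup>2 + (?l b s)\<^sup>2 + (?l c s)\<^sup>2) has_real_derivative 2 * (a x * a' i x + b x * b' i x + c x * c' i x)) (at 0)"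
      using DERIV_add[OF DERIV_add[OF DERIV_power[OF d(1), of 2] DERIV_power[OF d(2), of 2]] DERIV_power[OF d(3), of 2]]
      by (simp add: algebra_simps)
    from DERIV_chain2[OF DERIV_real_sqrt this] sq[of x]
    have "(?l U has_real_derivative inverse (sqrt ((a x)\<^sup>2 + (b x)\<^sup>2 + (c x)\<^sup>2)) / 2 * (2 * (a x * a' i x + b x * b' i x + c x * c' i x))) (at 0)"
      unfolding U_def by simp
    then show "(?l U has_real_derivative G i x) (at 0)"
    proof (rule DERIV_cong)
      have "inverse r / 2 * (2 * t) = t / r" for r t :: real by (simp add: field_simps)
      then show "inverse (sqrt ((a x)\<^sup>2 + (b x)\<^sup>2 + (c x)\<^sup>2)) / 2 * (2 * (a x * a' i x + b x * b' i x + c x * c' i x)) = G i x"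
        unfolding G_def .
    qed
  qed
qed

lemma sobolev_const_pos: "3 \<le> n \<Longrightarrow> 0 < sobolev_const n"
  unfolding sobolev_const_def
  by (intro mult_pos_pos powr_gt_zero[THEN iffD2] less_imp_neq[THEN not_sym] prod_pos bessel_pos) (auto simp: less_divide_eq)

lemma bracket_cutoff_lim: "(\<lambda>m. bracket (1 / (real (Suc m))\<^sup>2) b (x :: real ^ 'n::finite)) \<longlonglongrightarrow> 1"
  and bracket_deriv_cutoff_lim: "(\<lambda>m. bracket_deriv (1 / (real (Suc m))\<^sup>2) b i (x :: real ^ 'n)) \<longlonglongrightarrow> 0"
proof -
  have "(\<lambda>m. (inverse (real (Suc m)))\<^sup>2) \<longlonglongrightarrow> 0\<^sup>2"
    by (intro tendsto_power LIMSEQ_inverse_real_of_nat)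
  then have c: "(\<lambda>m. 1 / (real (Suc m))\<^sup>2) \<longlonglongrightarrow> 0" by (simp add: inverse_eq_divide power_divide del: of_nat_Suc)
  have "(\<lambda>m. (1 + 1 / (real (Suc m))\<^sup>2 * (norm x)\<^sup>2) powr b) \<longlonglongrightarrow> (1 + 0 * (norm x)\<^sup>2) powr b"
    by (intro tendsto_intros c) auto
  then show "(\<lambda>m. bracket (1 / (real (Suc m))\<^sup>2) b x) \<longlonglongrightarrow> 1" by (simp add: bracket_def del: of_nat_Suc)
  have "(\<lambda>m. b * (1 + 1 / (real (Suc m))\<^sup>2 * (norm x)\<^sup>2) powr (b - 1) * (2 * (1 / (real (Suc m))\<^sup>2) * x $ i))
      \<longlonglongrightarrow> b * (1 + 0 * (norm x)\<^sup>2) powr (b - 1) * (2 * 0 * x $ i)"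
    by (intro tendsto_intros c) auto
  then show "(\<lambda>m. bracket_deriv (1 / (real (Suc m))\<^sup>2) b i x) \<longlonglongrightarrow> 0" by (simp add: bracket_deriv_def del: of_nat_Suc)
qed

text \<open>\<open>a\<close> and \<open>b\<close> stand for the real and imaginary parts of a
  complex function. They are treated jointly, since separate estimates followed by a triangle
  inequality would lose the sharp constant.\<close>

locale C1_pair =
  fixes a b :: "real ^ 'n::finite \<Rightarrow> real" and a' b' :: "'n \<Rightarrow> real ^ 'n \<Rightarrow> real" and B n :: real
  assumes n_eq: "n = real CARD('n)" and dim: "3 \<le> CARD('n)"
    and a: "line_C1 a a'" and b: "line_C1 b b'"
    and sq: "integrable lborel (\<lambda>x. (a x)\<^sup>2)" "integrable lborel (\<lambda>x. (b x)\<^sup>2)"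
    and sq': "\<And>i. integrable lborel (\<lambda>x. (a' i x)\<^sup>2)" "\<And>i. integrable lborel (\<lambda>x. (b' i x)\<^sup>2)"
    and bnd: "\<And>x. \<bar>a x\<bar> \<le> B" "\<And>x. \<bar>b x\<bar> \<le> B"
begin

text \<open>The modulus of (\<eta> a, \<eta> b, \<omega> / (m + 1)) meets the hypotheses of
  \<open>smooth_decaying\<close>: \<eta> supplies the decay and \<omega> the positivity.
  \<open>F i\<close> bounds the squared derivative of this modulus, and its own bound is independent
  of \<open>m\<close>, ready for dominated convergence.\<close>

lemma cutoff_sobolev:
  fixes m :: nat
  defines "\<eta> \<equiv> bracket (1 / (real (Suc m))\<^sup>2) (- n)" and "\<omega> \<equiv> bracket 1 (- n)"
    and "\<eta>' \<equiv> bracket_deriv (1 / (real (Suc m))\<^sup>2) (- n)" and "\<omega>' \<equiv> bracket_deriv 1 (- n)"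
  defines "F \<equiv> \<lambda>i x. (\<eta> x * a' i x + \<eta>' i x * a x)\<^sup>2 + (\<eta> x * b' i x + \<eta>' i x * b x)\<^sup>2 + (1 / real (Suc m) * \<omega>' i x)\<^sup>2"
  shows "(\<integral>\<^sup>+x. ennreal (((\<eta> x * a x)\<^sup>2 + (\<eta> x * b x)\<^sup>2 + (1 / real (Suc m) * \<omega> x)\<^sup>2) powr (two_upper CARD('n) / 2)) \<partial>lborel)
    \<le> ennreal (((LINT x|lborel. (\<Sum>i\<in>UNIV. F i x)) / sobolev_const CARD('n)) powr (two_upper CARD('n) / 2))"
    and "F i x \<le> 2 * (a' i x)\<^sup>2 + 2 * n\<^sup>2 * (a x)\<^sup>2 + 2 * (b' i x)\<^sup>2 + 2 * n\<^sup>2 * (b x)\<^sup>2 + n\<^sup>2 * \<omega> x"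
    and "F i \<in> borel_measurable borel"
proof -
  define c where "c = 1 / (real (Suc m))\<^sup>2"
  have c: "0 < c" "c \<le> 1" "sqrt c \<le> 1" by (auto simp: c_def real_sqrt_divide divide_le_eq power2_eq_square intro!: mult_ge1_I)
  have n: "3 \<le> n" using dim n_eq by simp
  have \<eta>: "0 < \<eta> x" "\<eta> x \<le> 1" for x
    unfolding \<eta>_def c_def[symmetric] using bracket_pos[of c "- n" x] bracket_le_1[of c "- n" x] c n by auto
  have \<omega>: "0 < \<omega> x" "\<omega> x \<le> 1" for x
    unfolding \<omega>_def using bracket_pos[of 1 "- n" x] bracket_le_1[of 1 "- n" x] n by auto
  have \<eta>': "\<bar>\<eta>' i x\<bar> \<le> n" for i x
  proof -
    have "\<bar>\<eta>' i x\<bar> \<le> \<bar>- n\<bar> * sqrt c * \<eta> x"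
      unfolding \<eta>'_def \<eta>_def c_def[symmetric] using c by (intro bracket_deriv_bound) auto
    also have "\<dots> \<le> \<bar>- n\<bar> * 1 * 1" using c \<eta>[of x] by (intro mult_mono) (auto intro: less_imp_le)
    finally show ?thesis using n by simp
  qed
  have \<omega>': "\<bar>\<omega>' i x\<bar> \<le> n * \<omega> x" for i x
    using bracket_deriv_bound[of 1 "- n" i x] n by (simp add: \<omega>'_def \<omega>_def)
  have \<eta>C: "line_C1 \<eta> \<eta>'" and \<omega>C: "line_C1 \<omega> \<omega>'"
    unfolding \<eta>_def \<eta>'_def \<omega>_def \<omega>'_def by (auto intro: line_C1_bracket)
  note C1a = line_C1_mult[OF \<eta>C a] and C1b = line_C1_mult[OF \<eta>C b] and C1c = line_C1_cmult[OF \<omega>C, of "1 / real (Suc m)"]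
  have cpos: "0 < 1 / real (Suc m) * \<omega> x" for x using \<omega> by simp
  define U where "U x = sqrt ((\<eta> x * a x)\<^sup>2 + (\<eta> x * b x)\<^sup>2 + (1 / real (Suc m) * \<omega> x)\<^sup>2)" for x
  define G where "G i x = (\<eta> x * a x * (\<eta> x * a' i x + \<eta>' i x * a x) + \<eta> x * b x * (\<eta> x * b' i x + \<eta>' i x * b x)
      + 1 / real (Suc m) * \<omega> x * (1 / real (Suc m) * \<omega>' i x)) / sqrt ((\<eta> x * a x)\<^sup>2 + (\<eta> x * b x)\<^sup>2 + (1 / real (Suc m) * \<omega> x)\<^sup>2)" for i x
  have UG: "line_C1 U G" "0 < U x" "(G i x)\<^sup>2 \<le> F i x" for i x
    using line_C1_modulus[OF C1a C1b C1c cpos] unfolding U_def[abs_def] G_def[abs_def] F_def by blast+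
  have \<omega>_int: "integrable lborel \<omega>"
    unfolding \<omega>_def using n n_eq by (intro integrable_bracket_1) simp
  show F_meas: "F i \<in> borel_measurable borel" for i
    unfolding F_def using line_C1_measurable[OF a] line_C1_measurable[OF b] line_C1_measurable[OF \<eta>C] line_C1_measurable[OF \<omega>C]
    by measurable
  have two: "(s * u + t * v)\<^sup>2 \<le> 2 * u\<^sup>2 + 2 * n\<^sup>2 * v\<^sup>2" if "0 < s" "s \<le> 1" "\<bar>t\<bar> \<le> n" for s t u v :: real
  proof -
    have "(s * u + t * v)\<^sup>2 \<le> 2 * (s * u)\<^sup>2 + 2 * (t * v)\<^sup>2"
      using zero_le_power2[of "s * u - t * v"] by (simp add: power2_eq_square algebra_simps)
    moreover have "(s * u)\<^sup>2 \<le> 1 * u\<^sup>2" using that unfolding power_mult_distrib by (intro mult_right_mono) (auto simp: power_le_one)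
    moreover have "(t * v)\<^sup>2 \<le> n\<^sup>2 * v\<^sup>2" using that unfolding power_mult_distrib by (intro mult_right_mono) (auto simp: abs_le_square_iff[symmetric])
    ultimately show ?thesis by simp
  qed
  show F_le: "F i x \<le> 2 * (a' i x)\<^sup>2 + 2 * n\<^sup>2 * (a x)\<^sup>2 + 2 * (b' i x)\<^sup>2 + 2 * n\<^sup>2 * (b x)\<^sup>2 + n\<^sup>2 * \<omega> x" for i x
  proof -
    have "(1 / real (Suc m) * \<omega>' i x)\<^sup>2 \<le> 1 * (n * \<omega> x)\<^sup>2"
      unfolding power_mult_distrib[of "1 / real (Suc m)"] using \<omega>'[of i x] \<omega>[of x] n
      by (intro mult_mono) (auto simp: abs_le_square_iff[symmetric] power_le_one)
    also have "\<dots> \<le> n\<^sup>2 * \<omega> x"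
      using \<omega>[of x] by (simp add: power_mult_distrib power2_eq_square[of "\<omega> x"] mult_left_mono mult_left_le)
    finally show ?thesis
      using two[OF \<eta>[of x] \<eta>'[of i x], of "a' i x" "a x"] two[OF \<eta>[of x] \<eta>'[of i x], of "b' i x" "b x"] by (simp add: F_def)
  qed
  have F_int: "integrable lborel (F i)" for i
  proof (rule Bochner_Integration.integrable_bound)
    show "integrable lborel (\<lambda>x. 2 * (a' i x)\<^sup>2 + 2 * n\<^sup>2 * (a x)\<^sup>2 + 2 * (b' i x)\<^sup>2 + 2 * n\<^sup>2 * (b x)\<^sup>2 + n\<^sup>2 * \<omega> x)"
      using sq sq' \<omega>_int by auto
    show "AE x in lborel. norm (F i x) \<le> norm (2 * (a' i x)\<^sup>2 + 2 * n\<^sup>2 * (a x)\<^sup>2 + 2 * (b' i x)\<^sup>2 + 2 * n\<^sup>2 * (b x)\<^sup>2 + n\<^sup>2 * \<omega> x)"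
    proof (rule AE_I2)
      fix x
      have "0 \<le> F i x" by (simp add: F_def)
      then show "norm (F i x) \<le> norm (2 * (a' i x)\<^sup>2 + 2 * n\<^sup>2 * (a x)\<^sup>2 + 2 * (b' i x)\<^sup>2 + 2 * n\<^sup>2 * (b x)\<^sup>2 + n\<^sup>2 * \<omega> x)"
        using F_le[of i x] by simp
    qed
  qed (use F_meas in simp)
  have [measurable]: "U \<in> borel_measurable borel" "G i \<in> borel_measurable borel" for i
    using line_C1_measurable[OF UG(1)] by auto
  \<comment> \<open>Both a and b are at most \<open>B\<close> in modulus and \<eta> is at most
    \<open>min 1 c powr (- n)\<close> times \<omega>; the summand 1 accounts for \<omega> / (m + 1).
    The constant may blow up with \<open>m\<close>, because it does not enter the resulting
    inequality.\<close>
  interpret S: smooth_decaying U G "2 * B * min 1 c powr (- n) + 1"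
  proof
    show "3 \<le> CARD('n)" by (rule dim)
    show "0 < U x" for x by (rule UG(2))
    show "continuous_on UNIV U" "continuous_on UNIV (G i)" "((\<lambda>s. U (x + s *\<^sub>R axis i 1)) has_real_derivative G i x) (at 0)" for i x
      using UG(1) by (auto simp: line_C1_def)
    show "integrable lborel (\<lambda>x. (G i x)\<^sup>2)" for i
    proof (rule Bochner_Integration.integrable_bound[OF F_int])
      show "AE x in lborel. norm ((G i x)\<^sup>2) \<le> norm (F i x)"
        using UG(3) by (intro AE_I2) (auto intro: order_trans[OF _ abs_ge_self])
    qed simp
    show "integrable lborel (\<lambda>x. (U x)\<^sup>2)"
    proof (rule Bochner_Integration.integrable_bound)
      show "integrable lborel (\<lambda>x. (a x)\<^sup>2 + (b x)\<^sup>2 + \<omega> x)" using sq \<omega>_int by auto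
      show "AE x in lborel. norm ((U x)\<^sup>2) \<le> norm ((a x)\<^sup>2 + (b x)\<^sup>2 + \<omega> x)"
      proof (rule AE_I2)
        fix x
        have "(\<eta> x * u)\<^sup>2 \<le> 1 * u\<^sup>2" for u using \<eta>[of x] unfolding power_mult_distrib by (intro mult_right_mono) (auto simp: power_le_one)
        moreover have "(1 / real (Suc m) * \<omega> x)\<^sup>2 \<le> \<omega> x"
        proof -
          have "(1 / real (Suc m) * \<omega> x)\<^sup>2 \<le> 1 * (\<omega> x)\<^sup>2"
            unfolding power_mult_distrib by (intro mult_right_mono) (auto simp: power_le_one)
          also have "\<dots> \<le> \<omega> x" using \<omega>[of x] by (simp add: power2_eq_square mult_left_le)
          finally show ?thesis .
        qed
        ultimately show "norm ((U x)\<^sup>2) \<le> norm ((a x)\<^sup>2 + (b x)\<^sup>2 + \<omega> x)"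
          using \<omega>[of x] by (simp add: U_def add_mono)
      qed
    qed simp
    fix x
    have tri: "sqrt (u\<^sup>2 + v\<^sup>2 + w\<^sup>2) \<le> \<bar>u\<bar> + \<bar>v\<bar> + \<bar>w\<bar>" for u v w :: real
      using sqrt_sum_squares_le_sum_abs[of "sqrt (u\<^sup>2 + v\<^sup>2)" w] sqrt_sum_squares_le_sum_abs[of u v] by simp
    have "U x \<le> \<eta> x * \<bar>a x\<bar> + \<eta> x * \<bar>b x\<bar> + 1 / real (Suc m) * \<omega> x"
      using tri[of "\<eta> x * a x" "\<eta> x * b x" "1 / real (Suc m) * \<omega> x"] \<eta>[of x] \<omega>[of x] by (simp add: U_def abs_mult)
    also have "\<dots> \<le> \<eta> x * B + \<eta> x * B + 1 * \<omega> x"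
      using \<eta>[of x] \<omega>[of x] bnd by (intro add_mono mult_left_mono mult_right_mono) (auto intro: less_imp_le)
    also have "\<dots> \<le> (min 1 c powr (- n) * \<omega> x) * B + (min 1 c powr (- n) * \<omega> x) * B + 1 * \<omega> x"
    proof -
      have "\<eta> x \<le> min 1 c powr (- n) * \<omega> x"
        unfolding \<eta>_def \<omega>_def c_def[symmetric] using c n by (intro bracket_mono) auto
      moreover have "0 \<le> B" using bnd(1)[of x] by simp
      ultimately show ?thesis using \<omega>[of x] by (intro add_mono mult_right_mono) auto
    qed
    also have "\<dots> = (2 * B * min 1 c powr (- n) + 1) * \<omega> x" by (simp add: algebra_simps)
    also have "\<dots> \<le> (2 * B * min 1 c powr (- n) + 1) * (\<Prod>i\<in>UNIV. (1 + (x $ i)\<^sup>2) powr - 1)"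
    proof (rule mult_left_mono)
      show "\<omega> x \<le> (\<Prod>i\<in>UNIV. (1 + (x $ i)\<^sup>2) powr - 1)" unfolding \<omega>_def n_eq by (rule bracket_le_decay)
      show "0 \<le> 2 * B * min 1 c powr (- n) + 1" using bnd(1)[of x] by simp
    qed
    finally show "U x \<le> (2 * B * min 1 c powr (- n) + 1) * (\<Prod>i\<in>UNIV. (1 + (x $ i)\<^sup>2) powr - 1)" .
  qed
  let ?p = "two_upper CARD('n)"
  let ?S = "sobolev_const CARD('n)"
  have p: "2 < ?p" using two_upper_gt[OF dim] .
  have S: "0 < ?S" using sobolev_const_pos[OF dim] .
  define I where "I = (LINT x|lborel. U x powr ?p)"
  have I: "0 \<le> I" unfolding I_def by (intro Bochner_Integration.integral_nonneg) auto
  have "?S * I powr (2 / ?p) \<le> (LINT x|lborel. (\<Sum>i\<in>UNIV. (G i x)\<^sup>2))"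
    unfolding I_def by (rule S.sobolev)
  also have "\<dots> \<le> (LINT x|lborel. (\<Sum>i\<in>UNIV. F i x))"
    using F_int S.G_sq UG(3) by (intro integral_mono) (auto intro: sum_mono)
  finally have "I powr (2 / ?p) \<le> (LINT x|lborel. (\<Sum>i\<in>UNIV. F i x)) / ?S"
    using S by (simp add: field_simps)
  then have "(I powr (2 / ?p)) powr (?p / 2) \<le> ((LINT x|lborel. (\<Sum>i\<in>UNIV. F i x)) / ?S) powr (?p / 2)"
    using p by (intro powr_mono2) auto
  then have I_le: "I \<le> ((LINT x|lborel. (\<Sum>i\<in>UNIV. F i x)) / ?S) powr (?p / 2)"
    using I p by (simp add: powr_powr)
  have "((\<eta> x * a x)\<^sup>2 + (\<eta> x * b x)\<^sup>2 + (1 / real (Suc m) * \<omega> x)\<^sup>2) powr (?p / 2) = U x powr ?p" for x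
  proof -
    have "U x powr ?p = (U x powr 2) powr (?p / 2)" by (simp add: powr_powr)
    also have "U x powr 2 = (U x)\<^sup>2" using UG(2)[of x] by simp
    also have "(U x)\<^sup>2 = (\<eta> x * a x)\<^sup>2 + (\<eta> x * b x)\<^sup>2 + (1 / real (Suc m) * \<omega> x)\<^sup>2"
      unfolding U_def by (intro real_sqrt_pow2 add_nonneg_nonneg) auto
    finally show ?thesis by simp
  qed
  then show "(\<integral>\<^sup>+x. ennreal (((\<eta> x * a x)\<^sup>2 + (\<eta> x * b x)\<^sup>2 + (1 / real (Suc m) * \<omega> x)\<^sup>2) powr (?p / 2)) \<partial>lborel)
    \<le> ennreal (((LINT x|lborel. (\<Sum>i\<in>UNIV. F i x)) / ?S) powr (?p / 2))"
    using I_le nn_integral_eq_integral[OF S.powr_integrable[of ?p]] p by (simp add: I_def ennreal_leI)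
qed

text \<open>As m grows the cutoff tends to one and its derivative and the corrector tend to zero.
  The gradient side converges by domination, the critical norm by Fatou.\<close>

lemma sobolev_pair:
  "(\<integral>\<^sup>+x. ennreal (((a x)\<^sup>2 + (b x)\<^sup>2) powr (two_upper CARD('n) / 2)) \<partial>lborel)
    \<le> ennreal (((LINT x|lborel. (\<Sum>i\<in>UNIV. (a' i x)\<^sup>2 + (b' i x)\<^sup>2)) / sobolev_const CARD('n)) powr (two_upper CARD('n) / 2))"
proof -
  let ?p = "two_upper CARD('n)" and ?S = "sobolev_const CARD('n)"
  have p: "2 < ?p" using two_upper_gt[OF dim] .
  let ?\<eta> = "\<lambda>m. bracket (1 / (real (Suc m))\<^sup>2) (- n) :: real ^ 'n \<Rightarrow> real" and ?\<omega> = "bracket 1 (- n) :: real ^ 'n \<Rightarrow> real"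
  let ?\<eta>' = "\<lambda>m. bracket_deriv (1 / (real (Suc m))\<^sup>2) (- n) :: 'n \<Rightarrow> real ^ 'n \<Rightarrow> real" and ?\<omega>' = "bracket_deriv 1 (- n) :: 'n \<Rightarrow> real ^ 'n \<Rightarrow> real"
  define F where "F m i x = (?\<eta> m x * a' i x + ?\<eta>' m i x * a x)\<^sup>2 + (?\<eta> m x * b' i x + ?\<eta>' m i x * b x)\<^sup>2 + (1 / real (Suc m) * ?\<omega>' i x)\<^sup>2" for m i x
  have inv: "(\<lambda>m. 1 / real (Suc m)) \<longlonglongrightarrow> 0"
    using LIMSEQ_inverse_real_of_nat by (simp add: inverse_eq_divide del: of_nat_Suc)
  have n: "3 \<le> n" using dim n_eq by simp
  have \<omega>_int: "integrable lborel ?\<omega>" using n n_eq by (intro integrable_bracket_1) simp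
  have F_lim: "(\<lambda>m. \<Sum>i\<in>UNIV. F m i x) \<longlonglongrightarrow> (\<Sum>i\<in>UNIV. (a' i x)\<^sup>2 + (b' i x)\<^sup>2)" for x
  proof -
    have "(\<lambda>m. F m i x) \<longlonglongrightarrow> (1 * a' i x + 0 * a x)\<^sup>2 + (1 * b' i x + 0 * b x)\<^sup>2 + (0 * ?\<omega>' i x)\<^sup>2" for i
      unfolding F_def by (intro tendsto_intros bracket_cutoff_lim bracket_deriv_cutoff_lim inv)
    then show ?thesis by (intro tendsto_sum) simp
  qed
  have "(\<lambda>m. LINT x|lborel. (\<Sum>i\<in>UNIV. F m i x)) \<longlonglongrightarrow> (LINT x|lborel. (\<Sum>i\<in>UNIV. (a' i x)\<^sup>2 + (b' i x)\<^sup>2))"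
  proof (rule integral_dominated_convergence)
    show "integrable lborel (\<lambda>x. \<Sum>i\<in>UNIV. 2 * (a' i x)\<^sup>2 + 2 * n\<^sup>2 * (a x)\<^sup>2 + 2 * (b' i x)\<^sup>2 + 2 * n\<^sup>2 * (b x)\<^sup>2 + n\<^sup>2 * ?\<omega> x)"
      using sq sq' \<omega>_int by auto
    show "AE x in lborel. norm (\<Sum>i\<in>UNIV. F m i x)
      \<le> (\<Sum>i\<in>UNIV. 2 * (a' i x)\<^sup>2 + 2 * n\<^sup>2 * (a x)\<^sup>2 + 2 * (b' i x)\<^sup>2 + 2 * n\<^sup>2 * (b x)\<^sup>2 + n\<^sup>2 * ?\<omega> x)" for m
    proof (rule AE_I2)
      fix x
      have "0 \<le> F m i x" for i by (simp add: F_def)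
      then have "norm (\<Sum>i\<in>UNIV. F m i x) = (\<Sum>i\<in>UNIV. F m i x)" by (simp add: sum_nonneg)
      also have "\<dots> \<le> (\<Sum>i\<in>UNIV. 2 * (a' i x)\<^sup>2 + 2 * n\<^sup>2 * (a x)\<^sup>2 + 2 * (b' i x)\<^sup>2 + 2 * n\<^sup>2 * (b x)\<^sup>2 + n\<^sup>2 * ?\<omega> x)"
        unfolding F_def by (intro sum_mono cutoff_sobolev(2))
      finally show "norm (\<Sum>i\<in>UNIV. F m i x)
        \<le> (\<Sum>i\<in>UNIV. 2 * (a' i x)\<^sup>2 + 2 * n\<^sup>2 * (a x)\<^sup>2 + 2 * (b' i x)\<^sup>2 + 2 * n\<^sup>2 * (b x)\<^sup>2 + n\<^sup>2 * ?\<omega> x)" .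
    qed
    show "(\<lambda>x. \<Sum>i\<in>UNIV. F m i x) \<in> borel_measurable lborel" for m
      using cutoff_sobolev(3)[of m] unfolding F_def[abs_def] by (intro borel_measurable_sum) simp
    show "(\<lambda>x. \<Sum>i\<in>UNIV. (a' i x)\<^sup>2 + (b' i x)\<^sup>2) \<in> borel_measurable lborel"
      using line_C1_measurable[OF a] line_C1_measurable[OF b] by measurable
  qed (use F_lim in auto)
  moreover have "0 \<le> (LINT x|lborel. (\<Sum>i\<in>UNIV. F m i x)) / ?S" for m
    using sobolev_const_pos[OF dim]
    by (intro divide_nonneg_pos Bochner_Integration.integral_nonneg sum_nonneg) (simp_all add: F_def)
  ultimately have lim: "(\<lambda>m. ennreal (((LINT x|lborel. (\<Sum>i\<in>UNIV. F m i x)) / ?S) powr (?p / 2)))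
    \<longlonglongrightarrow> ennreal (((LINT x|lborel. (\<Sum>i\<in>UNIV. (a' i x)\<^sup>2 + (b' i x)\<^sup>2)) / ?S) powr (?p / 2))"
    using p sobolev_const_pos[OF dim]
    by (intro tendsto_ennrealI tendsto_powr'[OF tendsto_divide[OF _ tendsto_const] tendsto_const])
      (simp_all only: eventually_True, simp_all)
  show ?thesis
  proof (rule nn_integral_limit_le[OF _ _ _ _ lim])
    show "(\<lambda>x. ennreal (((?\<eta> k x * a x)\<^sup>2 + (?\<eta> k x * b x)\<^sup>2 + (1 / real (Suc k) * ?\<omega> x)\<^sup>2) powr (?p / 2))) \<in> borel_measurable lborel" for k
      using line_C1_measurable(1)[OF a] line_C1_measurable(1)[OF b] line_C1_measurable(1)[OF line_C1_bracket, of "1 / (real (Suc k))\<^sup>2" "- n"]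
        line_C1_measurable(1)[OF line_C1_bracket, of 1 "- n"] by measurable
    show "(\<lambda>x. ennreal (((a x)\<^sup>2 + (b x)\<^sup>2) powr (?p / 2))) \<in> borel_measurable lborel"
      using line_C1_measurable(1)[OF a] line_C1_measurable(1)[OF b] by measurable
    show "AE x in lborel. (\<lambda>k. ennreal (((?\<eta> k x * a x)\<^sup>2 + (?\<eta> k x * b x)\<^sup>2 + (1 / real (Suc k) * ?\<omega> x)\<^sup>2) powr (?p / 2)))
      \<longlonglongrightarrow> ennreal (((a x)\<^sup>2 + (b x)\<^sup>2) powr (?p / 2))"
    proof (rule AE_I2)
      fix x
      have "(\<lambda>k. (?\<eta> k x * a x)\<^sup>2 + (?\<eta> k x * b x)\<^sup>2 + (1 / real (Suc k) * ?\<omega> x)\<^sup>2) \<longlonglongrightarrow> (1 * a x)\<^sup>2 + (1 * b x)\<^sup>2 + (0 * ?\<omega> x)\<^sup>2"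
        by (intro tendsto_intros bracket_cutoff_lim inv)
      then have L: "(\<lambda>k. (?\<eta> k x * a x)\<^sup>2 + (?\<eta> k x * b x)\<^sup>2 + (1 / real (Suc k) * ?\<omega> x)\<^sup>2) \<longlonglongrightarrow> (a x)\<^sup>2 + (b x)\<^sup>2" by simp
      show "(\<lambda>k. ennreal (((?\<eta> k x * a x)\<^sup>2 + (?\<eta> k x * b x)\<^sup>2 + (1 / real (Suc k) * ?\<omega> x)\<^sup>2) powr (?p / 2)))
        \<longlonglongrightarrow> ennreal (((a x)\<^sup>2 + (b x)\<^sup>2) powr (?p / 2))"
        using p by (intro tendsto_ennrealI tendsto_powr'[OF L tendsto_const]) simp
    qed
    show "(\<integral>\<^sup>+x. ennreal (((?\<eta> k x * a x)\<^sup>2 + (?\<eta> k x * b x)\<^sup>2 + (1 / real (Suc k) * ?\<omega> x)\<^sup>2) powr (?p / 2)) \<partial>lborel)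
      \<le> ennreal (((LINT x|lborel. (\<Sum>i\<in>UNIV. F k i x)) / ?S) powr (?p / 2))" for k
      unfolding F_def by (rule cutoff_sobolev(1))
  qed
qed

end


section \<open>Mollification\<close>

text \<open>Correlation rather than convolution: as a function of \<open>y\<close>, the kernel is a
  translate of \<phi> without reflection, hence again a box bump and directly usable as a test
  function.\<close>

definition correlation :: "(real ^ 'n::finite \<Rightarrow> real) \<Rightarrow> (real ^ 'n \<Rightarrow> real) \<Rightarrow> real ^ 'n \<Rightarrow> real" where
  "correlation \<phi> v x = (LINT y|lborel. \<phi> (y - x) * v y)"

lemma square_integrable_local:
  fixes v :: "real ^ 'n::finite \<Rightarrow> real"
  assumes [measurable]: "v \<in> borel_measurable borel" and "integrable lborel (\<lambda>x. (v x)\<^sup>2)"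
  shows "integrable lborel (\<lambda>y. indicator (cball x r) y * \<bar>v y\<bar>)"
proof (rule Bochner_Integration.integrable_bound)
  have "integrable lborel (indicator (cball x r) :: real ^ 'n \<Rightarrow> real)"
    by (intro integrable_real_indicator) (use emeasure_compact_finite[OF compact_cball, of x r] in \<open>auto simp: infinity_ennreal_def\<close>)
  then show "integrable lborel (\<lambda>y. indicator (cball x r) y + (v y)\<^sup>2)"
    using assms by auto
  show "AE y in lborel. norm (indicator (cball x r) y * \<bar>v y\<bar>) \<le> norm (indicator (cball x r) y + (v y)\<^sup>2)"
  proof (rule AE_I2)
    fix y
    have "\<bar>v y\<bar> \<le> 1 + (v y)\<^sup>2"
      using zero_le_power2[of "1 - \<bar>v y\<bar>"] by (simp add: power2_eq_square algebra_simps)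
    then show "norm (indicator (cball x r) y * \<bar>v y\<bar>) \<le> norm (indicator (cball x r) y + (v y)\<^sup>2)"
      by (auto simp: indicator_def)
  qed
  show "(\<lambda>y. indicator (cball x r) y * \<bar>v y\<bar>) \<in> borel_measurable lborel"
    using assms(1) by (intro borel_measurable_times borel_measurable_indicator) auto
qed

text \<open>\<open>V\<close> is an upper bound for the mass rather than its value: the bumps stay
  below the indicator of their box, whose volume is the convenient normalisation, and the estimates
  in L^2 only use this direction.\<close>

locale kernel =
  fixes \<phi> :: "real ^ 'n::finite \<Rightarrow> real" and R V :: real
  assumes test: "test_function \<phi>" and nonneg: "\<And>x. 0 \<le> \<phi> x" and le_1: "\<And>x. \<phi> x \<le> 1"
    and support: "\<And>x. x \<notin> cball 0 R \<Longrightarrow> \<phi> x = 0"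
    and int: "integrable lborel \<phi>" and mass: "(LINT x|lborel. \<phi> x) \<le> V" and V: "0 < V"
begin

lemma \<phi>_meas [measurable]: "\<phi> \<in> borel_measurable borel"
  using test_function_cont[OF test] by (rule borel_measurable_continuous_onI)

lemma \<phi>_le_ball: "\<bar>\<phi> (y - x)\<bar> \<le> indicator (cball x R) y"
  using nonneg[of "y - x"] le_1[of "y - x"] support[of "y - x"]
  by (auto simp: indicator_def dist_norm norm_minus_commute)

lemma \<phi>_shift: "integrable lborel (\<lambda>y. \<phi> (y - x))" "(LINT y|lborel. \<phi> (y - x)) = (LINT y|lborel. \<phi> y)"
  using integrable_lborel_translate[OF int, of "- x"] integral_lborel_translate[OF int, of "- x"] by simp_all

context
  fixes v :: "real ^ 'n \<Rightarrow> real"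
  assumes v_meas [measurable]: "v \<in> borel_measurable borel" and v_sq: "integrable lborel (\<lambda>x. (v x)\<^sup>2)"
begin

lemma correlation_integrable: "integrable lborel (\<lambda>y. \<phi> (y - x) * v y)"
proof (rule Bochner_Integration.integrable_bound[OF square_integrable_local[OF v_meas v_sq]])
  show "AE y in lborel. norm (\<phi> (y - x) * v y) \<le> norm (indicator (cball x R) y * \<bar>v y\<bar>)"
    using \<phi>_le_ball by (intro AE_I2) (simp add: abs_mult mult_right_mono)
qed measurable

lemma correlation_cont: "continuous_on UNIV (correlation \<phi> v)"
  unfolding correlation_def[abs_def]
proof (rule continuous_on_LINT)
  show "continuous_on UNIV (\<lambda>x. \<phi> (y - x) * v y)" for y
    by (intro continuous_intros continuous_on_compose2[OF test_function_cont[OF test]]) auto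
  fix x0 :: "real ^ 'n"
  have "\<bar>\<phi> (y - x) * v y\<bar> \<le> indicator (cball x0 (R + 1)) y * \<bar>v y\<bar>" if "x \<in> ball x0 1" for x y
  proof -
    have "indicator (cball x R) y \<le> (indicator (cball x0 (R + 1)) y :: real)"
      using that dist_triangle[of x0 y x] by (auto simp: indicator_def)
    then show ?thesis using \<phi>_le_ball[of y x] by (auto simp: abs_mult intro!: mult_right_mono)
  qed
  then show "\<exists>w. integrable lborel w \<and> (\<forall>\<^sub>F x in nhds x0. \<forall>y. norm (\<phi> (y - x) * v y) \<le> w y)"
    using square_integrable_local[OF v_meas v_sq, of x0 "R + 1"] eventually_nhds_in_open[of "ball x0 1" x0]
    by (intro exI[of _ "\<lambda>y. indicator (cball x0 (R + 1)) y * \<bar>v y\<bar>"]) (auto elim!: eventually_mono)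
qed measurable

lemma correlation_bounded: "\<bar>correlation \<phi> v x\<bar> \<le> V + (LINT y|lborel. (v y)\<^sup>2)"
proof -
  have "\<bar>correlation \<phi> v x\<bar> \<le> (LINT y|lborel. \<phi> (y - x) + (v y)\<^sup>2)"
    unfolding correlation_def
  proof (rule integral_abs_bound[THEN order_trans], rule integral_mono)
    fix y
    have "\<bar>v y\<bar> \<le> 1 + (v y)\<^sup>2"
      using zero_le_power2[of "1 - \<bar>v y\<bar>"] by (simp add: power2_eq_square algebra_simps)
    then have "\<phi> (y - x) * \<bar>v y\<bar> \<le> \<phi> (y - x) * (1 + (v y)\<^sup>2)"
      using nonneg by (intro mult_left_mono) auto
    also have "\<dots> \<le> \<phi> (y - x) + 1 * (v y)\<^sup>2"
      using le_1[of "y - x"] by (simp add: distrib_left mult_right_le_one_le mult_left_le_one_le nonneg)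
    finally show "\<bar>\<phi> (y - x) * v y\<bar> \<le> \<phi> (y - x) + (v y)\<^sup>2" using nonneg by (simp add: abs_mult)
  qed (use correlation_integrable \<phi>_shift v_sq in auto)
  also have "\<dots> = (LINT y|lborel. \<phi> y) + (LINT y|lborel. (v y)\<^sup>2)"
    using \<phi>_shift v_sq by simp
  finally show ?thesis using mass by simp
qed

lemma correlation_translated: "correlation \<phi> v x = (LINT z|lborel. \<phi> z * v (z + x))"
  using integral_lborel_translate[OF correlation_integrable, of x x] by (simp add: correlation_def)

text \<open>Cauchy-Schwarz with respect to the measure \<phi> dz of mass at most \<open>V\<close>,
  obtained as nonnegativity of a variance.\<close>

lemma correlation_sq_le: "(correlation \<phi> v x)\<^sup>2 \<le> V * (LINT z|lborel. \<phi> z * (v (z + x))\<^sup>2)"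
proof -
  have 1: "integrable lborel (\<lambda>z. \<phi> z * v (z + x))"
    using integrable_lborel_translate[OF correlation_integrable, of x x] by simp
  have 2: "integrable lborel (\<lambda>z. \<phi> z * (v (z + x))\<^sup>2)"
  proof (rule Bochner_Integration.integrable_bound[OF integrable_lborel_translate[OF v_sq, of x]])
    show "AE z in lborel. norm (\<phi> z * (v (z + x))\<^sup>2) \<le> norm ((v (z + x))\<^sup>2)"
      using nonneg le_1 by (intro AE_I2) (simp add: abs_mult mult_left_le_one_le)
  qed measurable
  define W where "W = correlation \<phi> v x"
  define Q where "Q = (LINT z|lborel. \<phi> z * (v (z + x))\<^sup>2)"
  \<comment> \<open>The minimiser of Q - 2 \<mu> W + \<mu>^2 V, which bounds the expanded variance
    from above.\<close>
  define \<mu> where "\<mu> = W / V"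
  have "0 \<le> (LINT z|lborel. \<phi> z * (v (z + x) - \<mu>)\<^sup>2)"
    by (intro Bochner_Integration.integral_nonneg) (simp add: nonneg)
  also have "(\<lambda>z. \<phi> z * (v (z + x) - \<mu>)\<^sup>2) = (\<lambda>z. \<phi> z * (v (z + x))\<^sup>2 - 2 * \<mu> * (\<phi> z * v (z + x)) + \<mu>\<^sup>2 * \<phi> z)"
    by (simp add: fun_eq_iff power2_eq_square algebra_simps)
  also have "(LINT z|lborel. \<phi> z * (v (z + x))\<^sup>2 - 2 * \<mu> * (\<phi> z * v (z + x)) + \<mu>\<^sup>2 * \<phi> z) = Q - 2 * \<mu> * W + \<mu>\<^sup>2 * (LINT z|lborel. \<phi> z)"
    using 1 2 int by (simp add: Q_def W_def correlation_translated)
  also have "\<dots> \<le> Q - 2 * \<mu> * W + \<mu>\<^sup>2 * V"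
    using mass by (simp add: mult_left_mono)
  also have "\<dots> = Q - W\<^sup>2 / V"
    using V by (simp add: \<mu>_def power2_eq_square field_simps)
  finally show ?thesis using V by (simp add: Q_def W_def field_simps)
qed

text \<open>Integrates the pointwise bound and exchanges the integrals; every translate of
  \<open>v\<close> has the same norm, which leaves one more factor at most \<open>V\<close> from the
  mass of \<phi>.\<close>

lemma
  shows correlation_sq_integrable: "integrable lborel (\<lambda>x. (correlation \<phi> v x)\<^sup>2)"
    and correlation_L2: "(LINT x|lborel. (correlation \<phi> v x)\<^sup>2) \<le> V\<^sup>2 * (LINT x|lborel. (v x)\<^sup>2)"
proof -
  have [measurable]: "correlation \<phi> v \<in> borel_measurable borel"
    using correlation_cont by (rule borel_measurable_continuous_onI)
  have "(\<integral>\<^sup>+x. ennreal ((correlation \<phi> v x)\<^sup>2) \<partial>lborel) \<le> (\<integral>\<^sup>+x. \<integral>\<^sup>+z. ennreal V * (ennreal (\<phi> z) * ennreal ((v (z + x))\<^sup>2)) \<partial>lborel \<partial>lborel)"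
  proof (rule nn_integral_mono)
    fix x
    have 2: "integrable lborel (\<lambda>z. \<phi> z * (v (z + x))\<^sup>2)"
    proof (rule Bochner_Integration.integrable_bound[OF integrable_lborel_translate[OF v_sq, of x]])
      show "AE z in lborel. norm (\<phi> z * (v (z + x))\<^sup>2) \<le> norm ((v (z + x))\<^sup>2)"
        using nonneg le_1 by (intro AE_I2) (simp add: abs_mult mult_left_le_one_le)
    qed measurable
    have "ennreal ((correlation \<phi> v x)\<^sup>2) \<le> ennreal (V * (LINT z|lborel. \<phi> z * (v (z + x))\<^sup>2))"
      by (intro ennreal_leI correlation_sq_le)
    also have "\<dots> = ennreal V * ennreal (LINT z|lborel. \<phi> z * (v (z + x))\<^sup>2)"
      using V by (simp add: ennreal_mult')
    also have "ennreal (LINT z|lborel. \<phi> z * (v (z + x))\<^sup>2) = (\<integral>\<^sup>+z. ennreal (\<phi> z * (v (z + x))\<^sup>2) \<partial>lborel)"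
      using 2 nonneg by (intro nn_integral_eq_integral[symmetric]) auto
    also have "ennreal V * \<dots> = (\<integral>\<^sup>+z. ennreal V * (ennreal (\<phi> z) * ennreal ((v (z + x))\<^sup>2)) \<partial>lborel)"
      using nonneg by (subst nn_integral_cmult[symmetric]) (auto simp: ennreal_mult')
    finally show "ennreal ((correlation \<phi> v x)\<^sup>2) \<le> (\<integral>\<^sup>+z. ennreal V * (ennreal (\<phi> z) * ennreal ((v (z + x))\<^sup>2)) \<partial>lborel)" .
  qed
  also have "\<dots> = (\<integral>\<^sup>+z. \<integral>\<^sup>+x. ennreal V * (ennreal (\<phi> z) * ennreal ((v (z + x))\<^sup>2)) \<partial>lborel \<partial>lborel)"
    by (rule lborel_pair.Fubini') simp
  also have "\<dots> = (\<integral>\<^sup>+z. ennreal V * ennreal (\<phi> z) * ennreal (LINT x|lborel. (v x)\<^sup>2) \<partial>lborel)"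
  proof (rule nn_integral_cong)
    fix z
    have "(\<integral>\<^sup>+x. ennreal ((v (z + x))\<^sup>2) \<partial>lborel) = ennreal (LINT x|lborel. (v x)\<^sup>2)"
      using nn_integral_lborel_translate[of "\<lambda>x. ennreal ((v x)\<^sup>2)" z] nn_integral_eq_integral[OF v_sq] by (simp add: add.commute)
    then show "(\<integral>\<^sup>+x. ennreal V * (ennreal (\<phi> z) * ennreal ((v (z + x))\<^sup>2)) \<partial>lborel) = ennreal V * ennreal (\<phi> z) * ennreal (LINT x|lborel. (v x)\<^sup>2)"
      by (simp add: nn_integral_cmult mult.assoc)
  qed
  also have "\<dots> = ennreal V * (\<integral>\<^sup>+z. ennreal (\<phi> z) \<partial>lborel) * ennreal (LINT x|lborel. (v x)\<^sup>2)"
    by (simp add: nn_integral_multc nn_integral_cmult)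
  also have "(\<integral>\<^sup>+z. ennreal (\<phi> z) \<partial>lborel) = ennreal (LINT x|lborel. \<phi> x)"
    using int nonneg by (intro nn_integral_eq_integral) auto
  also have "ennreal V * ennreal (LINT x|lborel. \<phi> x) * ennreal (LINT x|lborel. (v x)\<^sup>2)
      \<le> ennreal V * ennreal V * ennreal (LINT x|lborel. (v x)\<^sup>2)"
    using mass by (intro mult_right_mono mult_left_mono ennreal_leI) auto
  also have "\<dots> = ennreal (V\<^sup>2 * (LINT x|lborel. (v x)\<^sup>2))"
    using V by (simp add: ennreal_mult'[symmetric] power2_eq_square)
  finally have le: "(\<integral>\<^sup>+x. ennreal ((correlation \<phi> v x)\<^sup>2) \<partial>lborel) \<le> ennreal (V\<^sup>2 * (LINT x|lborel. (v x)\<^sup>2))" .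
  show i: "integrable lborel (\<lambda>x. (correlation \<phi> v x)\<^sup>2)"
    by (rule integrableI_nonneg) (use le in \<open>auto simp: less_top[symmetric] top_unique\<close>)
  have "0 \<le> (LINT x|lborel. (v x)\<^sup>2)" by (intro Bochner_Integration.integral_nonneg) auto
  then show "(LINT x|lborel. (correlation \<phi> v x)\<^sup>2) \<le> V\<^sup>2 * (LINT x|lborel. (v x)\<^sup>2)"
    using le nn_integral_eq_integral[OF i] by (simp add: ennreal_le_iff)
qed

text \<open>The derivative falls on the kernel, so \<open>v\<close> needs no regularity. The
  difference quotients of \<phi> are dominated by a Lipschitz constant on a ball slightly larger
  than the support.\<close>

lemma correlation_deriv:
  "((\<lambda>s. correlation \<phi> v (x + s *\<^sub>R axis i 1)) has_real_derivative
     - (LINT y|lborel. partial_deriv i \<phi> (y - x) * v y)) (at 0)"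
proof -
  let ?e = "axis i 1 :: real ^ 'n"
  obtain K where K: "compact K" "\<And>x. x \<notin> K \<Longrightarrow> partial_deriv i \<phi> x = 0"
    using test_function_support[OF test] by blast
  have "bounded (partial_deriv i \<phi> ` K)"
    using K by (intro compact_imp_bounded compact_continuous_image continuous_on_subset[OF partial_deriv_cont[OF test]]) auto
  then obtain L0 where L0: "\<And>x. x \<in> K \<Longrightarrow> \<bar>partial_deriv i \<phi> x\<bar> \<le> L0" by (auto simp: bounded_iff)
  define L where "L = max L0 0"
  have L: "\<bar>partial_deriv i \<phi> x\<bar> \<le> L" for x
    using L0[of x] K(2)[of x] by (cases "x \<in> K") (auto simp: L_def)
  have lineD: "((\<lambda>s. \<phi> (z + s *\<^sub>R ?e)) has_real_derivative partial_deriv i \<phi> (z + r *\<^sub>R ?e)) (at r)" for z r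
  proof -
    have "((\<lambda>s. \<phi> (z + (s + r) *\<^sub>R ?e)) has_real_derivative partial_deriv i \<phi> (z + r *\<^sub>R ?e)) (at 0)"
      using test_function_deriv[OF test, of "z + r *\<^sub>R ?e" i] by (simp add: algebra_simps)
    then show ?thesis using DERIV_shift[of "\<lambda>s. \<phi> (z + s *\<^sub>R ?e)" _ 0 r] by simp
  qed
  have lip: "\<bar>\<phi> (z + s *\<^sub>R ?e) - \<phi> z\<bar> \<le> L * \<bar>s\<bar>" for z s
    using field_differentiable_bound[of UNIV "\<lambda>s. \<phi> (z + s *\<^sub>R ?e)" "\<lambda>s. partial_deriv i \<phi> (z + s *\<^sub>R ?e)" L s 0] lineD L by simp
  have [measurable]: "partial_deriv i \<phi> \<in> borel_measurable borel"
    using partial_deriv_cont[OF test] by (rule borel_measurable_continuous_onI)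
  show ?thesis
    unfolding has_field_derivative_iff tendsto_at_iff_sequentially
  proof (intro allI impI)
    fix X :: "nat \<Rightarrow> real"
    assume X0: "\<forall>k. X k \<in> UNIV - {0}" and X: "X \<longlonglongrightarrow> 0"
    \<comment> \<open>Shifts of length below one keep the difference quotients supported in the ball
      of radius R + 1, which fixes one dominating function.\<close>
    have "\<forall>\<^sub>F k in sequentially. \<bar>X k\<bar> < 1" using X by (auto simp: tendsto_iff dist_real_def)
    then obtain N where N: "\<And>k. N \<le> k \<Longrightarrow> \<bar>X k\<bar> < 1" by (auto simp: eventually_sequentially)
    define q where "q k y = (\<phi> (y - x - X (k + N) *\<^sub>R ?e) - \<phi> (y - x)) / X (k + N) * v y" for k y
    have "(\<lambda>k. LINT y|lborel. q k y) \<longlonglongrightarrow> (LINT y|lborel. - partial_deriv i \<phi> (y - x) * v y)"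
    proof (rule integral_dominated_convergence)
      show "integrable lborel (\<lambda>y. L * (indicator (cball x (R + 1)) y * \<bar>v y\<bar>))"
        by (intro integrable_mult_right square_integrable_local[OF v_meas v_sq])
      show "AE y in lborel. (\<lambda>k. q k y) \<longlonglongrightarrow> - partial_deriv i \<phi> (y - x) * v y"
      proof (rule AE_I2)
        fix y
        have "((\<lambda>s. (\<phi> (y - x + s *\<^sub>R ?e) - \<phi> (y - x)) / s) \<longlongrightarrow> partial_deriv i \<phi> (y - x)) (at 0)"
          using test_function_deriv[OF test, of "y - x" i] by (simp add: has_field_derivative_iff)
        moreover have "filterlim (\<lambda>k. - X (k + N)) (at 0) sequentially"
          using tendsto_minus[OF LIMSEQ_ignore_initial_segment[OF X, of N]] X0 by (auto simp: filterlim_at)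
        ultimately have "(\<lambda>k. (\<phi> (y - x + (- X (k + N)) *\<^sub>R ?e) - \<phi> (y - x)) / (- X (k + N))) \<longlonglongrightarrow> partial_deriv i \<phi> (y - x)"
          by (rule filterlim_compose)
        from tendsto_mult[OF tendsto_minus[OF this] tendsto_const[of "v y"]]
        show "(\<lambda>k. q k y) \<longlonglongrightarrow> - partial_deriv i \<phi> (y - x) * v y"
          by (simp add: q_def[abs_def])
      qed
      show "AE y in lborel. norm (q k y) \<le> L * (indicator (cball x (R + 1)) y * \<bar>v y\<bar>)" for k
      proof (rule AE_I2)
        fix y
        have Xk: "\<bar>X (k + N)\<bar> < 1" "X (k + N) \<noteq> 0" using N X0 by auto
        have "\<bar>(\<phi> (y - x - X (k + N) *\<^sub>R ?e) - \<phi> (y - x)) / X (k + N)\<bar> \<le> L * indicator (cball x (R + 1)) y"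
        proof (cases "y \<in> cball x (R + 1)")
          case True
          have "\<bar>\<phi> (y - x - X (k + N) *\<^sub>R ?e) - \<phi> (y - x)\<bar> \<le> L * \<bar>X (k + N)\<bar>"
            using lip[of "y - x" "- X (k + N)"] by simp
          then show ?thesis using True Xk by (simp add: divide_le_eq)
        next
          case False
          then have far: "R + 1 < norm (y - x)" by (simp add: dist_norm norm_minus_commute)
          have "norm (X (k + N) *\<^sub>R ?e) < 1" using Xk by (simp add: norm_axis_1)
          then have "R < norm (y - x - X (k + N) *\<^sub>R ?e)"
            using far norm_triangle_ineq2[of "y - x" "X (k + N) *\<^sub>R ?e"] by linarith
          then show ?thesis using far support[of "y - x"] support[of "y - x - X (k + N) *\<^sub>R ?e"] False by simp
        qed
        then have "\<bar>(\<phi> (y - x - X (k + N) *\<^sub>R ?e) - \<phi> (y - x)) / X (k + N)\<bar> * \<bar>v y\<bar> \<le> (L * indicator (cball x (R + 1)) y) * \<bar>v y\<bar>"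
          by (rule mult_right_mono) simp
        then show "norm (q k y) \<le> L * (indicator (cball x (R + 1)) y * \<bar>v y\<bar>)"
          by (simp add: q_def abs_mult mult.assoc)
      qed
    qed (auto simp: q_def[abs_def])
    moreover have "(LINT y|lborel. q k y) = (correlation \<phi> v (x + X (k + N) *\<^sub>R ?e) - correlation \<phi> v x) / X (k + N)" for k
    proof -
      have "q k y = (\<phi> (y - (x + X (k + N) *\<^sub>R ?e)) * v y - \<phi> (y - x) * v y) / X (k + N)" for y
        by (simp add: q_def algebra_simps diff_divide_distrib)
      then show ?thesis
        using correlation_integrable by (simp add: correlation_def)
    qed
    ultimately have "(\<lambda>k. (correlation \<phi> v (x + X (k + N) *\<^sub>R ?e) - correlation \<phi> v x) / X (k + N)) \<longlonglongrightarrow> - (LINT y|lborel. partial_deriv i \<phi> (y - x) * v y)"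
      by simp
    then have "(\<lambda>k. (correlation \<phi> v (x + X k *\<^sub>R ?e) - correlation \<phi> v x) / X k) \<longlonglongrightarrow> - (LINT y|lborel. partial_deriv i \<phi> (y - x) * v y)"
      by (rule LIMSEQ_offset)
    then show "((\<lambda>s. (correlation \<phi> v (x + s *\<^sub>R ?e) - correlation \<phi> v (x + 0 *\<^sub>R ?e)) / (s - 0)) \<circ> X)
        \<longlonglongrightarrow> - (LINT y|lborel. partial_deriv i \<phi> (y - x) * v y)"
      by (simp add: o_def)
  qed
qed

end

end

text \<open>
  Weak partial derivatives tested against box bumps only: the mollifiers used here are
  themselves box bumps, so nothing more is needed.
\<close>

definition bump_weak :: "(real ^ 'n::finite \<Rightarrow> real) \<Rightarrow> ('n \<Rightarrow> real ^ 'n \<Rightarrow> real) \<Rightarrow> bool" where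
  "bump_weak v g \<longleftrightarrow> v \<in> borel_measurable borel \<and> integrable lborel (\<lambda>x. (v x)\<^sup>2) \<and>
    (\<forall>i. g i \<in> borel_measurable borel \<and> integrable lborel (\<lambda>x. (g i x)\<^sup>2)) \<and>
    (\<forall>i a b m. 0 < m \<longrightarrow> (LINT x|lborel. partial_deriv i (box_bump a b m) x * v x) = - (LINT x|lborel. box_bump a b m x * g i x))"

section \<open>Mollification by box bumps and its limits\<close>

lemma box_bump_kernel:
  assumes "0 < h" "0 < m"
  obtains R where "kernel (box_bump 0 (h *\<^sub>R One) m :: real ^ 'n::finite \<Rightarrow> real) R (h ^ CARD('n))"
proof -
  let ?\<phi> = "box_bump 0 (h *\<^sub>R One) m :: real ^ 'n \<Rightarrow> real"
  obtain R where R: "box 0 (h *\<^sub>R One :: real ^ 'n) \<subseteq> cball 0 R"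
    using bounded_subset_ballD[OF bounded_box] ball_subset_cball by blast
  have cont: "continuous_on UNIV ?\<phi>" by (rule box_bump_cont[OF assms(2)])
  have le: "?\<phi> x \<le> indicator (box 0 (h *\<^sub>R One)) x" for x
    using box_bump_bounds[of 0 "h *\<^sub>R One" m x] box_bump_outside[OF assms(2), of x 0 "h *\<^sub>R One"] by (auto simp: indicator_def)
  have vol: "emeasure lborel (box 0 (h *\<^sub>R One :: real ^ 'n)) = ennreal (h ^ CARD('n))"
    using assms by (subst emeasure_lborel_box) (auto simp: inner_sum_left_Basis)
  have ind: "integrable lborel (indicator (box 0 (h *\<^sub>R One :: real ^ 'n)) :: real ^ 'n \<Rightarrow> real)"
    by (intro integrable_real_indicator) (auto simp: vol)
  have int: "integrable lborel ?\<phi>"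
  proof (rule Bochner_Integration.integrable_bound[OF ind])
    show "AE x in lborel. norm (?\<phi> x) \<le> norm (indicator (box 0 (h *\<^sub>R One)) x :: real)"
      by (intro AE_I2) (simp add: le box_bump_bounds)
  qed (use cont in \<open>auto intro: borel_measurable_continuous_onI\<close>)
  have "(LINT x|lborel. ?\<phi> x) \<le> (LINT x|lborel. indicator (box 0 (h *\<^sub>R One :: real ^ 'n)) x)"
    by (rule integral_mono[OF int ind le])
  also have "\<dots> = h ^ CARD('n)" using vol assms by (simp add: measure_def)
  finally have mass: "(LINT x|lborel. ?\<phi> x) \<le> h ^ CARD('n)" .
  have supp: "?\<phi> x = 0" if "x \<notin> cball 0 R" for x
    using that R by (intro box_bump_outside[OF assms(2)]) auto
  have "kernel ?\<phi> R (h ^ CARD('n))"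
    by unfold_locales
      (use assms int mass supp in \<open>auto intro: box_bump_bounds test_function_box_bump\<close>)
  then show ?thesis by (rule that)
qed

lemma partial_deriv_shift:
  assumes "test_function \<phi>" "test_function (\<lambda>y. \<phi> (y - x))"
  shows "partial_deriv i (\<lambda>y. \<phi> (y - x)) y = partial_deriv i \<phi> (y - x)"
proof -
  have "((\<lambda>s. \<phi> (y + s *\<^sub>R axis i 1 - x)) has_real_derivative partial_deriv i \<phi> (y - x)) (at 0)"
    using test_function_deriv[OF assms(1), of "y - x" i] by (simp add: algebra_simps)
  then show ?thesis using test_function_deriv[OF assms(2), of y i] by (metis DERIV_unique)
qed

text \<open>The derivative of the mollification is the mollification of the weak derivative: testing
  with the bump translated by \<open>x\<close> moves the derivative from the kernel to
  \<open>v\<close>, and the sign cancels the one in \<open>correlation_deriv\<close>.\<close>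

lemma correlation_line_C1:
  fixes v :: "real ^ 'n::finite \<Rightarrow> real"
  assumes v: "bump_weak v g" and h: "0 < h" and m: "0 < m"
  shows "line_C1 (correlation (box_bump 0 (h *\<^sub>R One) m) v) (\<lambda>i. correlation (box_bump 0 (h *\<^sub>R One) m) (g i))"
proof -
  let ?\<phi> = "box_bump 0 (h *\<^sub>R One) m :: real ^ 'n \<Rightarrow> real"
  obtain R where "kernel ?\<phi> R (h ^ CARD('n))" by (rule box_bump_kernel[OF h m])
  then interpret kernel ?\<phi> R "h ^ CARD('n)" .
  have meas: "v \<in> borel_measurable borel" "integrable lborel (\<lambda>x. (v x)\<^sup>2)"
    "g i \<in> borel_measurable borel" "integrable lborel (\<lambda>x. (g i x)\<^sup>2)" for i
    using v by (auto simp: bump_weak_def)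
  have "correlation ?\<phi> (g i) x = - (LINT y|lborel. partial_deriv i ?\<phi> (y - x) * v y)" for i x
  proof -
    have shift: "box_bump (0 + x) (h *\<^sub>R One + x) m = (\<lambda>y. ?\<phi> (y - x))"
      by (rule ext) (rule box_bump_shift)
    have pd: "partial_deriv i (box_bump (0 + x) (h *\<^sub>R One + x) m) y = partial_deriv i ?\<phi> (y - x)" for y
      using partial_deriv_shift[OF test, of x i y] test_function_box_bump[OF m, of "0 + x" "h *\<^sub>R One + x"] by (simp only: shift)
    have "(LINT y|lborel. partial_deriv i (box_bump (0 + x) (h *\<^sub>R One + x) m) y * v y)
        = - (LINT y|lborel. box_bump (0 + x) (h *\<^sub>R One + x) m y * g i y)"
      using v m unfolding bump_weak_def by blast
    then show ?thesis unfolding pd unfolding shift correlation_def by simp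
  qed
  then show ?thesis
    using correlation_cont[OF meas(1,2)] correlation_cont[OF meas(3,4)] correlation_deriv[OF meas(1,2)]
    by (simp add: line_C1_def)
qed

text \<open>The mollifier is removed in two stages. Here the side \<open>h\<close> of the cube is
  fixed and the bump steepens to its indicator, which turns the mollification into a plain integral
  over the cube.\<close>

lemma correlation_bump_tendsto:
  fixes v :: "real ^ 'n::finite \<Rightarrow> real"
  assumes v: "v \<in> borel_measurable borel" "integrable lborel (\<lambda>x. (v x)\<^sup>2)" and h: "0 < h"
  shows "(\<lambda>k. correlation (box_bump 0 (h *\<^sub>R One) (real (Suc k))) v x) \<longlonglongrightarrow> integral (cbox x (x + h *\<^sub>R One)) v"
proof -
  note [measurable] = v(1)
  obtain R where R: "box x (x + h *\<^sub>R One :: real ^ 'n) \<subseteq> cball x R"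
    using bounded_subset_ballD[OF bounded_box] ball_subset_cball by blast
  have mem: "y - x \<in> box 0 (h *\<^sub>R One) \<longleftrightarrow> y \<in> box x (x + h *\<^sub>R One)" for y
    by (simp add: mem_box_cart algebra_simps)
  have le: "\<bar>indicator (box 0 (h *\<^sub>R One)) (y - x) * v y\<bar> \<le> indicator (cball x R) y * \<bar>v y\<bar>" for y
    using R mem[of y] by (auto simp: indicator_def)
  have "(\<lambda>k. correlation (box_bump 0 (h *\<^sub>R One) (real (Suc k))) v x) \<longlonglongrightarrow> (LINT y|lborel. indicator (box 0 (h *\<^sub>R One)) (y - x) * v y)"
    unfolding correlation_def
  proof (rule integral_dominated_convergence)
    show "integrable lborel (\<lambda>y. indicator (cball x R) y * \<bar>v y\<bar>)" by (rule square_integrable_local[OF v])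
    show "AE y in lborel. (\<lambda>k. box_bump 0 (h *\<^sub>R One) (real (Suc k)) (y - x) * v y) \<longlonglongrightarrow> indicator (box 0 (h *\<^sub>R One)) (y - x) * v y"
      by (intro AE_I2 tendsto_intros box_bump_tendsto)
    show "AE y in lborel. norm (box_bump 0 (h *\<^sub>R One) (real (Suc k)) (y - x) * v y) \<le> indicator (cball x R) y * \<bar>v y\<bar>" for k
    proof (rule AE_I2)
      fix y
      have "\<bar>box_bump 0 (h *\<^sub>R One) (real (Suc k)) (y - x)\<bar> \<le> (indicator (box 0 (h *\<^sub>R One)) (y - x) :: real)"
        using box_bump_bounds[of 0 "h *\<^sub>R One" "real (Suc k)" "y - x"] box_bump_outside[of "real (Suc k)" "y - x" 0 "h *\<^sub>R One"]
        by (auto simp: indicator_def simp del: of_nat_Suc)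
      then have "\<bar>box_bump 0 (h *\<^sub>R One) (real (Suc k)) (y - x)\<bar> * \<bar>v y\<bar> \<le> indicator (box 0 (h *\<^sub>R One)) (y - x) * \<bar>v y\<bar>"
        by (rule mult_right_mono) simp
      then show "norm (box_bump 0 (h *\<^sub>R One) (real (Suc k)) (y - x) * v y) \<le> indicator (cball x R) y * \<bar>v y\<bar>"
        using le[of y] by (simp add: abs_mult)
    qed
    show "(\<lambda>y. box_bump 0 (h *\<^sub>R One) (real (Suc k)) (y - x) * v y) \<in> borel_measurable lborel" for k
    proof -
      have [measurable]: "box_bump 0 (h *\<^sub>R One) (real (Suc k)) \<in> borel_measurable (borel :: (real ^ 'n) measure)"
        by (intro borel_measurable_continuous_onI box_bump_cont) simp
      show ?thesis by measurable
    qed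
    show "(\<lambda>y. indicator (box 0 (h *\<^sub>R One)) (y - x) * v y) \<in> borel_measurable lborel" by measurable
  qed
  also have "(LINT y|lborel. indicator (box 0 (h *\<^sub>R One)) (y - x) * v y) = (LINT y : box x (x + h *\<^sub>R One)|lborel. v y)"
    unfolding set_lebesgue_integral_def by (intro Bochner_Integration.integral_cong refl) (auto simp: indicator_def mem)
  also have "\<dots> = integral (box x (x + h *\<^sub>R One)) v"
  proof (rule set_borel_integral_eq_integral)
    show "set_integrable lborel (box x (x + h *\<^sub>R One)) v"
      unfolding set_integrable_def
    proof (rule Bochner_Integration.integrable_bound[OF square_integrable_local[OF v, of x R]])
      show "AE y in lborel. norm (indicator (box x (x + h *\<^sub>R One)) y *\<^sub>R v y) \<le> norm (indicator (cball x R) y * \<bar>v y\<bar>)"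
        using R by (intro AE_I2) (auto simp: indicator_def)
    qed measurable
  qed
  finally show ?thesis by (simp add: integral_open_interval)
qed

text \<open>The second stage: the cubes shrink, and their averages converge almost everywhere by
  Lebesgue differentiation.\<close>

lemma averages_tendsto:
  fixes v :: "real ^ 'n::finite \<Rightarrow> real"
  assumes v: "v \<in> borel_measurable borel" "integrable lborel (\<lambda>x. (v x)\<^sup>2)"
  shows "AE x in lborel. (\<lambda>j. 1 / (1 / real (Suc j)) ^ CARD('n) * integral (cbox x (x + (1 / real (Suc j)) *\<^sub>R One)) v) \<longlonglongrightarrow> v x"
proof -
  have "v integrable_on cbox a b" for a b
  proof -
    obtain R where R: "cbox a b \<subseteq> cball 0 R"
      using bounded_subset_ballD[OF bounded_cbox, of a b 0] ball_subset_cball by blast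
    have "set_integrable lborel (cbox a b) v"
      unfolding set_integrable_def
    proof (rule Bochner_Integration.integrable_bound[OF square_integrable_local[OF v, of 0 R]])
      show "AE y in lborel. norm (indicator (cbox a b) y *\<^sub>R v y) \<le> norm (indicator (cball 0 R) y * \<bar>v y\<bar>)"
        using R by (intro AE_I2) (auto simp: indicator_def)
    qed (use v in measurable)
    then show ?thesis by (rule set_borel_integral_eq_integral)
  qed
  then obtain N where N: "negligible N" "\<And>x \<epsilon>. \<lbrakk>x \<notin> N; 0 < \<epsilon>\<rbrakk> \<Longrightarrow>
      \<exists>d>0. \<forall>h. 0 < h \<and> h < d \<longrightarrow> norm (integral (cbox x (x + h *\<^sub>R One)) v /\<^sub>R h ^ DIM(real ^ 'n) - v x) < \<epsilon>"
    using integrable_ccontinuous_explicit[of v] by metis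
  have "(\<lambda>j. 1 / (1 / real (Suc j)) ^ CARD('n) * integral (cbox x (x + (1 / real (Suc j)) *\<^sub>R One)) v) \<longlonglongrightarrow> v x" if xN: "x \<notin> N" for x
    unfolding tendsto_iff
  proof (intro allI impI)
    fix \<epsilon> :: real assume "0 < \<epsilon>"
    then obtain d where d: "0 < d" "\<And>h. 0 < h \<and> h < d \<Longrightarrow> norm (integral (cbox x (x + h *\<^sub>R One)) v /\<^sub>R h ^ DIM(real ^ 'n) - v x) < \<epsilon>"
      using N(2)[OF xN] by blast
    have "(\<lambda>j. 1 / real (Suc j)) \<longlonglongrightarrow> 0"
      using LIMSEQ_inverse_real_of_nat by (simp add: inverse_eq_divide del: of_nat_Suc)
    then have "\<forall>\<^sub>F j in sequentially. 1 / real (Suc j) < d" using d(1) by (rule order_tendstoD)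
    then show "\<forall>\<^sub>F j in sequentially. dist (1 / (1 / real (Suc j)) ^ CARD('n) * integral (cbox x (x + (1 / real (Suc j)) *\<^sub>R One)) v) (v x) < \<epsilon>"
    proof eventually_elim
      case (elim j)
      then show ?case using d(2)[of "1 / real (Suc j)"] by (simp add: dist_real_def inverse_eq_divide del: of_nat_Suc)
    qed
  qed
  moreover have "AE x in lborel. x \<notin> N"
    using N(1) AE_not_in[of N lebesgue] by (simp add: negligible_iff_null_sets AE_completion_iff)
  ultimately show ?thesis by (auto elim!: eventually_mono)
qed


text \<open>Divided by the volume of the cube, the mollification contracts the L^2 norm, since the
  bump has mass at most that volume. The gradient side is therefore bounded by the final constant at
  every stage, and two applications of Fatou remove the mollifier.\<close>

lemma bump_weak_sobolev:
  fixes v w :: "real ^ 'n::finite \<Rightarrow> real"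
  assumes dim: "3 \<le> CARD('n)" and v: "bump_weak v g" and w: "bump_weak w k"
  shows "(\<integral>\<^sup>+x. ennreal (((v x)\<^sup>2 + (w x)\<^sup>2) powr (two_upper CARD('n) / 2)) \<partial>lborel)
    \<le> ennreal (((\<Sum>i\<in>UNIV. (LINT x|lborel. (g i x)\<^sup>2) + (LINT x|lborel. (k i x)\<^sup>2)) / sobolev_const CARD('n)) powr (two_upper CARD('n) / 2))"
    (is "_ \<le> ennreal ((?A / ?S) powr (?p / 2))")
proof -
  have p: "2 < ?p" using two_upper_gt[OF dim] .
  have S: "0 < ?S" using sobolev_const_pos[OF dim] .
  have vm: "v \<in> borel_measurable borel" "integrable lborel (\<lambda>x. (v x)\<^sup>2)"
    "g i \<in> borel_measurable borel" "integrable lborel (\<lambda>x. (g i x)\<^sup>2)" for i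
    using v by (auto simp: bump_weak_def)
  have wm: "w \<in> borel_measurable borel" "integrable lborel (\<lambda>x. (w x)\<^sup>2)"
    "k i \<in> borel_measurable borel" "integrable lborel (\<lambda>x. (k i x)\<^sup>2)" for i
    using w by (auto simp: bump_weak_def)
  define avg where "avg h f x = 1 / h ^ CARD('n) * integral (cbox x (x + h *\<^sub>R One)) f" for h and f :: "real ^ 'n \<Rightarrow> real" and x
  define mol where "mol h m f x = 1 / h ^ CARD('n) * correlation (box_bump 0 (h *\<^sub>R One) m) f x" for h m and f :: "real ^ 'n \<Rightarrow> real" and x
  have mol_le: "(\<integral>\<^sup>+x. ennreal (((mol h m v x)\<^sup>2 + (mol h m w x)\<^sup>2) powr (?p / 2)) \<partial>lborel) \<le> ennreal ((?A / ?S) powr (?p / 2))"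
    and mol_C1: "line_C1 (mol h m v) (\<lambda>i. mol h m (g i))" "line_C1 (mol h m w) (\<lambda>i. mol h m (k i))"
    if h: "0 < h" and m: "0 < m" for h m
  proof -
    obtain R where "kernel (box_bump 0 (h *\<^sub>R One) m :: real ^ 'n \<Rightarrow> real) R (h ^ CARD('n))"
      by (rule box_bump_kernel[OF h m])
    then interpret kernel "box_bump 0 (h *\<^sub>R One) m :: real ^ 'n \<Rightarrow> real" R "h ^ CARD('n)" .
    have V: "0 < h ^ CARD('n)" using h by simp
    show C1: "line_C1 (mol h m v) (\<lambda>i. mol h m (g i))" "line_C1 (mol h m w) (\<lambda>i. mol h m (k i))"
      unfolding mol_def[abs_def] by (rule line_C1_cmult[OF correlation_line_C1[OF v h m]], rule line_C1_cmult[OF correlation_line_C1[OF w h m]])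
    have sqi: "integrable lborel (\<lambda>x. (mol h m f x)\<^sup>2)"
      and sql: "(LINT x|lborel. (mol h m f x)\<^sup>2) \<le> (LINT x|lborel. (f x)\<^sup>2)"
      if f: "f \<in> borel_measurable borel" "integrable lborel (\<lambda>x. (f x)\<^sup>2)" for f
    proof -
      have eq: "(mol h m f x)\<^sup>2 = (1 / h ^ CARD('n))\<^sup>2 * (correlation (box_bump 0 (h *\<^sub>R One) m) f x)\<^sup>2" for x
        unfolding mol_def by (rule power_mult_distrib)
      show "integrable lborel (\<lambda>x. (mol h m f x)\<^sup>2)"
        unfolding eq by (intro integrable_mult_right correlation_sq_integrable[OF f])
      have "(LINT x|lborel. (mol h m f x)\<^sup>2) = (1 / h ^ CARD('n))\<^sup>2 * (LINT x|lborel. (correlation (box_bump 0 (h *\<^sub>R One) m) f x)\<^sup>2)"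
        unfolding eq by (rule integral_mult_right_zero)
      also have "\<dots> \<le> (1 / h ^ CARD('n))\<^sup>2 * ((h ^ CARD('n))\<^sup>2 * (LINT x|lborel. (f x)\<^sup>2))"
        by (intro mult_left_mono correlation_L2[OF f]) simp
      also have "\<dots> = (LINT x|lborel. (f x)\<^sup>2)"
      proof -
        have "(1 / r)\<^sup>2 * (r\<^sup>2 * t) = t" if "0 < r" for r t :: real using that by (simp add: power_divide)
        then show ?thesis using V by blast
      qed
      finally show "(LINT x|lborel. (mol h m f x)\<^sup>2) \<le> (LINT x|lborel. (f x)\<^sup>2)" .
    qed
    define B where "B = max (1 / h ^ CARD('n) * (h ^ CARD('n) + (LINT y|lborel. (v y)\<^sup>2))) (1 / h ^ CARD('n) * (h ^ CARD('n) + (LINT y|lborel. (w y)\<^sup>2)))"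
    have bnd: "\<bar>mol h m f x\<bar> \<le> 1 / h ^ CARD('n) * (h ^ CARD('n) + (LINT y|lborel. (f y)\<^sup>2))"
      if f: "f \<in> borel_measurable borel" "integrable lborel (\<lambda>x. (f x)\<^sup>2)" for f x
      unfolding mol_def abs_mult using V by (intro mult_mono correlation_bounded[OF f]) auto
    interpret C1_pair "mol h m v" "mol h m w" "\<lambda>i. mol h m (g i)" "\<lambda>i. mol h m (k i)" B "real CARD('n)"
    proof
      show "\<bar>mol h m v x\<bar> \<le> B" "\<bar>mol h m w x\<bar> \<le> B" for x
        using bnd[OF vm(1,2), of x] bnd[OF wm(1,2), of x] by (auto simp: B_def)
    qed (use dim C1 sqi vm wm in auto)
    have "(\<integral>\<^sup>+x. ennreal (((mol h m v x)\<^sup>2 + (mol h m w x)\<^sup>2) powr (?p / 2)) \<partial>lborel)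
      \<le> ennreal (((LINT x|lborel. (\<Sum>i\<in>UNIV. (mol h m (g i) x)\<^sup>2 + (mol h m (k i) x)\<^sup>2)) / ?S) powr (?p / 2))"
      by (rule sobolev_pair)
    also have "\<dots> \<le> ennreal ((?A / ?S) powr (?p / 2))"
    proof (intro ennreal_leI powr_mono2 divide_right_mono)
      have "(LINT x|lborel. (\<Sum>i\<in>UNIV. (mol h m (g i) x)\<^sup>2 + (mol h m (k i) x)\<^sup>2))
        = (\<Sum>i\<in>UNIV. (LINT x|lborel. (mol h m (g i) x)\<^sup>2) + (LINT x|lborel. (mol h m (k i) x)\<^sup>2))"
        using sqi vm wm by simp
      also have "\<dots> \<le> ?A" using sql vm wm by (intro sum_mono add_mono) auto
      finally show "(LINT x|lborel. (\<Sum>i\<in>UNIV. (mol h m (g i) x)\<^sup>2 + (mol h m (k i) x)\<^sup>2)) \<le> ?A" .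
      show "0 \<le> (LINT x|lborel. (\<Sum>i\<in>UNIV. (mol h m (g i) x)\<^sup>2 + (mol h m (k i) x)\<^sup>2)) / ?S"
        using S by (intro divide_nonneg_pos Bochner_Integration.integral_nonneg sum_nonneg) auto
    qed (use p S in auto)
    finally show "(\<integral>\<^sup>+x. ennreal (((mol h m v x)\<^sup>2 + (mol h m w x)\<^sup>2) powr (?p / 2)) \<partial>lborel) \<le> ennreal ((?A / ?S) powr (?p / 2))" .
  qed
  have mol_lim: "(\<lambda>m. mol h (real (Suc m)) f x) \<longlonglongrightarrow> avg h f x"
    if "f \<in> borel_measurable borel" "integrable lborel (\<lambda>x. (f x)\<^sup>2)" "0 < h" for f h x
    unfolding mol_def avg_def by (intro tendsto_mult tendsto_const correlation_bump_tendsto that)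
  have avg_meas: "avg h f \<in> borel_measurable borel"
    if "\<And>m. mol h (real (Suc m)) f \<in> borel_measurable borel" "f \<in> borel_measurable borel" "integrable lborel (\<lambda>x. (f x)\<^sup>2)" "0 < h" for f h
    using mol_lim[OF that(2,3,4)] that(1) by (rule borel_measurable_LIMSEQ_real)
  have mol_meas: "mol h (real (Suc m)) v \<in> borel_measurable borel" "mol h (real (Suc m)) w \<in> borel_measurable borel" if "0 < h" for h m
    using line_C1_measurable(1)[OF mol_C1(1)[OF that]] line_C1_measurable(1)[OF mol_C1(2)[OF that]] by auto
  have avg_le: "(\<integral>\<^sup>+x. ennreal (((avg h v x)\<^sup>2 + (avg h w x)\<^sup>2) powr (?p / 2)) \<partial>lborel) \<le> ennreal ((?A / ?S) powr (?p / 2))"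
    if h: "0 < h" for h
  proof (rule nn_integral_limit_le[OF _ _ _ _ tendsto_const])
    show "(\<integral>\<^sup>+x. ennreal (((mol h (real (Suc m)) v x)\<^sup>2 + (mol h (real (Suc m)) w x)\<^sup>2) powr (?p / 2)) \<partial>lborel) \<le> ennreal ((?A / ?S) powr (?p / 2))" for m
      by (rule mol_le[OF h]) simp
    show "AE x in lborel. (\<lambda>m. ennreal (((mol h (real (Suc m)) v x)\<^sup>2 + (mol h (real (Suc m)) w x)\<^sup>2) powr (?p / 2)))
      \<longlonglongrightarrow> ennreal (((avg h v x)\<^sup>2 + (avg h w x)\<^sup>2) powr (?p / 2))"
      using p by (intro AE_I2 tendsto_ennrealI tendsto_powr'[OF tendsto_add[OF tendsto_power[OF mol_lim] tendsto_power[OF mol_lim]] tendsto_const] vm wm h) simp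
    note [measurable] = mol_meas[OF h] avg_meas[OF mol_meas(1)[OF h] vm(1,2) h] avg_meas[OF mol_meas(2)[OF h] wm(1,2) h]
    show "(\<lambda>x. ennreal (((mol h (real (Suc m)) v x)\<^sup>2 + (mol h (real (Suc m)) w x)\<^sup>2) powr (?p / 2))) \<in> borel_measurable lborel" for m
      by measurable
    show "(\<lambda>x. ennreal (((avg h v x)\<^sup>2 + (avg h w x)\<^sup>2) powr (?p / 2))) \<in> borel_measurable lborel"
      by measurable
  qed
  show ?thesis
  proof (rule nn_integral_limit_le[OF _ _ _ _ tendsto_const])
    show "(\<integral>\<^sup>+x. ennreal (((avg (1 / real (Suc j)) v x)\<^sup>2 + (avg (1 / real (Suc j)) w x)\<^sup>2) powr (?p / 2)) \<partial>lborel) \<le> ennreal ((?A / ?S) powr (?p / 2))" for j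
      by (rule avg_le) simp
    show "AE x in lborel. (\<lambda>j. ennreal (((avg (1 / real (Suc j)) v x)\<^sup>2 + (avg (1 / real (Suc j)) w x)\<^sup>2) powr (?p / 2)))
      \<longlonglongrightarrow> ennreal (((v x)\<^sup>2 + (w x)\<^sup>2) powr (?p / 2))"
      using averages_tendsto[OF vm(1,2)] averages_tendsto[OF wm(1,2)]
    proof eventually_elim
      case (elim x)
      then have "(\<lambda>j. avg (1 / real (Suc j)) v x) \<longlonglongrightarrow> v x" "(\<lambda>j. avg (1 / real (Suc j)) w x) \<longlonglongrightarrow> w x"
        unfolding avg_def by simp_all
      then show ?case
        using p by (intro tendsto_ennrealI tendsto_powr'[OF tendsto_add[OF tendsto_power tendsto_power] tendsto_const]) simp_all
    qed
    show "(\<lambda>x. ennreal (((avg (1 / real (Suc j)) v x)\<^sup>2 + (avg (1 / real (Suc j)) w x)\<^sup>2) powr (?p / 2))) \<in> borel_measurable lborel" for j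
    proof -
      have h: "0 < 1 / real (Suc j)" by simp
      note [measurable] = avg_meas[OF mol_meas(1)[OF h] vm(1,2) h] avg_meas[OF mol_meas(2)[OF h] wm(1,2) h]
      show ?thesis by measurable
    qed
    show "(\<lambda>x. ennreal (((v x)\<^sup>2 + (w x)\<^sup>2) powr (?p / 2))) \<in> borel_measurable lborel"
      using vm(1) wm(1) by measurable
  qed
qed


section \<open>The sharp Sobolev inequality and the lower bound\<close>

lemma locally_integrable_measurable:
  fixes g :: "real ^ 'n::finite \<Rightarrow> 'b::euclidean_space"
  assumes "locally_integrable g" shows "g \<in> borel_measurable lebesgue"
proof (rule borel_measurable_LIMSEQ_metric)
  show "(\<lambda>x. indicator (cball 0 (real k)) x *\<^sub>R g x) \<in> borel_measurable lebesgue" for k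
    using assms by (intro borel_measurable_integrable) (auto simp: locally_integrable_def set_integrable_def)
  fix x :: "real ^ 'n"
  have "\<forall>\<^sub>F k in sequentially. indicator (cball 0 (real k)) x *\<^sub>R g x = g x"
    using eventually_ge_at_top[of "nat \<lceil>norm x\<rceil>"]
    by eventually_elim (auto simp: indicator_def nat_le_iff ceiling_le_iff)
  then show "(\<lambda>k. indicator (cball 0 (real k)) x *\<^sub>R g x) \<longlonglongrightarrow> g x"
    by (rule tendsto_eventually)
qed

lemma Lp_norm_powr:
  assumes "0 < p" shows "Lp_norm p f powr p = (LINT x|lebesgue. norm (f x) powr p)"
proof -
  have "0 \<le> (LINT x|lebesgue. norm (f x) powr p)" by (intro Bochner_Integration.integral_nonneg) auto
  then show ?thesis using assms by (simp add: Lp_norm_def powr_powr)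
qed

lemma norm_powr_2: "norm (a :: 'a::real_normed_vector) powr 2 = (norm a)\<^sup>2"
  by (cases "a = 0") (auto simp: powr_realpow)

lemma Lp_norm_2_sq: "(Lp_norm 2 f)\<^sup>2 = (LINT x|lebesgue. (norm (f x))\<^sup>2)"
proof -
  have "0 \<le> Lp_norm 2 f" by (simp add: Lp_norm_def)
  then have "(Lp_norm 2 f)\<^sup>2 = Lp_norm 2 f powr 2" by (cases "Lp_norm 2 f = 0") (auto simp: powr_realpow)
  then show ?thesis using Lp_norm_powr[of 2 f] by (simp add: norm_powr_2)
qed

lemma weak_gradient_norm:
  assumes "has_weak_gradient u g"
  shows "(Lp_norm 2 (weak_gradient u))\<^sup>2 = (LINT x|lebesgue. (norm (g x))\<^sup>2)"
proof -
  have w: "has_weak_gradient u (weak_gradient u)"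
    unfolding weak_gradient_def by (rule someI[of "has_weak_gradient u", OF assms])
  have [measurable]: "g \<in> borel_measurable lebesgue" "weak_gradient u \<in> borel_measurable lebesgue"
    using assms w by (auto simp: has_weak_gradient_def intro: locally_integrable_measurable)
  show ?thesis
    unfolding Lp_norm_2_sq
    using weak_gradient_unique[OF w assms] by (intro integral_cong_AE) (auto elim: eventually_mono)
qed

text \<open>\<open>L\<close> will be the real or the imaginary part. Lebesgue measurable functions
  are replaced by Borel representatives, since composition with translations and slicing in the
  preceding arguments use Borel measurability.\<close>

lemma bump_weak_component:
  fixes u :: "real ^ 'n::finite \<Rightarrow> complex" and L :: "complex \<Rightarrow> real"
  assumes L: "bounded_linear L" "\<And>z. \<bar>L z\<bar> \<le> cmod z"
    and u: "in_Lp 2 u" and G: "has_weak_gradient u G" "in_Lp 2 G"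
  obtains v g where "bump_weak v g" "AE x in lborel. v x = L (u x)" "\<And>i. AE x in lborel. g i x = L (G x $ i)"
proof -
  have [measurable]: "L \<in> borel_measurable borel"
    by (intro borel_measurable_continuous_onI linear_continuous_on L)
  have [measurable]: "u \<in> borel_measurable lebesgue" "G \<in> borel_measurable lebesgue"
    using u G by (auto simp: in_Lp_def)
  have [measurable]: "(\<lambda>x. G x $ i) \<in> borel_measurable lebesgue" for i
    by (rule borel_measurable_continuous_on[of "\<lambda>v. v $ i"]) (auto intro!: continuous_intros)
  obtain v where v [measurable]: "v \<in> borel_measurable borel" and vu: "AE x in lborel. L (u x) = v x"
    using completion_ex_borel_measurable_real[of "\<lambda>x. L (u x)" lborel] by auto
  have "\<exists>g. g \<in> borel_measurable borel \<and> (AE x in lborel. L (G x $ i) = g x)" for i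
    using completion_ex_borel_measurable_real[of "\<lambda>x. L (G x $ i)" lborel] by auto
  then obtain g where g [measurable]: "\<And>i. g i \<in> borel_measurable borel" and gG: "\<And>i. AE x in lborel. L (G x $ i) = g i x"
    by metis
  have sq: "integrable lborel (\<lambda>x. (f x)\<^sup>2)"
    if f [measurable]: "f \<in> borel_measurable borel" and w: "in_Lp 2 w" and fw: "AE x in lborel. \<bar>f x\<bar> \<le> norm (w x)"
    for f and w :: "real ^ 'n \<Rightarrow> 'b::euclidean_space"
  proof -
    have "integrable lebesgue (\<lambda>x. (f x)\<^sup>2)"
    proof (rule Bochner_Integration.integrable_bound)
      show "integrable lebesgue (\<lambda>x. norm (w x) powr 2)" using w by (simp add: in_Lp_def)
      show "AE x in lebesgue. norm ((f x)\<^sup>2) \<le> norm (norm (w x) powr 2)"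
        unfolding AE_completion_iff using fw by (auto elim!: eventually_mono simp: norm_powr_2 abs_le_square_iff[symmetric])
      show "(\<lambda>x. (f x)\<^sup>2) \<in> borel_measurable lebesgue" by (rule measurable_completion) simp
    qed
    then show ?thesis by (subst (asm) integrable_completion) auto
  qed
  have v2: "integrable lborel (\<lambda>x. (v x)\<^sup>2)"
  proof (rule sq[OF v u])
    show "AE x in lborel. \<bar>v x\<bar> \<le> cmod (u x)"
      using vu by (rule eventually_mono) (metis L(2))
  qed
  have g2: "integrable lborel (\<lambda>x. (g i x)\<^sup>2)" for i
  proof (rule sq[OF g G(2)])
    have LG: "\<bar>L (G x $ i)\<bar> \<le> norm (G x)" for x
      by (rule order_trans[OF L(2) Finite_Cartesian_Product.norm_nth_le])
    show "AE x in lborel. \<bar>g i x\<bar> \<le> norm (G x)"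
      using gG[of i] by (rule eventually_mono) (metis LG)
  qed
  have "(LINT x|lborel. partial_deriv i (box_bump a b m) x * v x) = - (LINT x|lborel. box_bump a b m x * g i x)"
    if m: "0 < m" for i a b m
  proof -
    note test = test_function_box_bump[OF m, of a b]
    obtain K where K: "compact K" "\<And>x. x \<notin> K \<Longrightarrow> box_bump a b m x = 0 \<and> (\<forall>i. partial_deriv i (box_bump a b m) x = 0)"
      using test_function_support[OF test] by blast
    have li: "locally_integrable u" "locally_integrable (\<lambda>x. G x $ i)"
      using G by (auto simp: has_weak_gradient_def intro: locally_integrable_component)
    have 1: "integrable lebesgue (\<lambda>x. partial_deriv i (box_bump a b m) x *\<^sub>R u x)"
      by (rule integrable_compact_scaleR[OF li(1) partial_deriv_cont[OF test] K(1)]) (use K in auto)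
    have 2: "integrable lebesgue (\<lambda>x. box_bump a b m x *\<^sub>R (G x $ i))"
      by (rule integrable_compact_scaleR[OF li(2) test_function_cont[OF test] K(1)]) (use K in auto)
    have [measurable]: "partial_deriv i (box_bump a b m) \<in> borel_measurable borel" "box_bump a b m \<in> borel_measurable borel"
      using partial_deriv_cont[OF test] test_function_cont[OF test] by (auto intro: borel_measurable_continuous_onI)
    have lin: "L (r *\<^sub>R z) = r * L z" "L (- z) = - L z" for r z
      using linear_cmul[OF bounded_linear.linear[OF L(1)]] linear_neg[OF bounded_linear.linear[OF L(1)]] by auto
    have "(LINT x|lebesgue. partial_deriv i (box_bump a b m) x *\<^sub>R u x) = - (LINT x|lebesgue. box_bump a b m x *\<^sub>R (G x $ i))"
      using G(1) test unfolding has_weak_gradient_def by blast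
    then have "L (LINT x|lebesgue. partial_deriv i (box_bump a b m) x *\<^sub>R u x) = - L (LINT x|lebesgue. box_bump a b m x *\<^sub>R (G x $ i))"
      by (simp add: lin)
    then have *: "(LINT x|lebesgue. partial_deriv i (box_bump a b m) x * L (u x)) = - (LINT x|lebesgue. box_bump a b m x * L (G x $ i))"
      using integral_bounded_linear[OF L(1) 1] integral_bounded_linear[OF L(1) 2] by (simp add: lin)
    have [measurable]: "(\<lambda>x. L (u x)) \<in> borel_measurable lebesgue" "(\<lambda>x. L (G x $ i)) \<in> borel_measurable lebesgue" by measurable
    have m1: "partial_deriv i (box_bump a b m) \<in> borel_measurable lebesgue" "box_bump a b m \<in> borel_measurable lebesgue"
      "v \<in> borel_measurable lebesgue" "g i \<in> borel_measurable lebesgue"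
      by (auto intro!: measurable_completion)
    have "(LINT x|lebesgue. partial_deriv i (box_bump a b m) x * L (u x)) = (LINT x|lebesgue. partial_deriv i (box_bump a b m) x * v x)"
    proof (rule integral_cong_AE)
      show "AE x in lebesgue. partial_deriv i (box_bump a b m) x * L (u x) = partial_deriv i (box_bump a b m) x * v x"
        unfolding AE_completion_iff using vu by (rule eventually_mono) simp
    qed (use m1 in measurable)
    moreover have "(LINT x|lebesgue. box_bump a b m x * L (G x $ i)) = (LINT x|lebesgue. box_bump a b m x * g i x)"
    proof (rule integral_cong_AE)
      show "AE x in lebesgue. box_bump a b m x * L (G x $ i) = box_bump a b m x * g i x"
        unfolding AE_completion_iff using gG[of i] by (rule eventually_mono) simp
    qed (use m1 in measurable)
    ultimately show ?thesis using * by (simp add: integral_completion)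
  qed
  then have "bump_weak v g" unfolding bump_weak_def using v2 g2 by auto
  moreover have "AE x in lborel. v x = L (u x)" using vu by (auto elim: eventually_mono)
  moreover have "AE x in lborel. g i x = L (G x $ i)" for i using gG[of i] by (auto elim: eventually_mono)
  ultimately show ?thesis by (rule that)
qed

lemma norm_sq_complex_vec: "(norm (z :: complex ^ 'n::finite))\<^sup>2 = (\<Sum>i\<in>UNIV. (Re (z $ i))\<^sup>2 + (Im (z $ i))\<^sup>2)"
  by (simp add: norm_vec_def L2_set_def sum_nonneg cmod_power2)

lemma sobolev_inequality:
  fixes u :: "real ^ 'n::finite \<Rightarrow> complex"
  assumes dim: "3 \<le> CARD('n)" and u: "u \<in> sobolev_H1"
  defines "p \<equiv> two_upper CARD('n)"
  shows "in_Lp p u"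
    and "(LINT x|lebesgue. cmod (u x) powr p) \<le> ((Lp_norm 2 (weak_gradient u))\<^sup>2 / sobolev_const CARD('n)) powr (p / 2)"
proof -
  obtain G where G: "has_weak_gradient u G" "in_Lp 2 G" and u2: "in_Lp 2 u"
    using u by (auto simp: sobolev_H1_def)
  have [measurable]: "u \<in> borel_measurable lebesgue" "G \<in> borel_measurable lebesgue"
    using u2 G by (auto simp: in_Lp_def)
  obtain v g where v: "bump_weak v g" "AE x in lborel. v x = Re (u x)" "\<And>i. AE x in lborel. g i x = Re (G x $ i)"
    using bump_weak_component[OF bounded_linear_Re abs_Re_le_cmod u2 G] by blast
  obtain w k where w: "bump_weak w k" "AE x in lborel. w x = Im (u x)" "\<And>i. AE x in lborel. k i x = Im (G x $ i)"
    using bump_weak_component[OF bounded_linear_Im abs_Im_le_cmod u2 G] by blast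
  have meas: "g i \<in> borel_measurable lebesgue" "k i \<in> borel_measurable lebesgue"
    and sq: "integrable lborel (\<lambda>x. (g i x)\<^sup>2)" "integrable lborel (\<lambda>x. (k i x)\<^sup>2)" for i
    using v(1) w(1) by (auto simp: bump_weak_def intro: measurable_completion)
  have A: "(\<Sum>i\<in>UNIV. (LINT x|lborel. (g i x)\<^sup>2) + (LINT x|lborel. (k i x)\<^sup>2)) = (Lp_norm 2 (weak_gradient u))\<^sup>2"
  proof -
    have "(\<Sum>i\<in>UNIV. (LINT x|lborel. (g i x)\<^sup>2) + (LINT x|lborel. (k i x)\<^sup>2)) = (LINT x|lborel. (\<Sum>i\<in>UNIV. (g i x)\<^sup>2 + (k i x)\<^sup>2))"
      using sq by simp
    also have "\<dots> = (LINT x|lebesgue. (\<Sum>i\<in>UNIV. (g i x)\<^sup>2 + (k i x)\<^sup>2))"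
      using sq by (intro integral_completion[symmetric] borel_measurable_integrable) auto
    also have "\<dots> = (LINT x|lebesgue. (norm (G x))\<^sup>2)"
    proof (rule integral_cong_AE)
      have "AE x in lborel. \<forall>i. g i x = Re (G x $ i)" "AE x in lborel. \<forall>i. k i x = Im (G x $ i)"
        using v(3) w(3) by (simp_all add: AE_all_countable)
      then show "AE x in lebesgue. (\<Sum>i\<in>UNIV. (g i x)\<^sup>2 + (k i x)\<^sup>2) = (norm (G x))\<^sup>2"
        unfolding AE_completion_iff by eventually_elim (simp add: norm_sq_complex_vec)
    qed (use meas in auto)
    finally show ?thesis using weak_gradient_norm[OF G(1)] by simp
  qed
  have "(\<integral>\<^sup>+x. ennreal (cmod (u x) powr p) \<partial>lebesgue) = (\<integral>\<^sup>+x. ennreal (((v x)\<^sup>2 + (w x)\<^sup>2) powr (p / 2)) \<partial>lborel)"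
    unfolding nn_integral_completion using v(2) w(2)
  proof (intro nn_integral_cong_AE, eventually_elim)
    case (elim x)
    have "cmod (u x) powr p = (cmod (u x) powr 2) powr (p / 2)" by (subst powr_powr) simp
    also have "cmod (u x) powr 2 = (v x)\<^sup>2 + (w x)\<^sup>2" using elim by (simp only: norm_powr_2 cmod_power2)
    finally show ?case by simp
  qed
  also have "\<dots> \<le> ennreal (((Lp_norm 2 (weak_gradient u))\<^sup>2 / sobolev_const CARD('n)) powr (p / 2))"
    using bump_weak_sobolev[OF dim v(1) w(1)] unfolding A p_def .
  finally have le: "(\<integral>\<^sup>+x. ennreal (cmod (u x) powr p) \<partial>lebesgue) \<le> ennreal (((Lp_norm 2 (weak_gradient u))\<^sup>2 / sobolev_const CARD('n)) powr (p / 2))" .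
  have int: "integrable lebesgue (\<lambda>x. cmod (u x) powr p)"
    by (rule integrableI_nonneg) (use le in \<open>auto simp: less_top[symmetric] top_unique\<close>)
  then show "in_Lp p u" by (simp add: in_Lp_def)
  show "(LINT x|lebesgue. cmod (u x) powr p) \<le> ((Lp_norm 2 (weak_gradient u))\<^sup>2 / sobolev_const CARD('n)) powr (p / 2)"
    using le nn_integral_eq_integral[OF int] by (simp add: ennreal_le_iff)
qed

section \<open>The strict lower bound on the constraint\<close>

lemma exponents:
  assumes "3 \<le> n"
  shows "two_lower n = 2 * (real n + 2) / real n" "two_upper n / 2 = real n / (real n - 2)" "two_upper n / 2 - 1 = 2 / (real n - 2)"
    "2 < two_lower n" "two_lower n \<le> two_upper n" "1 / 2 - 1 / two_upper n = 1 / real n"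
    "1 / two_lower n = 1 / 2 * (real n / (real n + 2))"
  using assms by (auto simp: two_lower_def two_upper_def field_simps)

text \<open>The critical energy of the ground state, expressed through the sharp constant so that
  the lower bound can be stated independently of it; \<open>critical_energy_ground_state\<close>
  confirms the identity.\<close>

definition sobolev_energy :: "nat \<Rightarrow> real" where
  "sobolev_energy n = sobolev_const n powr (real n / 2) / real n"

text \<open>\<open>1 / two_lower d\<close> is exactly half of d / (d + 2), so subtracting half of
  the virial from the energy removes the gradient and the lower-order term together and leaves 1/2 -
  1/2^* = 1/d times the critical term.\<close>

lemma constraint_energy:
  fixes u :: "real ^ 'n::finite \<Rightarrow> complex"
  assumes dim: "3 \<le> CARD('n)" and K: "virial u = 0"
  shows "energy u = (LINT x|lebesgue. cmod (u x) powr two_upper CARD('n)) / real CARD('n)"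
proof -
  let ?n = "CARD('n)"
  define E where "E = (Lp_norm 2 (weak_gradient u))\<^sup>2"
  define B where "B = Lp_norm (two_lower ?n) u powr two_lower ?n"
  define C where "C = Lp_norm (two_upper ?n) u powr two_upper ?n"
  have K': "C = E + real ?n / (real ?n + 2) * B"
    using K by (simp add: virial_def E_def B_def C_def)
  have "energy u = 1 / 2 * E + 1 / two_lower ?n * B - 1 / two_upper ?n * C"
    by (simp add: energy_def E_def B_def C_def)
  also have "\<dots> = 1 / 2 * (E + real ?n / (real ?n + 2) * B) - 1 / two_upper ?n * C"
    unfolding exponents(7)[OF dim] by (simp add: algebra_simps)
  also have "\<dots> = (1 / 2 - 1 / two_upper ?n) * C"
    unfolding K'[symmetric] by (simp add: algebra_simps)
  also have "\<dots> = C / real ?n" unfolding exponents(6)[OF dim] by simp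
  finally show ?thesis
    using Lp_norm_powr[of "two_upper ?n" u] two_upper_gt[OF dim] by (simp add: C_def)
qed

lemma energy_gt:
  fixes u :: "real ^ 'n::finite \<Rightarrow> complex"
  assumes dim: "3 \<le> CARD('n)" and c: "0 < c" and u: "u \<in> constraint_set c"
  shows "sobolev_energy CARD('n) < energy u"
proof -
  define n where "n = CARD('n)"
  have n: "3 \<le> n" using dim by (simp add: n_def)
  have H1: "u \<in> sobolev_H1" and M: "mass u = c" and K: "virial u = 0"
    using u by (auto simp: constraint_set_def)
  have u2: "in_Lp 2 u" using H1 by (simp add: sobolev_H1_def)
  define E where "E = (Lp_norm 2 (weak_gradient u))\<^sup>2"
  define B where "B = (LINT x|lebesgue. cmod (u x) powr two_lower n)"
  define C where "C = (LINT x|lebesgue. cmod (u x) powr two_upper n)"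
  define S where "S = sobolev_const n"
  have S: "0 < S" using sobolev_const_pos[OF n] by (simp add: S_def)
  note ex = exponents[OF n]
  have [measurable]: "u \<in> borel_measurable lebesgue" using u2 by (simp add: in_Lp_def)
  have up: "in_Lp (two_upper n) u" and C_le: "C \<le> (E / S) powr (two_upper n / 2)"
    using sobolev_inequality[OF dim H1] by (simp_all add: C_def E_def S_def n_def)
  have KE: "C = E + real n / (real n + 2) * B"
    using K Lp_norm_powr[of "two_lower n" u] Lp_norm_powr[of "two_upper n" u] ex two_upper_gt[OF n]
    by (simp add: virial_def n_def[symmetric] E_def B_def C_def)
  \<comment> \<open>If this were not integrable, the Bochner integral \<open>B\<close> would be 0 by
    default, and its positivity below could not be obtained. The exponent lies between 2 and the
    critical one, both of which are under control.\<close>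
  have B_int: "integrable lebesgue (\<lambda>x. cmod (u x) powr two_lower n)"
  proof (rule Bochner_Integration.integrable_bound)
    show "integrable lebesgue (\<lambda>x. cmod (u x) powr 2 + cmod (u x) powr two_upper n)"
      using u2 up by (auto simp: in_Lp_def)
    have "t powr two_lower n \<le> t powr 2 + t powr two_upper n" if "0 \<le> t" for t :: real
    proof (cases "t \<le> 1")
      case True
      then have "t powr two_lower n \<le> t powr 2" using ex that by (intro powr_mono') auto
      then show ?thesis by (simp add: add_increasing2)
    next
      case False
      then have "t powr two_lower n \<le> t powr two_upper n" using ex by (intro powr_mono) auto
      then show ?thesis by (simp add: add_increasing)
    qed
    then show "AE x in lebesgue. norm (cmod (u x) powr two_lower n) \<le> norm (cmod (u x) powr 2 + cmod (u x) powr two_upper n)"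
      by (intro AE_I2) simp
  qed measurable
  \<comment> \<open>The source of strictness: B = 0 forces u = 0 almost everywhere, against the
    positive mass. With B > 0 the constraint gives E < C.\<close>
  have "B \<noteq> 0"
  proof
    assume "B = 0"
    then have "AE x in lebesgue. cmod (u x) powr two_lower n = 0"
      using integral_nonneg_eq_0_iff_AE[OF B_int] by (simp add: B_def)
    then have "(LINT x|lebesgue. (cmod (u x))\<^sup>2) = (LINT x|(lebesgue :: (real ^ 'n) measure). 0)"
      by (intro integral_cong_AE) (auto elim!: eventually_mono)
    then have "mass u = 0" by (simp add: mass_def Lp_norm_2_sq)
    then show False using M c by simp
  qed
  moreover have "0 \<le> B" unfolding B_def by (intro Bochner_Integration.integral_nonneg) auto
  ultimately have B: "0 < B" by simp
  have E: "0 \<le> E" by (simp add: E_def)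
  have EC: "E < C" using KE B n by (simp add: add_pos_nonneg divide_pos_pos)
  then have C: "0 < C" using E by simp
  \<comment> \<open>The Sobolev inequality with the gradient term replaced by the larger
    \<open>C\<close> becomes a strict inequality in \<open>C\<close> alone; dividing by
    \<open>C\<close> and taking a power gives C > S^(n/2).\<close>
  have "C \<le> (E / S) powr (two_upper n / 2)" by (rule C_le)
  also have "\<dots> < (C / S) powr (two_upper n / 2)"
    using E EC S two_upper_gt[OF n] by (intro powr_less_mono2) (auto simp: divide_strict_right_mono)
  finally have "C < C powr (two_upper n / 2) / S powr (two_upper n / 2)"
    using C S by (simp add: powr_divide)
  then have "C * S powr (two_upper n / 2) < C powr (two_upper n / 2)"
    using S by (simp add: field_simps)
  also have "\<dots> = C * C powr (two_upper n / 2 - 1)"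
    unfolding powr_diff using C by simp
  finally have "S powr (two_upper n / 2) < C powr (two_upper n / 2 - 1)"
    using C by (simp only: mult_less_cancel_left_pos)
  then have "(S powr (two_upper n / 2)) powr ((real n - 2) / 2) < (C powr (two_upper n / 2 - 1)) powr ((real n - 2) / 2)"
    using n by (intro powr_less_mono2) auto
  moreover have "two_upper n / 2 * ((real n - 2) / 2) = real n / 2" "(two_upper n / 2 - 1) * ((real n - 2) / 2) = 1"
    by (subst ex(2), use n in simp) (subst ex(3), use n in simp)
  ultimately have "S powr (real n / 2) < C"
    using C by (simp add: powr_powr)
  then have "sobolev_energy n < C / real n"
    using n by (simp add: sobolev_energy_def S_def divide_strict_right_mono)
  then show ?thesis
    using constraint_energy[OF dim K] by (simp add: C_def n_def)
qed


section \<open>The ground state\<close>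

lemma integral_pos_everywhere:
  fixes f :: "'a::euclidean_space \<Rightarrow> real"
  assumes int: "integrable lborel f" and pos: "\<And>x. 0 < f x"
  shows "0 < (LINT x|lborel. f x)"
proof -
  have ne: "f x \<noteq> 0" for x using pos[of x] by simp
  have "(LINT x|lborel. f x) \<noteq> 0"
    using pos by (subst integral_nonneg_eq_0_iff_AE[OF int])
      (auto simp: ne eventually_ae_filter null_sets_def emeasure_lborel_UNIV less_imp_le dest: top.extremum_uniqueI)
  moreover have "0 \<le> (LINT x|lborel. f x)"
    using pos by (intro Bochner_Integration.integral_nonneg) (simp add: less_imp_le)
  ultimately show ?thesis by simp
qed

lemma integral_lborel_scale:
  fixes f :: "real ^ 'n::finite \<Rightarrow> real"
  assumes [measurable]: "f \<in> borel_measurable borel" and r: "0 < r"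
  shows "(LINT x|lborel. f x) = r ^ CARD('n) * (LINT x|lborel. f (r *\<^sub>R x))"
    and "integrable lborel f \<Longrightarrow> integrable lborel (\<lambda>x. f (r *\<^sub>R x))"
proof -
  have eq: "(lborel :: (real ^ 'n) measure) = density (distr lborel borel (\<lambda>x. 0 + r *\<^sub>R x)) (\<lambda>_. ennreal (\<bar>r\<bar> ^ DIM(real ^ 'n)))"
    using lborel_affine[of r "0 :: real ^ 'n"] r by (simp add: ennreal_power)
  have "(LINT x|lborel. f x) = (LINT x|density (distr lborel borel (\<lambda>x. 0 + r *\<^sub>R x)) (\<lambda>_. ennreal (\<bar>r\<bar> ^ DIM(real ^ 'n))). f x)"
    by (subst eq) simp
  also have "\<dots> = (LINT x|distr lborel borel (\<lambda>x. 0 + r *\<^sub>R x). \<bar>r\<bar> ^ DIM(real ^ 'n) *\<^sub>R f x)"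
    by (rule integral_density) auto
  also have "\<dots> = (LINT x|lborel. \<bar>r\<bar> ^ DIM(real ^ 'n) *\<^sub>R f (0 + r *\<^sub>R x))"
    by (rule integral_distr) auto
  finally show "(LINT x|lborel. f x) = r ^ CARD('n) * (LINT x|lborel. f (r *\<^sub>R x))" using r by simp
  assume "integrable lborel f"
  then have "integrable (density (distr lborel borel (\<lambda>x. 0 + r *\<^sub>R x)) (\<lambda>_. ennreal (\<bar>r\<bar> ^ DIM(real ^ 'n)))) f"
    by (subst (asm) eq)
  then have "integrable (distr lborel borel (\<lambda>x. 0 + r *\<^sub>R x)) (\<lambda>x. \<bar>r\<bar> ^ DIM(real ^ 'n) *\<^sub>R f x)"
    by (subst (asm) integrable_density) auto
  then have "integrable lborel (\<lambda>x. \<bar>r\<bar> ^ DIM(real ^ 'n) *\<^sub>R f (0 + r *\<^sub>R x))"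
    by (subst (asm) integrable_distr_eq) auto
  then have "integrable lborel (\<lambda>x. \<bar>r\<bar> ^ DIM(real ^ 'n) * f (r *\<^sub>R x))" by simp
  from integrable_mult_right[OF this, of "1 / \<bar>r\<bar> ^ DIM(real ^ 'n)"]
  show "integrable lborel (\<lambda>x. f (r *\<^sub>R x))" using r by simp
qed

lemma locally_integrable_continuous:
  fixes f :: "real ^ 'n::finite \<Rightarrow> 'b::euclidean_space"
  assumes "continuous_on UNIV f" shows "locally_integrable f"
  unfolding locally_integrable_def set_integrable_def
proof (intro allI impI)
  fix K :: "(real ^ 'n) set" assume "compact K"
  then have "integrable lborel (\<lambda>x. indicator K x *\<^sub>R f x)"
    by (intro borel_integrable_compact continuous_on_subset[OF assms]) auto
  then show "integrable lebesgue (\<lambda>x. indicator K x *\<^sub>R f x)"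
    by (subst integrable_completion) (auto dest: borel_measurable_integrable)
qed

text \<open>The product of the function with a test function is integrable together with its
  derivative, so the integral of the derivative vanishes.\<close>

lemma line_C1_weak_gradient:
  fixes a :: "real ^ 'n::finite \<Rightarrow> real"
  assumes a: "line_C1 a a'"
  shows "has_weak_gradient (\<lambda>x. complex_of_real (a x)) (\<lambda>x. \<chi> i. complex_of_real (a' i x))"
  unfolding has_weak_gradient_def
proof (intro conjI allI impI)
  have ac: "continuous_on UNIV a" "continuous_on UNIV (a' i)" for i using a by (auto simp: line_C1_def)
  show "locally_integrable (\<lambda>x. complex_of_real (a x))"
    by (intro locally_integrable_continuous continuous_intros ac)
  show "locally_integrable (\<lambda>x. \<chi> i. complex_of_real (a' i x))"
    by (intro locally_integrable_continuous continuous_on_vec_lambda continuous_intros ac)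
  fix \<phi> :: "real ^ 'n \<Rightarrow> real" and i assume test: "test_function \<phi>"
  obtain K where K: "compact K" "\<And>x. x \<notin> K \<Longrightarrow> \<phi> x = 0 \<and> (\<forall>i. partial_deriv i \<phi> x = 0)"
    using test_function_support[OF test] by blast
  have cs: "integrable lborel f" if "continuous_on UNIV f" "\<And>x. x \<notin> K \<Longrightarrow> f x = 0" for f :: "real ^ 'n \<Rightarrow> real"
  proof -
    have "integrable lborel (\<lambda>x. indicator K x *\<^sub>R f x)"
      using K(1) by (intro borel_integrable_compact continuous_on_subset[OF that(1)]) auto
    moreover have "(\<lambda>x. indicator K x *\<^sub>R f x) = f" using that(2) by (fastforce simp: indicator_def)
    ultimately show ?thesis by simp
  qed
  note pc = partial_deriv_cont[OF test, of i] and tc = test_function_cont[OF test]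
  have i0: "integrable lborel (\<lambda>x. \<phi> x * a x)" by (rule cs) (use tc ac K in \<open>auto intro!: continuous_intros\<close>)
  have i1: "integrable lborel (\<lambda>x. \<phi> x * a' i x)" by (rule cs) (use tc ac K in \<open>auto intro!: continuous_intros\<close>)
  have i2: "integrable lborel (\<lambda>x. partial_deriv i \<phi> x * a x)" by (rule cs) (use pc ac K in \<open>auto intro!: continuous_intros\<close>)
  have int: "integrable lborel (\<lambda>x. \<phi> x * a' i x + partial_deriv i \<phi> x * a x)" using i1 i2 by simp
  have d: "((\<lambda>s. \<phi> (x + s *\<^sub>R axis i 1) * a (x + s *\<^sub>R axis i 1)) has_real_derivative
      (0 + (\<phi> x * a' i x + partial_deriv i \<phi> x * a x))) (at 0)" for x
    using DERIV_mult[OF test_function_deriv[OF test, of x i], of "\<lambda>s. a (x + s *\<^sub>R axis i 1)" "a' i x"] a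
    by (simp add: line_C1_def algebra_simps)
  \<comment> \<open>The integration by parts is used with its signed part \<open>D\<close> equal to
    zero and the whole derivative of the product as \<open>E\<close>.\<close>
  have "(LINT x|(lborel :: (real ^ 'n) measure). (0::real)) = - (LINT x|lborel. \<phi> x * a' i x + partial_deriv i \<phi> x * a x)"
  proof (rule line_integration_by_parts(2)[OF i0 int, where D = "\<lambda>_. 0" and i = i])
    show "((\<lambda>s. \<phi> (x + s *\<^sub>R axis i 1) * a (x + s *\<^sub>R axis i 1)) has_real_derivative
      (0 + (\<phi> x * a' i x + partial_deriv i \<phi> x * a x))) (at 0)" for x
      by (rule d)
    show "continuous_on UNIV (\<lambda>s. \<phi> (x + s *\<^sub>R axis i 1) * a' i (x + s *\<^sub>R axis i 1) + partial_deriv i \<phi> (x + s *\<^sub>R axis i 1) * a (x + s *\<^sub>R axis i 1))" for x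
      by (intro continuous_intros continuous_on_compose2[OF tc] continuous_on_compose2[OF pc] continuous_on_compose2[OF ac(1)] continuous_on_compose2[OF ac(2)]) auto
  qed auto
  then have *: "(LINT x|lborel. partial_deriv i \<phi> x * a x) = - (LINT x|lborel. \<phi> x * a' i x)"
    using i1 i2 by simp
  have m: "(\<lambda>x. partial_deriv i \<phi> x * a x) \<in> borel_measurable lborel" "(\<lambda>x. \<phi> x * a' i x) \<in> borel_measurable lborel"
    using i1 i2 by auto
  have "(LINT x|lebesgue. partial_deriv i \<phi> x *\<^sub>R complex_of_real (a x)) = complex_of_real (LINT x|lborel. partial_deriv i \<phi> x * a x)"
    by (simp add: scaleR_conv_of_real integral_completion[OF m(1)] flip: of_real_mult)
  moreover have "(LINT x|lebesgue. \<phi> x *\<^sub>R ((\<chi> i. complex_of_real (a' i x)) $ i)) = complex_of_real (LINT x|lborel. \<phi> x * a' i x)"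
    by (simp add: scaleR_conv_of_real integral_completion[OF m(2)] flip: of_real_mult)
  ultimately show "(LINT x|lebesgue. partial_deriv i \<phi> x *\<^sub>R complex_of_real (a x)) = - (LINT x|lebesgue. \<phi> x *\<^sub>R ((\<chi> i. complex_of_real (a' i x)) $ i))"
    using * by simp
qed

lemma line_C1_gradient_norm:
  fixes a :: "real ^ 'n::finite \<Rightarrow> real"
  assumes a: "line_C1 a a'"
  shows "(Lp_norm 2 (weak_gradient (\<lambda>x. complex_of_real (a x))))\<^sup>2 = (LINT x|lborel. (\<Sum>i\<in>UNIV. (a' i x)\<^sup>2))"
proof -
  have "(\<lambda>x. \<Sum>i\<in>UNIV. (a' i x)\<^sup>2) \<in> borel_measurable lborel"
    using line_C1_measurable(2)[OF a] by measurable
  then show ?thesis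
    unfolding weak_gradient_norm[OF line_C1_weak_gradient[OF a]]
    by (simp add: norm_sq_complex_vec integral_completion)
qed

lemma Lp_norm_of_real:
  fixes a :: "real ^ 'n::finite \<Rightarrow> real"
  assumes "continuous_on UNIV a" "\<And>x. 0 < a x" "0 < p"
  shows "Lp_norm p (\<lambda>x. complex_of_real (a x)) powr p = (LINT x|lborel. a x powr p)"
proof -
  have [measurable]: "a \<in> borel_measurable borel" using assms(1) by (rule borel_measurable_continuous_onI)
  have "\<bar>a x\<bar> = a x" for x using assms(2)[of x] by simp
  then show ?thesis using assms(3) by (simp add: Lp_norm_powr integral_completion)
qed

section \<open>The norms of the ground state\<close>

lemma bracket_powr: "0 \<le> c \<Longrightarrow> bracket c b x powr r = bracket c (b * r) x"
  by (simp add: bracket_def powr_powr)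

lemma bracket_scale: "0 \<le> c \<Longrightarrow> bracket c b x = bracket 1 b (sqrt c *\<^sub>R x)"
  by (simp add: bracket_def power_mult_distrib)

lemma integral_bracket_scaled:
  assumes "0 < c"
  shows "(LINT x|lborel. bracket c b (x :: real ^ 'n::finite)) = (LINT x|lborel. bracket 1 b (x :: real ^ 'n)) / sqrt c ^ CARD('n)"
proof -
  have "bracket 1 b \<in> borel_measurable (borel :: (real ^ 'n) measure)"
    by (intro borel_measurable_continuous_onI bracket_cont) simp
  from integral_lborel_scale(1)[OF this, of "sqrt c"] show ?thesis
    using assms by (simp add: bracket_scale[of c b])
qed

definition ground_scale :: "nat \<Rightarrow> real" where
  "ground_scale n = 1 / (real n * (real n - 2))"

lemma ground_scale_pos: "3 \<le> n \<Longrightarrow> 0 < ground_scale n"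
  by (simp add: ground_scale_def)

lemma ground_state_bracket:
  "ground_state (x :: real ^ 'n::finite) = complex_of_real (bracket (ground_scale CARD('n)) (- (real CARD('n) - 2) / 2) x)"
  by (simp add: ground_state_def bracket_def ground_scale_def)

lemma ground_mass:
  assumes dim: "3 \<le> CARD('n::finite)"
  shows "(LINT x|lborel. bracket (ground_scale CARD('n)) (- real CARD('n)) (x :: real ^ 'n)) = real CARD('n) * sobolev_energy CARD('n)"
proof -
  define n where "n = CARD('n)"
  have n: "3 \<le> n" "3 \<le> real n" using dim by (auto simp: n_def)
  define Z where "Z = (\<Prod>j<n. bessel (real n - real j / 2))"
  have Z: "0 < Z" unfolding Z_def using n by (intro prod_pos bessel_pos) auto
  have r: "0 < real n * (real n - 2)" using n by simp
  have J: "(LINT x|lborel. bracket 1 (- real n) (x :: real ^ 'n)) = Z"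
    using integral_bracket[where 'n = 'n, of "real n"] n by (simp add: bracket_def Z_def n_def)
  have "sobolev_const n powr (real n / 2) = (real n * (real n - 2)) powr (real n / 2) * (Z powr (2 / real n)) powr (real n / 2)"
    unfolding sobolev_const_def Z_def[symmetric] using r by (simp add: powr_mult)
  also have "(Z powr (2 / real n)) powr (real n / 2) = Z" using Z n by (simp add: powr_powr)
  also have "(real n * (real n - 2)) powr (real n / 2) = 1 / sqrt (ground_scale n) ^ n"
  proof -
    have "sqrt (ground_scale n) ^ n = (ground_scale n powr (1 / 2)) powr real n"
      using ground_scale_pos[OF n(1)] by (simp add: powr_half_sqrt powr_realpow)
    also have "\<dots> = (1 / (real n * (real n - 2))) powr (real n / 2)" by (simp add: powr_powr ground_scale_def)
    also have "\<dots> = 1 / (real n * (real n - 2)) powr (real n / 2)" using r by (simp add: powr_divide)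
    finally show ?thesis by simp
  qed
  finally have "sobolev_const n powr (real n / 2) = Z / sqrt (ground_scale n) ^ n" by simp
  then show ?thesis
    using integral_bracket_scaled[OF ground_scale_pos[OF n(1)], of "- real n", where 'n = 'n] n J
    by (simp add: sobolev_energy_def n_def[symmetric])
qed

text \<open>The normalisation c n (n - 2) = 1 turns the coefficient (n - 2)^2 c^2 |x|^2 into (n -
  2)/n times c |x|^2, and c |x|^2 is the base of the bracket minus one; hence the difference of two
  consecutive powers.\<close>

lemma ground_gradient_sq:
  fixes x :: "real ^ 'n::finite"
  assumes dim: "3 \<le> CARD('n)"
  shows "(\<Sum>i\<in>UNIV. (bracket_deriv (ground_scale CARD('n)) (- (real CARD('n) - 2) / 2) i x)\<^sup>2)
    = (real CARD('n) - 2) / real CARD('n) * (bracket (ground_scale CARD('n)) (- (real CARD('n) - 1)) x - bracket (ground_scale CARD('n)) (- real CARD('n)) x)"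
proof -
  define n where "n = real CARD('n)"
  define c where "c = ground_scale CARD('n)"
  have n: "3 \<le> n" using dim by (simp add: n_def)
  have c: "0 < c" "c * (n * (n - 2)) = 1" using ground_scale_pos[OF dim] n by (auto simp: c_def n_def ground_scale_def)
  define y where "y = 1 + c * (norm x)\<^sup>2"
  have y: "0 < y" using c by (simp add: y_def add_pos_nonneg)
  have "(bracket_deriv c (- (n - 2) / 2) i x)\<^sup>2 = (n - 2)\<^sup>2 * c\<^sup>2 * y powr (- n) * (x $ i)\<^sup>2" for i
  proof -
    have "(y powr (- (n - 2) / 2 - 1))\<^sup>2 = y powr (- n)"
      using y by (simp add: power2_eq_square powr_add[symmetric] field_simps)
    moreover have "bracket_deriv c (- (n - 2) / 2) i x = - ((n - 2) * c * y powr (- (n - 2) / 2 - 1) * (x $ i))"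
      by (simp add: bracket_deriv_def y_def[symmetric]) (simp add: algebra_simps)
    ultimately show ?thesis by (simp only: power2_minus power_mult_distrib)
  qed
  then have "(\<Sum>i\<in>UNIV. (bracket_deriv c (- (n - 2) / 2) i x)\<^sup>2) = (n - 2)\<^sup>2 * c\<^sup>2 * y powr (- n) * (norm x)\<^sup>2"
    by (simp add: sum_distrib_left[symmetric] norm_sq_vec)
  also have "\<dots> = (n - 2) / n * (c * (n * (n - 2))) * ((c * (norm x)\<^sup>2) * y powr (- n))"
    using n by (simp add: power2_eq_square)
  also have "\<dots> = (n - 2) / n * ((y - 1) * y powr (- n))" by (simp add: c y_def)
  also have "(y - 1) * y powr (- n) = y powr (- (n - 1)) - y powr (- n)"
    using y by (simp add: algebra_simps powr_diff powr_minus powr_add divide_simps)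
  finally show ?thesis by (simp add: bracket_def y_def c_def n_def)
qed

text \<open>The squared gradient norm equals the critical integral of \<open>ground_mass\<close>,
  the identity that testing the equation of W with W itself would give. Here it comes from
  \<open>prod_bessel_ratio\<close>, the relation that also evaluates the moment of the
  transport.\<close>

lemma ground_gradient:
  assumes dim: "3 \<le> CARD('n::finite)"
  shows "integrable lborel (\<lambda>x :: real ^ 'n. \<Sum>i\<in>UNIV. (bracket_deriv (ground_scale CARD('n)) (- (real CARD('n) - 2) / 2) i x)\<^sup>2)"
    and "(LINT x|lborel. (\<Sum>i\<in>UNIV. (bracket_deriv (ground_scale CARD('n)) (- (real CARD('n) - 2) / 2) i (x :: real ^ 'n))\<^sup>2))
      = real CARD('n) * sobolev_energy CARD('n)"
proof -
  define n where "n = real CARD('n)"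
  define c where "c = ground_scale CARD('n)"
  have n: "3 \<le> n" using dim by (simp add: n_def)
  have c: "0 < c" using ground_scale_pos[OF dim] by (simp add: c_def)
  have int: "integrable lborel (bracket c (- (n - 1)) :: real ^ 'n \<Rightarrow> real)" "integrable lborel (bracket c (- n) :: real ^ 'n \<Rightarrow> real)"
    using n integrable_bracket_scaled[OF c, of "n - 1", where 'n = 'n] integrable_bracket_scaled[OF c, of n, where 'n = 'n] by (simp_all add: n_def)
  show "integrable lborel (\<lambda>x :: real ^ 'n. \<Sum>i\<in>UNIV. (bracket_deriv (ground_scale CARD('n)) (- (real CARD('n) - 2) / 2) i x)\<^sup>2)"
    unfolding ground_gradient_sq[OF dim] using int by (simp add: c_def n_def)
  have J: "(n - 2) * (LINT x|lborel. bracket c (- (n - 1)) (x :: real ^ 'n)) = (2 * n - 2) * (LINT x|lborel. bracket c (- n) (x :: real ^ 'n))"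
  proof -
    have "(n - 2) * (LINT x|lborel. bracket 1 (- (n - 1)) (x :: real ^ 'n)) = (2 * n - 2) * (LINT x|lborel. bracket 1 (- n) (x :: real ^ 'n))"
      using prod_bessel_ratio[OF dim] integral_bracket[where 'n = 'n, of "n - 1"] integral_bracket[where 'n = 'n, of n] n
      by (simp add: bracket_def n_def)
    then show ?thesis unfolding integral_bracket_scaled[OF c] by simp
  qed
  have "(LINT x|lborel. (\<Sum>i\<in>UNIV. (bracket_deriv (ground_scale CARD('n)) (- (real CARD('n) - 2) / 2) i (x :: real ^ 'n))\<^sup>2))
    = (n - 2) / n * ((LINT x|lborel. bracket c (- (n - 1)) (x :: real ^ 'n)) - (LINT x|lborel. bracket c (- n) (x :: real ^ 'n)))"
    unfolding ground_gradient_sq[OF dim] using int by (simp add: c_def n_def)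
  also have "\<dots> = (LINT x|lborel. bracket c (- n) (x :: real ^ 'n))"
    using J n by (simp add: field_simps)
  finally show "(LINT x|lborel. (\<Sum>i\<in>UNIV. (bracket_deriv (ground_scale CARD('n)) (- (real CARD('n) - 2) / 2) i (x :: real ^ 'n))\<^sup>2))
      = real CARD('n) * sobolev_energy CARD('n)"
    using ground_mass[OF dim] by (simp add: c_def n_def)
qed

lemma critical_energy_ground_state:
  assumes dim: "3 \<le> CARD('n::finite)"
  shows "critical_energy (ground_state :: real ^ 'n \<Rightarrow> complex) = sobolev_energy CARD('n)"
proof -
  let ?n = "real CARD('n)" and ?c = "ground_scale CARD('n)" and ?p = "two_upper CARD('n)"
  have c: "0 < ?c" by (rule ground_scale_pos[OF dim])
  have p: "0 < ?p" using two_upper_gt[OF dim] by simp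
  have W: "(ground_state :: real ^ 'n \<Rightarrow> complex) = (\<lambda>x. complex_of_real (bracket ?c (- (?n - 2) / 2) x))"
    by (rule ext) (rule ground_state_bracket)
  have "(Lp_norm 2 (weak_gradient (ground_state :: real ^ 'n \<Rightarrow> complex)))\<^sup>2 = ?n * sobolev_energy CARD('n)"
    unfolding W using c ground_gradient(2)[OF dim] by (subst line_C1_gradient_norm[OF line_C1_bracket]) auto
  moreover have "Lp_norm ?p (ground_state :: real ^ 'n \<Rightarrow> complex) powr ?p = ?n * sobolev_energy CARD('n)"
  proof -
    have "- (?n - 2) / 2 * ?p = - ?n" using dim by (simp add: two_upper_eq field_simps)
    then show ?thesis
      unfolding W using c ground_mass[OF dim] bracket_pos[of ?c] p
      by (subst Lp_norm_of_real) (auto intro: bracket_cont simp: bracket_powr)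
  qed
  ultimately have "critical_energy (ground_state :: real ^ 'n \<Rightarrow> complex) = (1 / 2 - 1 / ?p) * (?n * sobolev_energy CARD('n))"
    by (simp add: critical_energy_def algebra_simps)
  then show ?thesis unfolding exponents(6)[OF dim] using dim by simp
qed


section \<open>Rescaling to the constraint\<close>

lemma line_C1_dilation:
  fixes a :: "real ^ 'n::finite \<Rightarrow> real"
  assumes a: "line_C1 a a'"
  shows "line_C1 (\<lambda>x. s * a (l *\<^sub>R x)) (\<lambda>i x. s * (l * a' i (l *\<^sub>R x)))"
proof (rule line_C1_cmult)
  have ac: "continuous_on UNIV a" "continuous_on UNIV (a' i)" for i using a by (auto simp: line_C1_def)
  show "line_C1 (\<lambda>x. a (l *\<^sub>R x)) (\<lambda>i x. l * a' i (l *\<^sub>R x))"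
    unfolding line_C1_def
  proof (intro conjI allI)
    show "continuous_on UNIV (\<lambda>x. a (l *\<^sub>R x))"
      by (rule continuous_on_compose2[OF ac(1)]) (auto intro!: continuous_intros)
    show "continuous_on UNIV (\<lambda>x. l * a' i (l *\<^sub>R x))" for i
      by (intro continuous_on_mult_left continuous_on_compose2[OF ac(2)]) (auto intro!: continuous_intros)
    fix i and x :: "real ^ 'n"
    have "((\<lambda>t. a (l *\<^sub>R x + t *\<^sub>R axis i 1)) has_real_derivative a' i (l *\<^sub>R x)) (at (l * 0))"
      using a by (simp add: line_C1_def)
    moreover have "((\<lambda>r. l * r) has_real_derivative l) (at 0)" by (auto intro!: derivative_eq_intros)
    ultimately have "((\<lambda>r. a (l *\<^sub>R x + (l * r) *\<^sub>R axis i 1)) has_real_derivative a' i (l *\<^sub>R x) * l) (at 0)"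
      by (rule DERIV_chain2)
    then show "((\<lambda>r. a (l *\<^sub>R (x + r *\<^sub>R axis i 1))) has_real_derivative l * a' i (l *\<^sub>R x)) (at 0)"
      by (simp add: scaleR_add_right mult.commute)
  qed
qed

locale profile =
  fixes a :: "real ^ 'n::finite \<Rightarrow> real" and a' :: "'n \<Rightarrow> real ^ 'n \<Rightarrow> real" and K :: real
  assumes dim: "3 \<le> CARD('n)"
    and a: "line_C1 a a'" and pos: "\<And>x. 0 < a x" and bnd: "\<And>x. a x \<le> K"
    and sq: "integrable lborel (\<lambda>x. (a x)\<^sup>2)" and sq': "\<And>i. integrable lborel (\<lambda>x. (a' i x)\<^sup>2)"
begin

lemma a_cont: "continuous_on UNIV a"
  using a by (simp add: line_C1_def)

lemma a_measurable [measurable]: "a \<in> borel_measurable borel"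
  using line_C1_measurable(1)[OF a] .

lemma powr_integrable:
  assumes "2 \<le> r" shows "integrable lborel (\<lambda>x. a x powr r)"
proof (rule Bochner_Integration.integrable_bound)
  show "integrable lborel (\<lambda>x. K powr (r - 2) * (a x)\<^sup>2)" using sq by simp
  have "a x powr r \<le> K powr (r - 2) * (a x)\<^sup>2" for x
  proof -
    have "a x powr (r - 2) \<le> K powr (r - 2)" using pos[of x] bnd[of x] assms by (intro powr_mono2) auto
    moreover have "a x powr r = a x powr (r - 2) * (a x)\<^sup>2"
      using pos[of x] powr_add[of "a x" "r - 2" 2] by simp
    ultimately show ?thesis by (simp add: mult_right_mono)
  qed
  then show "AE x in lborel. norm (a x powr r) \<le> norm (K powr (r - 2) * (a x)\<^sup>2)" by (intro AE_I2) simp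
qed measurable

lemma powr_integral_pos: "2 \<le> r \<Longrightarrow> 0 < (LINT x|lborel. a x powr r)"
proof (rule integral_pos_everywhere[OF powr_integrable])
  show "0 < a x powr r" for x using pos[of x] by simp
qed

lemma dilation_powr_integral:
  assumes "0 < s" "0 < l"
  shows "(LINT x|lborel. (s * a (l *\<^sub>R x)) powr r) = s powr r * (LINT x|lborel. a x powr r) / l powr real CARD('n)"
proof -
  have "(LINT x|lborel. a x powr r) = l ^ CARD('n) * (LINT x|lborel. a (l *\<^sub>R x) powr r)"
    by (rule integral_lborel_scale(1)[OF _ assms(2)]) measurable
  then show ?thesis using assms pos by (simp add: powr_mult powr_realpow less_imp_le)
qed

lemma dilation_gradient:
  assumes "0 < s" "0 < l"
  shows "integrable lborel (\<lambda>x. (s * (l * a' i (l *\<^sub>R x)))\<^sup>2)"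
    and "(LINT x|lborel. (\<Sum>i\<in>UNIV. (s * (l * a' i (l *\<^sub>R x)))\<^sup>2))
      = s\<^sup>2 * l\<^sup>2 * (LINT x|lborel. (\<Sum>i\<in>UNIV. (a' i x)\<^sup>2)) / l powr real CARD('n)"
proof -
  have [measurable]: "a' i \<in> borel_measurable borel" for i by (rule line_C1_measurable(2)[OF a])
  have "integrable lborel (\<lambda>x. (a' i (l *\<^sub>R x))\<^sup>2)" for i
    by (rule integral_lborel_scale(2)[OF _ assms(2) sq']) measurable
  then show "integrable lborel (\<lambda>x. (s * (l * a' i (l *\<^sub>R x)))\<^sup>2)" by (simp add: power_mult_distrib)
  have "(LINT x|lborel. (\<Sum>i\<in>UNIV. (a' i x)\<^sup>2)) = l ^ CARD('n) * (LINT x|lborel. (\<Sum>i\<in>UNIV. (a' i (l *\<^sub>R x))\<^sup>2))"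
    by (rule integral_lborel_scale(1)[OF _ assms(2)]) measurable
  moreover have "(LINT x|lborel. (\<Sum>i\<in>UNIV. (s * (l * a' i (l *\<^sub>R x)))\<^sup>2)) = s\<^sup>2 * l\<^sup>2 * (LINT x|lborel. (\<Sum>i\<in>UNIV. (a' i (l *\<^sub>R x))\<^sup>2))"
    by (simp add: power_mult_distrib mult.assoc flip: sum_distrib_left)
  ultimately show "(LINT x|lborel. (\<Sum>i\<in>UNIV. (s * (l * a' i (l *\<^sub>R x)))\<^sup>2))
      = s\<^sup>2 * l\<^sup>2 * (LINT x|lborel. (\<Sum>i\<in>UNIV. (a' i x)\<^sup>2)) / l powr real CARD('n)"
    using assms(2) by (simp add: powr_realpow)
qed

lemma real_in_sobolev_H1: "(\<lambda>x. complex_of_real (a x)) \<in> sobolev_H1"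
proof -
  have w: "has_weak_gradient (\<lambda>x. complex_of_real (a x)) (\<lambda>x. \<chi> i. complex_of_real (a' i x))"
    by (rule line_C1_weak_gradient[OF a])
  then have [measurable]: "(\<lambda>x. complex_of_real (a x)) \<in> borel_measurable lebesgue"
    "(\<lambda>x. \<chi> i. complex_of_real (a' i x)) \<in> borel_measurable lebesgue"
    by (auto simp: has_weak_gradient_def intro: locally_integrable_measurable)
  have "integrable lebesgue (\<lambda>x. (a x)\<^sup>2)"
    using sq by (subst integrable_completion) auto
  then have "in_Lp 2 (\<lambda>x. complex_of_real (a x))"
    unfolding in_Lp_def norm_powr_2 by simp
  moreover have "integrable lebesgue (\<lambda>x. \<Sum>i\<in>UNIV. (a' i x)\<^sup>2)"
  proof -
    have "integrable lborel (\<lambda>x. \<Sum>i\<in>UNIV. (a' i x)\<^sup>2)" using sq' by auto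
    then show ?thesis by (subst integrable_completion) auto
  qed
  then have "in_Lp 2 (\<lambda>x. \<chi> i. complex_of_real (a' i x))"
    unfolding in_Lp_def norm_powr_2 by (simp add: norm_sq_complex_vec)
  ultimately show ?thesis using w by (auto simp: sobolev_H1_def)
qed

lemma energy_of_profile:
  assumes c: "0 < c"
  defines "n \<equiv> real CARD('n)"
    and "M \<equiv> LINT x|lborel. (a x)\<^sup>2" and "A \<equiv> LINT x|lborel. (\<Sum>i\<in>UNIV. (a' i x)\<^sup>2)"
    and "B \<equiv> LINT x|lborel. a x powr two_lower CARD('n)" and "C \<equiv> LINT x|lborel. a x powr two_upper CARD('n)"
  shows "\<exists>u\<in>constraint_set c. energy (u :: real ^ 'n \<Rightarrow> complex)
    = (A + n / (n + 2) * (c / M) powr (2 / n) * B) powr (n / 2) * C powr (- (n - 2) / 2) / n"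
    and "0 < M" "0 \<le> A" "0 < B" "0 < C"
proof -
  let ?p = "two_upper CARD('n)" and ?q = "two_lower CARD('n)"
  have n: "3 \<le> n" using dim by (simp add: n_def)
  have p: "?p = 2 * n / (n - 2)" "2 < ?p" using two_upper_eq[OF dim] two_upper_gt[OF dim] by (auto simp: n_def)
  have q: "?q = 2 * (n + 2) / n" "2 < ?q" using exponents[OF dim] by (auto simp: n_def)
  have a2: "a x powr 2 = (a x)\<^sup>2" for x using pos[of x] by simp
  show M: "0 < M" using powr_integral_pos[of 2] by (simp add: M_def a2)
  show A: "0 \<le> A" unfolding A_def by (intro Bochner_Integration.integral_nonneg sum_nonneg) auto
  show B: "0 < B" unfolding B_def using q by (intro powr_integral_pos) simp
  show C: "0 < C" unfolding C_def using p by (intro powr_integral_pos) simp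
  define t where "t = c / M"
  have t: "0 < t" using c M by (simp add: t_def)
  define A2 where "A2 = A + n / (n + 2) * t powr (2 / n) * B"
  have A2: "0 < A2" unfolding A2_def using A B n t by (intro add_nonneg_pos mult_pos_pos divide_pos_pos) auto
  define C1 where "C1 = t powr (?p / 2) * C"
  have C1: "0 < C1" using t C by (simp add: C1_def)
  define l where "l = (t * A2 / C1) powr (1 / (?p - 2))"
  have l: "0 < l" using t A2 C1 by (simp add: l_def)
  \<comment> \<open>Chosen so that s^2 / l^n = t = c / M, which sets the mass to
    \<open>c\<close>.\<close>
  define s where "s = l powr (n / 2) * t powr (1 / 2)"
  have s: "0 < s" using l t by (simp add: s_def)
  have s_powr: "s powr r / l powr n = l powr (n / 2 * r - n) * t powr (r / 2)" for r
    using l t by (simp add: s_def powr_mult powr_powr powr_diff)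
  interpret D: profile "\<lambda>x. s * a (l *\<^sub>R x)" "\<lambda>i x. s * (l * a' i (l *\<^sub>R x))" "s * K"
  proof
    show "integrable lborel (\<lambda>x. (s * a (l *\<^sub>R x))\<^sup>2)"
      using integral_lborel_scale(2)[OF _ l sq] by (simp add: power_mult_distrib)
  qed (use dim line_C1_dilation[OF a] pos bnd s dilation_gradient(1)[OF s l] in auto)
  let ?u = "\<lambda>x. complex_of_real (s * a (l *\<^sub>R x))"
  have E: "(Lp_norm 2 (weak_gradient ?u))\<^sup>2 = l\<^sup>2 * (t * A)"
  proof -
    have "(Lp_norm 2 (weak_gradient ?u))\<^sup>2 = s\<^sup>2 / l powr n * (l\<^sup>2 * A)"
      using line_C1_gradient_norm[OF D.a] dilation_gradient(2)[OF s l] by (simp add: A_def n_def)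
    also have "s\<^sup>2 / l powr n = t" using s_powr[of 2] s l t by simp
    finally show ?thesis by (simp only: mult_ac)
  qed
  have Lr: "Lp_norm r ?u powr r = l powr (n / 2 * r - n) * t powr (r / 2) * (LINT x|lborel. a x powr r)" if "0 < r" for r
  proof -
    have "Lp_norm r ?u powr r = (LINT x|lborel. (s * a (l *\<^sub>R x)) powr r)"
      by (rule Lp_norm_of_real[OF D.a_cont D.pos that])
    also have "\<dots> = s powr r / l powr n * (LINT x|lborel. a x powr r)"
      using dilation_powr_integral[OF s l, of r] by (simp add: n_def)
    finally show ?thesis unfolding s_powr .
  qed
  have "(Lp_norm 2 ?u)\<^sup>2 = Lp_norm 2 ?u powr 2"
  proof -
    have "0 \<le> Lp_norm 2 ?u" by (simp add: Lp_norm_def)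
    then show ?thesis by (cases "Lp_norm 2 ?u = 0") (auto simp: powr_realpow)
  qed
  then have mass: "mass ?u = c"
    using Lr[of 2] l t M c by (simp add: mass_def a2 M_def[symmetric] t_def)
  have Bu: "Lp_norm ?q ?u powr ?q = l\<^sup>2 * (t * t powr (2 / n) * B)"
  proof -
    have e: "n / 2 * ?q - n = 2" "?q / 2 = 1 + 2 / n" using n unfolding q(1) by (auto simp: field_simps)
    have "0 < ?q" using q(2) by simp
    from Lr[OF this] have "Lp_norm ?q ?u powr ?q = l powr 2 * (t powr 1 * t powr (2 / n)) * B"
      unfolding e B_def[symmetric] powr_add .
    then show ?thesis using l t by simp
  qed
  have Cu: "Lp_norm ?p ?u powr ?p = l powr ?p * C1"
  proof -
    have e: "n / 2 * ?p - n = ?p" using n unfolding p(1) by (auto simp: field_simps)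
    have "0 < ?p" using p(2) by simp
    from Lr[OF this] show ?thesis unfolding e C1_def C_def[symmetric] by simp
  qed
  have "l powr ?p = l powr 2 * l powr (?p - 2)" by (simp flip: powr_add)
  also have "l powr (?p - 2) = t * A2 / C1" using p t A2 C1 by (simp add: l_def powr_powr)
  finally have lp: "l powr ?p * C1 = l\<^sup>2 * (t * A2)" using l C1 by simp
  have "virial ?u = l\<^sup>2 * (t * A) + n / (n + 2) * (l\<^sup>2 * (t * t powr (2 / n) * B)) - l powr ?p * C1"
    unfolding virial_def E Bu Cu by (simp add: n_def)
  then have K0: "virial ?u = 0" unfolding lp A2_def by (simp add: algebra_simps)
  have "?u \<in> constraint_set c"
    using D.real_in_sobolev_H1 mass K0 by (simp add: constraint_set_def)
  moreover have "energy ?u = l powr ?p * C1 / n"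
    using constraint_energy[OF dim K0] Lp_norm_powr[of ?p ?u] Cu p by (simp add: n_def)
  moreover have "l powr ?p * C1 = A2 powr (n / 2) * C powr (- (n - 2) / 2)"
  proof -
    have e: "1 / (?p - 2) * ?p = n / 2" using n unfolding p(1) by (auto simp: field_simps)
    have "l powr ?p * C1 = (t * A2 / C1) powr (n / 2) * C1 powr 1"
      unfolding l_def powr_powr e using C1 by simp
    also have "\<dots> = t powr (n / 2) * A2 powr (n / 2) * C1 powr (1 - n / 2)"
      using t A2 C1 by (simp add: powr_mult powr_divide powr_diff)
    also have "C1 powr (1 - n / 2) = t powr (?p / 2 * (1 - n / 2)) * C powr (1 - n / 2)"
      using t C by (simp add: C1_def powr_mult powr_powr)
    also have "?p / 2 * (1 - n / 2) = - (n / 2)" using n unfolding p(1) by (auto simp: field_simps)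
    also have "1 - n / 2 = - (n - 2) / 2" by (simp add: field_simps)
    finally show ?thesis using t by (simp add: powr_minus)
  qed
  ultimately show "\<exists>u\<in>constraint_set c. energy (u :: real ^ 'n \<Rightarrow> complex)
    = (A + n / (n + 2) * (c / M) powr (2 / n) * B) powr (n / 2) * C powr (- (n - 2) / 2) / n"
    unfolding A2_def t_def by (intro bexI[of _ ?u]) auto
qed

end


section \<open>Trial functions\<close>

lemma line_C1_add_const:
  assumes "line_C1 a a'" shows "line_C1 (\<lambda>x. a x + r) a'"
proof -
  have "((\<lambda>s. a (x + s *\<^sub>R axis i 1) + r) has_real_derivative a' i x) (at 0)" for i x
    using DERIV_add[of "\<lambda>s. a (x + s *\<^sub>R axis i 1)" "a' i x" 0 UNIV "\<lambda>_. r" 0] assms by (simp add: line_C1_def)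
  then show ?thesis using assms by (auto simp: line_C1_def intro!: continuous_intros)
qed

text \<open>A bound independent of \<open>c\<close>, in contrast to
  \<open>bracket_deriv_bound\<close>: the derivative is at most of order 1 / |x| for every
  \<open>c\<close> in the given range. It provides the dominating function when the cutoff is
  removed from the ground state.\<close>

lemma bracket_deriv_uniform:
  fixes x :: "real ^ 'n::finite"
  assumes c: "0 < c" "c \<le> 1" and b: "0 \<le> b"
  shows "\<bar>bracket_deriv c (- b) i x\<bar> \<le> 2 * b * bracket 1 (- 1 / 2) x"
proof -
  define y where "y = 1 + c * (norm x)\<^sup>2"
  define z where "z = sqrt (1 + (norm x)\<^sup>2)"
  have y: "1 \<le> y" using c by (simp add: y_def)
  have z: "0 < z" "z\<^sup>2 = 1 + (norm x)\<^sup>2" by (auto simp: z_def add_pos_nonneg)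
  have "\<bar>x $ i\<bar> \<le> z"
    using component_le_norm_cart[of x i] real_le_rsqrt[of "norm x" "1 + (norm x)\<^sup>2"] by (simp add: z_def)
  then have "c * \<bar>x $ i\<bar> * z \<le> c * z * z" using c z by (intro mult_right_mono mult_left_mono) auto
  also have "\<dots> = c * (1 + (norm x)\<^sup>2)" using z by (simp add: power2_eq_square)
  also have "\<dots> \<le> y" using c by (simp add: y_def algebra_simps)
  finally have "c * \<bar>x $ i\<bar> \<le> y / z" using z by (simp add: field_simps)
  then have "y powr (- b - 1) * (c * \<bar>x $ i\<bar>) \<le> y powr (- b - 1) * (y / z)"
    by (intro mult_left_mono) auto
  also have "\<dots> = y powr (- b) / z" using y by (simp add: powr_diff)
  also have "\<dots> \<le> 1 / z" using y b z powr_mono[of "- b" 0 y] by (intro divide_right_mono) auto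
  also have "1 / z = bracket 1 (- 1 / 2) x"
    by (simp add: z_def bracket_def powr_minus powr_half_sqrt inverse_eq_divide add_nonneg_nonneg)
  finally have "y powr (- b - 1) * (c * \<bar>x $ i\<bar>) \<le> bracket 1 (- 1 / 2) x" .
  then have "2 * b * (y powr (- b - 1) * (c * \<bar>x $ i\<bar>)) \<le> 2 * b * bracket 1 (- 1 / 2) x"
    using b by (intro mult_left_mono) auto
  moreover have "\<bar>bracket_deriv c (- b) i x\<bar> = 2 * b * (y powr (- b - 1) * (c * \<bar>x $ i\<bar>))"
    using b c by (simp add: bracket_deriv_def y_def abs_mult)
  ultimately show ?thesis by simp
qed

text \<open>The weight \<theta> keeps the constant of the main term close to one, so that the limit
  of the energies is not spoiled.\<close>

lemma square_sum_le: "0 < \<theta> \<Longrightarrow> ((u::real) + v)\<^sup>2 \<le> (1 + \<theta>) * u\<^sup>2 + (1 + 1 / \<theta>) * v\<^sup>2"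
proof -
  assume \<theta>: "0 < \<theta>"
  have "(1 + \<theta>) * u\<^sup>2 + (1 + 1 / \<theta>) * v\<^sup>2 - (u + v)\<^sup>2 = (\<theta> * u - v)\<^sup>2 / \<theta>"
    using \<theta> by (simp add: field_simps power2_eq_square)
  moreover have "0 \<le> (\<theta> * u - v)\<^sup>2 / \<theta>" using \<theta> by simp
  ultimately show ?thesis by linarith
qed

lemma powr_sum_le:
  assumes "0 \<le> u" "0 \<le> v" "0 \<le> r"
  shows "((u::real) + v) powr r \<le> 2 powr r * (u powr r + v powr r)"
proof -
  have "(u + v) powr r \<le> (2 * max u v) powr r" using assms by (intro powr_mono2) auto
  also have "\<dots> = 2 powr r * max u v powr r" using assms by (simp add: powr_mult)
  also have "max u v powr r \<le> u powr r + v powr r" by (auto simp: max_def)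
  finally show ?thesis by simp
qed

text \<open>
  The ground state is multiplied by a slowly varying cutoff.  The small constant \<open>\<eta>\<close> adds a low
  and wide plateau, whose mass tends to infinity while its contributions to the gradient and to
  the \<open>two_lower\<close>-norm stay negligible; this is needed because the ground state itself has finite
  mass for \<open>d \<ge> 5\<close>.
\<close>

locale trial =
  fixes n :: real and W :: "real ^ 'n::finite \<Rightarrow> real" and W' :: "'n \<Rightarrow> real ^ 'n \<Rightarrow> real"
  assumes dim: "3 \<le> CARD('n)" and n_eq: "n = real CARD('n)"
    and W_eq: "W = bracket (ground_scale CARD('n)) (- (n - 2) / 2)"
    and W'_eq: "W' = bracket_deriv (ground_scale CARD('n)) (- (n - 2) / 2)"
begin

lemma n3: "3 \<le> n" using dim n_eq by simp

definition eps :: "nat \<Rightarrow> real" where "eps m = 1 / real (Suc m)"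
text \<open>The plateau has height eta and extends over volume eps^-n. The exponent (n - 1)/2 makes
  its mass eta^2 eps^-n = 1/eps blow up, its gradient term eta^2 eps^2 eps^-n = eps vanish, and its
  lower-order term, of size eps^(1 - 2/n), stay bounded.\<close>

definition eta :: "nat \<Rightarrow> real" where "eta m = eps m powr ((n - 1) / 2)"
definition cut :: "nat \<Rightarrow> real ^ 'n \<Rightarrow> real" where "cut m = bracket (1 / (real (Suc m))\<^sup>2) (- n)"
definition cut' :: "nat \<Rightarrow> 'n \<Rightarrow> real ^ 'n \<Rightarrow> real" where "cut' m = bracket_deriv (1 / (real (Suc m))\<^sup>2) (- n)"
definition J :: "real \<Rightarrow> real" where "J b = (LINT x|lborel. bracket 1 (- b) (x :: real ^ 'n))"

lemma eps: "0 < eps m" "eps m \<le> 1" "1 / (real (Suc m))\<^sup>2 = (eps m)\<^sup>2"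
  by (auto simp: eps_def power_divide)

lemma eps_sq: "0 < 1 / (real (Suc m))\<^sup>2" "1 / (real (Suc m))\<^sup>2 \<le> 1" "sqrt (1 / (real (Suc m))\<^sup>2) = eps m"
  unfolding eps(3) using eps[of m] by (auto simp: power_le_one)

lemma eps_lim: "eps \<longlonglongrightarrow> 0"
  using LIMSEQ_inverse_real_of_nat by (simp add: eps_def[abs_def] inverse_eq_divide del: of_nat_Suc)

lemma eta: "0 < eta m" "eta m \<le> 1"
  unfolding eta_def using eps[of m] n3 powr_mono'[of 0 "(n - 1) / 2" "eps m"] by auto

lemma eta_sq: "(eta m)\<^sup>2 = eps m powr (n - 1)"
  by (simp add: eta_def power2_eq_square powr_add[symmetric])

lemma cut: "0 < cut m x" "cut m x \<le> 1"
  unfolding cut_def using eps_sq(1)[of m] n3 by (auto intro!: bracket_pos bracket_le_1 simp del: of_nat_Suc)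

lemma cut'_le: "\<bar>cut' m i x\<bar> \<le> n * eps m * cut m x"
  using bracket_deriv_bound[of "1 / (real (Suc m))\<^sup>2" "- n" i x] eps_sq[of m] n3 unfolding cut_def cut'_def by simp

lemma cut'_uniform: "\<bar>cut' m i x\<bar> \<le> 2 * n * bracket 1 (- 1 / 2) x"
  unfolding cut'_def using eps_sq[of m] n3 by (intro bracket_deriv_uniform) auto

lemma cut_C1: "line_C1 (cut m) (cut' m)"
  unfolding cut_def cut'_def using eps_sq(1)[of m] by (intro line_C1_bracket) simp

lemma cut_integral:
  assumes "n / 2 < b"
  shows "integrable lborel (\<lambda>x. bracket (1 / (real (Suc m))\<^sup>2) (- b) (x :: real ^ 'n))"
    and "(LINT x|lborel. bracket (1 / (real (Suc m))\<^sup>2) (- b) (x :: real ^ 'n)) = J b / eps m powr n"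
proof -
  show "integrable lborel (\<lambda>x. bracket (1 / (real (Suc m))\<^sup>2) (- b) (x :: real ^ 'n))"
    using integrable_bracket_scaled[OF eps_sq(1), where 'n = 'n] assms by (simp add: n_eq)
  have "eps m ^ CARD('n) = eps m powr n" using eps[of m] by (simp add: n_eq powr_realpow)
  then show "(LINT x|lborel. bracket (1 / (real (Suc m))\<^sup>2) (- b) (x :: real ^ 'n)) = J b / eps m powr n"
    unfolding integral_bracket_scaled[OF eps_sq(1)] eps_sq(3) J_def by simp
qed

lemma cut_int: "integrable lborel (cut m)" "(LINT x|lborel. cut m x) = J n / eps m powr n"
  unfolding cut_def using cut_integral[of n m] n3 by simp_all

lemma J_pos: "n / 2 < b \<Longrightarrow> 0 < J b"
  unfolding J_def using integrable_bracket_1[of b, where 'n = 'n]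
  by (intro integral_pos_everywhere) (auto simp: n_eq bracket_pos)

lemma W_scale: "0 < ground_scale CARD('n)"
  by (rule ground_scale_pos[OF dim])

lemma W: "0 < W x" "W x \<le> 1"
  unfolding W_eq using W_scale n3 by (auto intro!: bracket_pos bracket_le_1)

lemma W_C1: "line_C1 W W'"
  unfolding W_eq W'_eq using W_scale by (intro line_C1_bracket) simp

lemma meas [measurable]: "W \<in> borel_measurable borel" "W' i \<in> borel_measurable borel"
  "cut m \<in> borel_measurable borel" "cut' m i \<in> borel_measurable borel"
  using line_C1_measurable[OF W_C1] line_C1_measurable[OF cut_C1] by auto

lemma W'_le: "\<bar>W' i x\<bar> \<le> (n - 2) / 2 * sqrt (ground_scale CARD('n))"
proof -
  have "\<bar>W' i x\<bar> \<le> \<bar>- (n - 2) / 2\<bar> * sqrt (ground_scale CARD('n)) * W x"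
    unfolding W'_eq W_eq using W_scale by (intro bracket_deriv_bound) simp
  also have "\<dots> \<le> \<bar>- (n - 2) / 2\<bar> * sqrt (ground_scale CARD('n)) * 1"
    using W[of x] W_scale by (intro mult_left_mono) auto
  finally show ?thesis using n3 by simp
qed

definition a :: "nat \<Rightarrow> real ^ 'n \<Rightarrow> real" where "a m x = (W x + eta m) * cut m x"
definition a' :: "nat \<Rightarrow> 'n \<Rightarrow> real ^ 'n \<Rightarrow> real" where "a' m i x = (W x + eta m) * cut' m i x + W' i x * cut m x"

lemma a_C1: "line_C1 (a m) (a' m)"
  unfolding a_def[abs_def] a'_def[abs_def] by (rule line_C1_mult[OF line_C1_add_const[OF W_C1] cut_C1])

lemma a_bounds: "0 < a m x" "a m x \<le> 2 * cut m x" "a m x \<le> 2"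
proof -
  show "0 < a m x" using W[of x] eta[of m] cut[of m x] by (simp add: a_def)
  show "a m x \<le> 2 * cut m x" unfolding a_def using W[of x] eta[of m] cut[of m x] by (intro mult_right_mono) auto
  then show "a m x \<le> 2" using cut[of m x] by simp
qed

lemma sq_cut_integrable:
  assumes [measurable]: "f \<in> borel_measurable borel" and f: "\<And>x. \<bar>f x\<bar> \<le> r * cut m x"
  shows "integrable lborel (\<lambda>x. (f x)\<^sup>2)"
proof (rule Bochner_Integration.integrable_bound)
  show "integrable lborel (\<lambda>x. r\<^sup>2 * cut m x)" using cut_int by simp
  have "(f x)\<^sup>2 \<le> r\<^sup>2 * cut m x" for x
  proof -
    have "(f x)\<^sup>2 \<le> (r * cut m x)\<^sup>2" using f[of x] by (simp add: abs_le_square_iff[symmetric])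
    also have "\<dots> \<le> r\<^sup>2 * cut m x"
      using cut[of m x] by (simp add: power_mult_distrib power2_eq_square[of "cut m x"] mult_left_mono mult_left_le)
    finally show ?thesis .
  qed
  then show "AE x in lborel. norm ((f x)\<^sup>2) \<le> norm (r\<^sup>2 * cut m x)"
    using cut by (intro AE_I2) (simp add: abs_mult less_imp_le)
qed measurable

sublocale prof: profile "a m" "a' m" 2 for m
proof
  have [measurable]: "a m \<in> borel_measurable borel" "a' m i \<in> borel_measurable borel" for i
    using line_C1_measurable[OF a_C1] by auto
  show "3 \<le> CARD('n)" by (rule dim)
  show "line_C1 (a m) (a' m)" by (rule a_C1)
  show "0 < a m x" "a m x \<le> 2" for x by (rule a_bounds)+
  show "integrable lborel (\<lambda>x. (a m x)\<^sup>2)"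
    by (rule sq_cut_integrable[where r = 2 and m = m]) (use a_bounds in \<open>auto simp: abs_of_pos\<close>)
  show "integrable lborel (\<lambda>x. (a' m i x)\<^sup>2)" for i
  proof (rule sq_cut_integrable[where r = "2 * n + (n - 2) / 2 * sqrt (ground_scale CARD('n))" and m = m])
    fix x
    have "\<bar>(W x + eta m) * cut' m i x\<bar> \<le> 2 * (n * 1 * cut m x)"
      unfolding abs_mult
    proof (rule mult_mono)
      show "\<bar>cut' m i x\<bar> \<le> n * 1 * cut m x"
      proof (rule order_trans[OF cut'_le])
        show "n * eps m * cut m x \<le> n * 1 * cut m x"
          using eps[of m] n3 cut[of m x] by (intro mult_right_mono mult_left_mono) auto
      qed
    qed (use W[of x] eta[of m] n3 cut[of m x] in auto)
    moreover have "\<bar>W' i x * cut m x\<bar> \<le> (n - 2) / 2 * sqrt (ground_scale CARD('n)) * cut m x"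
      unfolding abs_mult using W'_le[of i x] cut[of m x] by (intro mult_mono) auto
    ultimately show "\<bar>a' m i x\<bar> \<le> (2 * n + (n - 2) / 2 * sqrt (ground_scale CARD('n))) * cut m x"
      unfolding a'_def distrib_right using abs_triangle_ineq[of "(W x + eta m) * cut' m i x" "W' i x * cut m x"]
      unfolding distrib_right by linarith
  qed simp
qed

section \<open>Convergence of the gradient and of the critical norm along the trial
  functions\<close>

definition X :: real where "X = n * sobolev_energy CARD('n)"

lemma X_integral: "(LINT x|lborel. W x powr two_upper CARD('n)) = X"
  and X_integrable: "integrable lborel (\<lambda>x. W x powr two_upper CARD('n))"
proof -
  have "- (n - 2) / 2 * two_upper CARD('n) = - n" using n3 two_upper_eq[OF dim] by (simp add: n_eq field_simps)
  then have eq: "W x powr two_upper CARD('n) = bracket (ground_scale CARD('n)) (- n) x" for x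
    using W_scale by (simp add: W_eq bracket_powr)
  show "(LINT x|lborel. W x powr two_upper CARD('n)) = X"
    unfolding eq X_def unfolding n_eq by (rule ground_mass[OF dim])
  show "integrable lborel (\<lambda>x. W x powr two_upper CARD('n))"
    unfolding eq using integrable_bracket_scaled[OF W_scale, of n, where 'n = 'n] n3 by (simp add: n_eq)
qed

lemma X_pos: "0 < X"
proof -
  have "0 < W x powr two_upper CARD('n)" for x using W(1)[of x] by simp
  then show ?thesis unfolding X_integral[symmetric] by (intro integral_pos_everywhere X_integrable)
qed

definition P :: "nat \<Rightarrow> real" where
  "P m = (LINT x|lborel. (\<Sum>i\<in>UNIV. (W x * cut' m i x + W' i x * cut m x)\<^sup>2))"

text \<open>W decays like |x|^-(n - 2) and the derivative of the cutoff contributes 1/|x| uniformly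
  in \<open>m\<close>. The square decays like |x|^-(2n - 2), which is integrable as 2n - 2 >
  n.\<close>

lemma main_part_dominated:
  defines "r \<equiv> min 1 (ground_scale CARD('n)) powr (- (n - 2) / 2)"
  shows "(W x * cut' m i x + W' i x * cut m x)\<^sup>2 \<le> 2 * (r * (2 * n))\<^sup>2 * bracket 1 (- (n - 1)) x + 2 * (W' i x)\<^sup>2"
proof -
  have "W x \<le> r * bracket 1 (- (n - 2) / 2) x"
    unfolding W_eq r_def using W_scale n3 by (intro bracket_mono) auto
  then have "W x * \<bar>cut' m i x\<bar> \<le> (r * bracket 1 (- (n - 2) / 2) x) * (2 * n * bracket 1 (- 1 / 2) x)"
    using cut'_uniform[of m i x] bracket_pos[of 1 "- (n - 2) / 2" x] by (intro mult_mono) (auto simp: r_def)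
  also have "\<dots> = r * (2 * n) * (bracket 1 (- (n - 2) / 2) x * bracket 1 (- 1 / 2) x)" by simp
  finally have "(W x * \<bar>cut' m i x\<bar>)\<^sup>2 \<le> (r * (2 * n) * (bracket 1 (- (n - 2) / 2) x * bracket 1 (- 1 / 2) x))\<^sup>2"
    using W[of x] by (intro power_mono) auto
  also have "\<dots> = (r * (2 * n))\<^sup>2 * (bracket 1 (- (n - 2) / 2) x * bracket 1 (- 1 / 2) x)\<^sup>2"
    by (rule power_mult_distrib)
  also have "(bracket 1 (- (n - 2) / 2) x * bracket 1 (- 1 / 2) x)\<^sup>2 = bracket 1 (- (n - 1)) x"
  proof -
    have "- (n - 2) / 2 + - 1 / 2 + (- (n - 2) / 2 + - 1 / 2) = - (n - 1)" by (simp add: field_simps)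
    then show ?thesis unfolding bracket_def power2_eq_square powr_add[symmetric] by (simp only:)
  qed
  finally have "(W x * cut' m i x)\<^sup>2 \<le> (r * (2 * n))\<^sup>2 * bracket 1 (- (n - 1)) x"
    by (simp add: power_mult_distrib)
  moreover have "(W' i x * cut m x)\<^sup>2 \<le> (W' i x)\<^sup>2 * 1"
    unfolding power_mult_distrib using cut[of m x] by (intro mult_left_mono) (auto simp: power_le_one)
  moreover have "(W x * cut' m i x + W' i x * cut m x)\<^sup>2 \<le> 2 * (W x * cut' m i x)\<^sup>2 + 2 * (W' i x * cut m x)\<^sup>2"
    using square_sum_le[of 1 "W x * cut' m i x" "W' i x * cut m x"] by simp
  ultimately show ?thesis by simp
qed

lemma main_sum_dominated:
  "norm (\<Sum>i\<in>UNIV. (W x * cut' m i x + W' i x * cut m x)\<^sup>2)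
    \<le> (\<Sum>i\<in>(UNIV :: 'n set). 2 * (min 1 (ground_scale CARD('n)) powr (- (n - 2) / 2) * (2 * n))\<^sup>2 * bracket 1 (- (n - 1)) x + 2 * (W' i x)\<^sup>2)"
proof -
  have "norm (\<Sum>i\<in>UNIV. (W x * cut' m i x + W' i x * cut m x)\<^sup>2) = (\<Sum>i\<in>UNIV. (W x * cut' m i x + W' i x * cut m x)\<^sup>2)"
    by (simp add: sum_nonneg)
  then show ?thesis by (simp only:) (intro sum_mono main_part_dominated)
qed

lemma W'_sum: "integrable lborel (\<lambda>x. \<Sum>i\<in>UNIV. (W' i x)\<^sup>2)" "(LINT x|lborel. (\<Sum>i\<in>UNIV. (W' i x)\<^sup>2)) = X"
  unfolding W'_eq X_def unfolding n_eq by (rule ground_gradient[OF dim])+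

lemma dominating_integrable:
  "integrable lborel (\<lambda>x. \<Sum>i\<in>(UNIV :: 'n set). r * bracket 1 (- (n - 1)) x + 2 * (W' i x)\<^sup>2)"
proof -
  have "integrable lborel (\<lambda>x. \<Sum>i\<in>(UNIV :: 'n set). r * bracket 1 (- (n - 1)) (x :: real ^ 'n))"
    using integrable_bracket_1[of "n - 1", where 'n = 'n] n3 by (simp add: n_eq)
  then have "integrable lborel (\<lambda>x. (\<Sum>i\<in>(UNIV :: 'n set). r * bracket 1 (- (n - 1)) x) + 2 * (\<Sum>i\<in>(UNIV :: 'n set). (W' i x)\<^sup>2))"
    using W'_sum(1) by (intro Bochner_Integration.integrable_add integrable_mult_right)
  then show ?thesis by (simp add: sum.distrib sum_distrib_left)
qed

lemma main_part_integrable: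
  "integrable lborel (\<lambda>x. \<Sum>i\<in>UNIV. (W x * cut' m i x + W' i x * cut m x)\<^sup>2)"
proof (rule Bochner_Integration.integrable_bound[OF dominating_integrable])
  show "AE x in lborel. norm (\<Sum>i\<in>UNIV. (W x * cut' m i x + W' i x * cut m x)\<^sup>2)
    \<le> norm (\<Sum>i\<in>(UNIV :: 'n set). 2 * (min 1 (ground_scale CARD('n)) powr (- (n - 2) / 2) * (2 * n))\<^sup>2 * bracket 1 (- (n - 1)) x + 2 * (W' i x)\<^sup>2)"
    by (intro AE_I2 order_trans[OF main_sum_dominated]) (simp only: real_norm_def abs_ge_self)
qed measurable

lemma P_lim: "P \<longlonglongrightarrow> X"
proof -
  have "(\<lambda>m. LINT x|lborel. (\<Sum>i\<in>UNIV. (W x * cut' m i x + W' i x * cut m x)\<^sup>2)) \<longlonglongrightarrow> (LINT x|lborel. (\<Sum>i\<in>UNIV. (W' i x)\<^sup>2))"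
  proof (rule integral_dominated_convergence[OF _ _ dominating_integrable])
    show "AE x in lborel. (\<lambda>m. \<Sum>i\<in>UNIV. (W x * cut' m i x + W' i x * cut m x)\<^sup>2) \<longlonglongrightarrow> (\<Sum>i\<in>UNIV. (W' i x)\<^sup>2)"
    proof (rule AE_I2)
      fix x
      have "(\<lambda>m. \<Sum>i\<in>UNIV. (W x * cut' m i x + W' i x * cut m x)\<^sup>2) \<longlonglongrightarrow> (\<Sum>i\<in>UNIV. (W x * 0 + W' i x * 1)\<^sup>2)"
        unfolding cut_def cut'_def by (intro tendsto_intros bracket_cutoff_lim bracket_deriv_cutoff_lim)
      then show "(\<lambda>m. \<Sum>i\<in>UNIV. (W x * cut' m i x + W' i x * cut m x)\<^sup>2) \<longlonglongrightarrow> (\<Sum>i\<in>UNIV. (W' i x)\<^sup>2)" by simp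
    qed
    show "AE x in lborel. norm (\<Sum>i\<in>UNIV. (W x * cut' m i x + W' i x * cut m x)\<^sup>2)
      \<le> (\<Sum>i\<in>(UNIV :: 'n set). 2 * (min 1 (ground_scale CARD('n)) powr (- (n - 2) / 2) * (2 * n))\<^sup>2 * bracket 1 (- (n - 1)) x + 2 * (W' i x)\<^sup>2)" for m
      by (intro AE_I2 main_sum_dominated)
  qed measurable
  then show ?thesis unfolding P_def[abs_def] W'_sum(2) .
qed

text \<open>Separates the contribution of the truncated ground state from that of the plateau; only
  the derivative of the cutoff acts on the constant \<open>eta m\<close>.\<close>

lemma gradient_le:
  "(LINT x|lborel. (\<Sum>i\<in>UNIV. (a' m i x)\<^sup>2))
    \<le> (1 + sqrt (eps m)) * P m + (1 + 1 / sqrt (eps m)) * (n ^ 3 * J n * eps m)"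
proof -
  \<comment> \<open>A weight between 1 and eps: 1 + \<theta> tends to one, and the plateau term (1 +
    1/\<theta>) eps still tends to zero.\<close>
  let ?\<theta> = "sqrt (eps m)"
  have \<theta>: "0 < ?\<theta>" using eps[of m] by simp
  have pw: "(\<Sum>i\<in>UNIV. (a' m i x)\<^sup>2) \<le> (1 + ?\<theta>) * (\<Sum>i\<in>UNIV. (W x * cut' m i x + W' i x * cut m x)\<^sup>2)
      + (1 + 1 / ?\<theta>) * (n ^ 3 * (eta m)\<^sup>2 * (eps m)\<^sup>2 * cut m x)" for x
  proof -
    have "(a' m i x)\<^sup>2 \<le> (1 + ?\<theta>) * (W x * cut' m i x + W' i x * cut m x)\<^sup>2 + (1 + 1 / ?\<theta>) * (n\<^sup>2 * (eta m)\<^sup>2 * (eps m)\<^sup>2 * cut m x)" for i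
    proof -
      have "a' m i x = (W x * cut' m i x + W' i x * cut m x) + eta m * cut' m i x"
        by (simp add: a'_def algebra_simps)
      then have "(a' m i x)\<^sup>2 \<le> (1 + ?\<theta>) * (W x * cut' m i x + W' i x * cut m x)\<^sup>2 + (1 + 1 / ?\<theta>) * (eta m * cut' m i x)\<^sup>2"
        using square_sum_le[OF \<theta>] by simp
      moreover have "(eta m * cut' m i x)\<^sup>2 \<le> n\<^sup>2 * (eta m)\<^sup>2 * (eps m)\<^sup>2 * cut m x"
      proof -
        have "(cut' m i x)\<^sup>2 \<le> (n * eps m * cut m x)\<^sup>2" using cut'_le[of m i x] by (simp add: abs_le_square_iff[symmetric])
        also have "\<dots> \<le> n\<^sup>2 * (eps m)\<^sup>2 * cut m x"
          using cut[of m x] by (simp add: power_mult_distrib power2_eq_square[of "cut m x"] mult_left_mono mult_left_le)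
        finally have "(eta m)\<^sup>2 * (cut' m i x)\<^sup>2 \<le> (eta m)\<^sup>2 * (n\<^sup>2 * (eps m)\<^sup>2 * cut m x)" by (rule mult_left_mono) simp
        then show ?thesis by (simp add: power_mult_distrib mult_ac)
      qed
      then have "(1 + 1 / ?\<theta>) * (eta m * cut' m i x)\<^sup>2 \<le> (1 + 1 / ?\<theta>) * (n\<^sup>2 * (eta m)\<^sup>2 * (eps m)\<^sup>2 * cut m x)"
        using \<theta> by (intro mult_left_mono) auto
      ultimately show ?thesis by linarith
    qed
    then have "(\<Sum>i\<in>UNIV. (a' m i x)\<^sup>2) \<le> (\<Sum>i\<in>(UNIV :: 'n set). (1 + ?\<theta>) * (W x * cut' m i x + W' i x * cut m x)\<^sup>2 + (1 + 1 / ?\<theta>) * (n\<^sup>2 * (eta m)\<^sup>2 * (eps m)\<^sup>2 * cut m x))"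
      by (rule sum_mono)
    also have "\<dots> = (1 + ?\<theta>) * (\<Sum>i\<in>UNIV. (W x * cut' m i x + W' i x * cut m x)\<^sup>2) + n * ((1 + 1 / ?\<theta>) * (n\<^sup>2 * (eta m)\<^sup>2 * (eps m)\<^sup>2 * cut m x))"
      unfolding sum.distrib sum_distrib_left[symmetric] by (simp add: n_eq)
    also have "n * ((1 + 1 / ?\<theta>) * (n\<^sup>2 * (eta m)\<^sup>2 * (eps m)\<^sup>2 * cut m x)) = (1 + 1 / ?\<theta>) * (n ^ 3 * (eta m)\<^sup>2 * (eps m)\<^sup>2 * cut m x)"
      by (simp only: power3_eq_cube power2_eq_square mult_ac)
    finally show ?thesis .
  qed
  have "(LINT x|lborel. (\<Sum>i\<in>UNIV. (a' m i x)\<^sup>2)) \<le> (LINT x|lborel. (1 + ?\<theta>) * (\<Sum>i\<in>UNIV. (W x * cut' m i x + W' i x * cut m x)\<^sup>2)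
      + (1 + 1 / ?\<theta>) * (n ^ 3 * (eta m)\<^sup>2 * (eps m)\<^sup>2 * cut m x))"
    using pw by (intro integral_mono Bochner_Integration.integrable_add integrable_mult_right main_part_integrable cut_int(1) Bochner_Integration.integrable_sum prof.sq')
  also have "\<dots> = (1 + ?\<theta>) * P m + (1 + 1 / ?\<theta>) * (n ^ 3 * (eta m)\<^sup>2 * (eps m)\<^sup>2 * (J n / eps m powr n))"
    unfolding P_def cut_int(2)[symmetric]
    by (subst Bochner_Integration.integral_add) (intro integrable_mult_right main_part_integrable cut_int(1) | simp only: integral_mult_right_zero)+
  also have "n ^ 3 * (eta m)\<^sup>2 * (eps m)\<^sup>2 * (J n / eps m powr n) = n ^ 3 * J n * eps m"
  proof -
    have "(eps m)\<^sup>2 = eps m powr 2" using eps[of m] by simp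
    then have "(eta m)\<^sup>2 * (eps m)\<^sup>2 / eps m powr n = eps m powr (n - 1 + 2 - n)"
      by (simp only: eta_sq powr_add powr_diff)
    then have "(eta m)\<^sup>2 * (eps m)\<^sup>2 / eps m powr n = eps m" using eps[of m] by simp
    moreover have "n ^ 3 * (eta m)\<^sup>2 * (eps m)\<^sup>2 * (J n / eps m powr n) = n ^ 3 * J n * ((eta m)\<^sup>2 * (eps m)\<^sup>2 / eps m powr n)" by simp
    ultimately show ?thesis by simp
  qed
  finally show ?thesis .
qed

definition Q :: "nat \<Rightarrow> real" where
  "Q m = (LINT x|lborel. (W x * cut m x) powr two_upper CARD('n))"

lemma Q_integrable: "integrable lborel (\<lambda>x. (W x * cut m x) powr two_upper CARD('n))"
  and Q_dominated: "(W x * cut m x) powr two_upper CARD('n) \<le> W x powr two_upper CARD('n)"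
proof -
  show le: "(W x * cut m x) powr two_upper CARD('n) \<le> W x powr two_upper CARD('n)" for x
    using W[of x] cut[of m x] two_upper_gt[OF dim] by (intro powr_mono2) (auto simp: mult_left_le)
  show "integrable lborel (\<lambda>x. (W x * cut m x) powr two_upper CARD('n))"
    by (rule Bochner_Integration.integrable_bound[OF X_integrable]) (use le in auto)
qed

lemma Q_pos: "0 < Q m"
proof -
  have "0 < (W x * cut m x) powr two_upper CARD('n)" for x using W(1)[of x] cut(1)[of m x] by simp
  then show ?thesis unfolding Q_def by (intro integral_pos_everywhere Q_integrable)
qed

lemma Q_lim: "Q \<longlonglongrightarrow> X"
proof -
  have "(\<lambda>m. LINT x|lborel. (W x * cut m x) powr two_upper CARD('n)) \<longlonglongrightarrow> (LINT x|lborel. W x powr two_upper CARD('n))"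
  proof (rule integral_dominated_convergence[OF _ _ X_integrable])
    show "AE x in lborel. (\<lambda>m. (W x * cut m x) powr two_upper CARD('n)) \<longlonglongrightarrow> W x powr two_upper CARD('n)"
    proof (rule AE_I2)
      fix x
      have "(\<lambda>m. (W x * cut m x) powr two_upper CARD('n)) \<longlonglongrightarrow> (W x * 1) powr two_upper CARD('n)"
        unfolding cut_def using W[of x] by (intro tendsto_intros bracket_cutoff_lim) simp
      then show "(\<lambda>m. (W x * cut m x) powr two_upper CARD('n)) \<longlonglongrightarrow> W x powr two_upper CARD('n)" by simp
    qed
  qed (use Q_dominated in auto)
  then show ?thesis unfolding Q_def[abs_def] X_integral .
qed

lemma upper_norm_ge: "Q m \<le> (LINT x|lborel. a m x powr two_upper CARD('n))"
  unfolding Q_def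
proof (rule integral_mono[OF Q_integrable prof.powr_integrable])
  show "2 \<le> two_upper CARD('n)" using two_upper_gt[OF dim] by simp
  show "(W x * cut m x) powr two_upper CARD('n) \<le> a m x powr two_upper CARD('n)" for x
    unfolding a_def using W[of x] cut[of m x] eta[of m] two_upper_gt[OF dim]
    by (intro powr_mono2 mult_right_mono) auto
qed

text \<open>The plateau alone has this mass: dropping W leaves eta^2 times the square of the cutoff,
  and eta^2 = eps^(n - 1) against the volume factor eps^-n.\<close>

lemma mass_ge: "J (2 * n) / eps m \<le> (LINT x|lborel. (a m x)\<^sup>2)"
proof -
  have sq: "(cut m x)\<^sup>2 = bracket (1 / (real (Suc m))\<^sup>2) (- (2 * n)) x" for x
    by (simp add: cut_def bracket_def power2_eq_square powr_add[symmetric] del: of_nat_Suc)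
  have int: "integrable lborel (\<lambda>x. (cut m x)\<^sup>2)" "(LINT x|lborel. (cut m x)\<^sup>2) = J (2 * n) / eps m powr n"
    unfolding sq using cut_integral[of "2 * n" m] n3 by auto
  have "eps m powr (n - 1) / eps m powr n = 1 / eps m"
    using eps[of m] by (simp add: powr_diff)
  then have "J (2 * n) / eps m = (eta m)\<^sup>2 * (J (2 * n) / eps m powr n)"
    unfolding eta_sq by (metis mult.commute mult.right_neutral times_divide_eq_left times_divide_eq_right)
  also have "\<dots> = (LINT x|lborel. (eta m)\<^sup>2 * (cut m x)\<^sup>2)" using int by simp
  also have "\<dots> \<le> (LINT x|lborel. (a m x)\<^sup>2)"
  proof (rule integral_mono[OF _ prof.sq])
    show "integrable lborel (\<lambda>x. (eta m)\<^sup>2 * (cut m x)\<^sup>2)" using int by simp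
    fix x
    have "(eta m * cut m x)\<^sup>2 \<le> (a m x)\<^sup>2"
      unfolding a_def using W[of x] cut[of m x] eta[of m] by (intro power_mono mult_right_mono) auto
    then show "(eta m)\<^sup>2 * (cut m x)\<^sup>2 \<le> (a m x)\<^sup>2" by (simp add: power_mult_distrib)
  qed
  finally show ?thesis .
qed

section \<open>The lower-order term and the limit of the trial energies\<close>

definition B0 :: real where
  "B0 = 2 powr two_lower CARD('n) * ((LINT x|lborel. W x powr two_lower CARD('n)) + J n)"

lemma W_lower_integrable: "integrable lborel (\<lambda>x. W x powr two_lower CARD('n))"
proof -
  let ?b = "(n - 2) / 2 * two_lower CARD('n)"
  have q: "?b = n - 4 / n" using n3 exponents(1)[OF dim] by (simp add: n_eq field_simps power2_eq_square)
  \<comment> \<open>Integrability requires n - 4/n > n/2, that is n^2 > 8, which holds from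
    dimension three on.\<close>
  have "9 \<le> n * n" using n3 mult_mono[of 3 n 3 n] by simp
  then have "n / 2 < n - 4 / n" using n3 by (simp add: field_simps)
  then have "real CARD('n) / 2 < ?b" unfolding q by (simp add: n_eq)
  moreover have "W x powr two_lower CARD('n) = bracket (ground_scale CARD('n)) (- ?b) x" for x
  proof -
    have "- (n - 2) / 2 * two_lower CARD('n) = - ?b"
      by (simp only: mult_minus_left[symmetric] minus_divide_left)
    then show ?thesis using W_scale by (simp only: W_eq bracket_powr less_imp_le)
  qed
  ultimately show ?thesis using integrable_bracket_scaled[OF W_scale, of ?b, where 'n = 'n] by (simp only:)
qed

text \<open>Boundedness in \<open>m\<close> is enough: in the energy this term is multiplied by (c /
  M)^(2/n), which tends to zero because the mass \<open>M\<close> of the trial functions tends to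
  infinity.\<close>

lemma lower_norm_le: "(LINT x|lborel. a m x powr two_lower CARD('n)) \<le> B0"
proof -
  let ?q = "two_lower CARD('n)"
  have q: "2 < ?q" using exponents(4)[OF dim] .
  have "(LINT x|lborel. a m x powr ?q) \<le> (LINT x|lborel. 2 powr ?q * (W x powr ?q + eta m powr ?q * cut m x))"
  proof (rule integral_mono[OF prof.powr_integrable])
    show "2 \<le> ?q" using q by simp
    show "integrable lborel (\<lambda>x. 2 powr ?q * (W x powr ?q + eta m powr ?q * cut m x))"
      using W_lower_integrable cut_int(1) by (intro integrable_mult_right Bochner_Integration.integrable_add)
    fix x
    have "a m x \<le> W x + eta m * cut m x"
      using W[of x] cut[of m x] by (simp add: a_def distrib_right mult_left_le)
    then have "a m x powr ?q \<le> (W x + eta m * cut m x) powr ?q"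
      using a_bounds[of m x] q by (intro powr_mono2) auto
    also have "\<dots> \<le> 2 powr ?q * (W x powr ?q + (eta m * cut m x) powr ?q)"
      using W[of x] eta[of m] cut[of m x] q by (intro powr_sum_le) auto
    also have "(eta m * cut m x) powr ?q \<le> eta m powr ?q * cut m x"
      using eta[of m] cut[of m x] q powr_mono'[of 1 ?q "cut m x"] by (simp add: powr_mult mult_left_mono)
    finally show "a m x powr ?q \<le> 2 powr ?q * (W x powr ?q + eta m powr ?q * cut m x)"
      by (simp add: mult_left_mono)
  qed
  also have "\<dots> = 2 powr ?q * ((LINT x|lborel. W x powr ?q) + eta m powr ?q * (J n / eps m powr n))"
    unfolding cut_int(2)[symmetric] using W_lower_integrable cut_int(1) by simp
  also have "\<dots> \<le> B0"
  proof -
    have "(n - 1) / 2 * ?q - n = 1 - 2 / n"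
      using n3 exponents(1)[OF dim] by (simp add: n_eq field_simps power2_eq_square)
    then have "eta m powr ?q / eps m powr n = eps m powr (1 - 2 / n)"
      using eps[of m] by (simp add: eta_def powr_powr flip: powr_diff)
    also have "\<dots> \<le> 1" using eps[of m] n3 powr_mono'[of 0 "1 - 2 / n" "eps m"] by (simp add: field_simps)
    finally have "eta m powr ?q / eps m powr n * J n \<le> 1 * J n"
      using J_pos[of n] n3 by (intro mult_right_mono) auto
    then show ?thesis unfolding B0_def by (intro mult_left_mono add_left_mono) (auto simp: mult.commute)
  qed
  finally show ?thesis .
qed

text \<open>The energy formula of \<open>energy_of_profile\<close> with each ingredient replaced by
  its estimate, so that the limit is taken in an explicit expression.\<close>

definition bound :: "real \<Rightarrow> nat \<Rightarrow> real" where
  "bound c m = ((1 + sqrt (eps m)) * P m + (1 + 1 / sqrt (eps m)) * (n ^ 3 * J n * eps m)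
      + n / (n + 2) * (c / J (2 * n) * eps m) powr (2 / n) * B0) powr (n / 2) * Q m powr (- (n - 2) / 2) / n"

text \<open>The energy formula increases in the gradient and lower-order terms and decreases in the
  mass and in the critical norm, which matches the direction of every estimate.\<close>

lemma bound_attained:
  assumes c: "0 < c"
  shows "\<exists>u\<in>constraint_set c. energy (u :: real ^ 'n \<Rightarrow> complex) \<le> bound c m"
proof -
  define M where "M = (LINT x|lborel. (a m x)\<^sup>2)"
  define A where "A = (LINT x|lborel. (\<Sum>i\<in>UNIV. (a' m i x)\<^sup>2))"
  define B where "B = (LINT x|lborel. a m x powr two_lower CARD('n))"
  define D where "D = (LINT x|lborel. a m x powr two_upper CARD('n))"
  note en = prof.energy_of_profile[OF c, of m, folded n_eq, folded M_def A_def B_def D_def]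
  obtain u :: "real ^ 'n \<Rightarrow> complex" where u: "u \<in> constraint_set c"
    "energy u = (A + n / (n + 2) * (c / M) powr (2 / n) * B) powr (n / 2) * D powr (- (n - 2) / 2) / n"
    using en(1) by blast
  have J2: "0 < J (2 * n)" using n3 by (intro J_pos) simp
  have "c / M \<le> c / (J (2 * n) / eps m)"
    using mass_ge[of m] c J2 eps[of m] en(2) by (intro divide_left_mono) (auto simp: M_def)
  then have cM: "(c / M) powr (2 / n) \<le> (c / J (2 * n) * eps m) powr (2 / n)"
    using c en(2) n3 by (intro powr_mono2) auto
  have "n / (n + 2) * (c / M) powr (2 / n) * B \<le> n / (n + 2) * (c / J (2 * n) * eps m) powr (2 / n) * B0"
    using cM lower_norm_le[of m] en(4) n3 by (intro mult_mono mult_left_mono) (auto simp: B_def)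
  then have "A + n / (n + 2) * (c / M) powr (2 / n) * B \<le> (1 + sqrt (eps m)) * P m + (1 + 1 / sqrt (eps m)) * (n ^ 3 * J n * eps m)
      + n / (n + 2) * (c / J (2 * n) * eps m) powr (2 / n) * B0"
    using gradient_le[of m] by (simp add: A_def)
  then have 1: "(A + n / (n + 2) * (c / M) powr (2 / n) * B) powr (n / 2)
    \<le> ((1 + sqrt (eps m)) * P m + (1 + 1 / sqrt (eps m)) * (n ^ 3 * J n * eps m)
      + n / (n + 2) * (c / J (2 * n) * eps m) powr (2 / n) * B0) powr (n / 2)"
    using en(3,4) n3 by (intro powr_mono2) (auto intro!: add_nonneg_nonneg mult_nonneg_nonneg)
  have 2: "D powr (- (n - 2) / 2) \<le> Q m powr (- (n - 2) / 2)"
    using upper_norm_ge[of m] Q_pos[of m] n3 by (intro powr_mono2') (auto simp: D_def)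
  have "energy u \<le> bound c m"
    unfolding u(2) bound_def using 1 2 n3 by (intro divide_right_mono mult_mono) auto
  then show ?thesis using u(1) by blast
qed

lemma bound_lim:
  assumes c: "0 < c"
  shows "bound c \<longlonglongrightarrow> sobolev_energy CARD('n)"
proof -
  have J2: "0 < J (2 * n)" using n3 by (intro J_pos) simp
  have s: "(\<lambda>m. sqrt (eps m)) \<longlonglongrightarrow> 0" using tendsto_real_sqrt[OF eps_lim] by simp
  have t: "(\<lambda>m. (1 + 1 / sqrt (eps m)) * (n ^ 3 * J n * eps m)) \<longlonglongrightarrow> 0"
  proof -
    have "(\<lambda>m. n ^ 3 * J n * (eps m + sqrt (eps m))) \<longlonglongrightarrow> n ^ 3 * J n * (0 + 0)"
      by (intro tendsto_intros eps_lim s)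
    moreover have "(1 + 1 / sqrt (eps m)) * (n ^ 3 * J n * eps m) = n ^ 3 * J n * (eps m + sqrt (eps m))" for m
    proof -
      have "1 / sqrt (eps m) * eps m = sqrt (eps m)" using eps[of m] by (simp add: real_div_sqrt)
      moreover have "(1 + r) * (k * e) = k * (e + r * e)" for r k e :: real by (simp add: algebra_simps)
      ultimately show ?thesis by (simp only:)
    qed
    ultimately show ?thesis by (simp only:) simp
  qed
  have p: "(\<lambda>m. (c / J (2 * n) * eps m) powr (2 / n)) \<longlonglongrightarrow> 0"
  proof -
    have "(\<lambda>m. c / J (2 * n) * eps m) \<longlonglongrightarrow> c / J (2 * n) * 0" by (intro tendsto_intros eps_lim)
    then have "(\<lambda>m. (c / J (2 * n) * eps m) powr (2 / n)) \<longlonglongrightarrow> (c / J (2 * n) * 0) powr (2 / n)"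
      using n3 c J2 eps by (intro tendsto_powr' tendsto_const) (auto simp: less_imp_le)
    then show ?thesis by simp
  qed
  have "(\<lambda>m. (1 + sqrt (eps m)) * P m + (1 + 1 / sqrt (eps m)) * (n ^ 3 * J n * eps m)
      + n / (n + 2) * (c / J (2 * n) * eps m) powr (2 / n) * B0) \<longlonglongrightarrow> (1 + 0) * X + 0 + n / (n + 2) * 0 * B0"
    by (intro tendsto_add tendsto_mult tendsto_const s t p P_lim)
  then have "bound c \<longlonglongrightarrow> ((1 + 0) * X + 0 + n / (n + 2) * 0 * B0) powr (n / 2) * X powr (- (n - 2) / 2) / n"
    unfolding bound_def[abs_def] using X_pos n3 by (intro tendsto_divide tendsto_mult tendsto_powr tendsto_const Q_lim) auto
  moreover have "X powr (n / 2) * X powr (- (n - 2) / 2) = X"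
  proof -
    have "n / 2 + - (n - 2) / 2 = 1" by (simp add: field_simps)
    then show ?thesis using X_pos by (simp add: powr_add[symmetric])
  qed
  ultimately show ?thesis using n3 by (simp add: X_def)
qed

end

theorem proposition1p8:
  fixes c :: real
  assumes "CARD('n::finite) \<ge> 3" and "0 < c"
  shows "min_energy TYPE('n) c = ereal (critical_energy (ground_state :: real ^ 'n \<Rightarrow> complex))
    \<and> \<not> (\<exists>u \<in> (constraint_set c :: (real ^ 'n \<Rightarrow> complex) set).
            ereal (energy u) = min_energy TYPE('n) c)"
proof -
  let ?C = "constraint_set c :: (real ^ 'n \<Rightarrow> complex) set"
  let ?e = "sobolev_energy CARD('n)"
  interpret trial "real CARD('n)" "bracket (ground_scale CARD('n)) (- (real CARD('n) - 2) / 2) :: real ^ 'n \<Rightarrow> real"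
    "bracket_deriv (ground_scale CARD('n)) (- (real CARD('n) - 2) / 2)"
    using assms by unfold_locales auto
  have gt: "?e < energy u" if "u \<in> ?C" for u
    using energy_gt[OF assms that] .
  have "min_energy TYPE('n) c \<le> ereal (bound c m)" for m
    using bound_attained[OF assms(2), of m] unfolding min_energy_def by (meson INF_lower2 ereal_less_eq(3))
  then have "min_energy TYPE('n) c \<le> ereal ?e"
    using tendsto_lowerbound[of "\<lambda>m. ereal (bound c m)" "ereal ?e" sequentially] bound_lim[OF assms(2)] by simp
  moreover have "ereal ?e \<le> min_energy TYPE('n) c"
    unfolding min_energy_def using gt by (intro INF_greatest) (simp add: less_imp_le)
  ultimately have min: "min_energy TYPE('n) c = ereal ?e" by (rule antisym)
  have False if "u \<in> ?C" "ereal (energy u) = min_energy TYPE('n) c" for u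
    using gt[OF that(1)] that(2) unfolding min by simp
  then show ?thesis
    using min critical_energy_ground_state[OF assms(1)] by auto
qed


end
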